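(* Let $\alpha=\frac{M}{N}\pi$ for integers $M,N$ with $2M/N\notin\mathbb Z$, and let $\gamma=-2\cos(2\alpha)$. Then the series $t$, expressed as a formal power series in $\mathsf R=\mathsf R(t,\gamma)$ (i.e. the compositional inverse of $\mathsf R(t,\gamma)$), is D-finite: it satisfies a non-trivial linear differential equation in $\mathsf R$ with coefficients polynomial in $\mathsf R$.
   Context: $\mathsf R(t,\gamma)$ is defined as follows. Let $\theta(z,q)=2\sin(z)q^{1/8}\prod_{n\ge1}(1-2\cos(2z)q^n+q^{2n})(1-q^n)$, with derivatives in $z$. Let $q=q(t)=t+O(t^2)$ be the unique formal power series with zero constant term satisfying $t=\frac{\cos\alpha}{64\sin^3\alpha}\left(-\frac{\theta(\alpha,q)\theta'''(\alpha,q)}{\theta'(\alpha,q)^2}+\frac{\theta''(\alpha,q)}{\theta'(\alpha,q)}\right)$, and set $\mathsf R(t,\gamma)=\frac{\cos^2\alpha}{96\sin^4\alpha}\frac{\theta(\alpha,q)^2}{\theta'(\alpha,q)^2}\left(-\frac{\theta'''(\alpha,q)}{\theta'(\alpha,q)}+\frac{\theta'''(0,q)}{\theta'(0,q)}\right)$. Then $\mathsf R=t+O(t^2)$, so $t$ is a formal power series in $\mathsf R$. *)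

theory Defs
  imports "HOL-Analysis.Analysis" "HOL-Computational_Algebra.Computational_Algebra"
begin

(* theta(z,q) with the prefactor q^(1/8) removed (it cancels in every ratio used below),
   truncated to the factors n = 1..m; the coefficient of q^m of the infinite product
   equals the coefficient of q^m of this truncation. *)
definition theta_trunc :: "nat \<Rightarrow> real \<Rightarrow> real fps" where
  "theta_trunc m z = fps_const (2 * sin z) *
     (\<Prod>k\<in>{1..m}. (1 - fps_const (2 * cos (2 * z)) * fps_X ^ k + fps_X ^ (2 * k)) * (1 - fps_X ^ k))"

definition theta_coeff :: "nat \<Rightarrow> real \<Rightarrow> real" where
  "theta_coeff n z = theta_trunc n z $ n"

definition theta_d :: "nat \<Rightarrow> real \<Rightarrow> real fps" where
  "theta_d j a = Abs_fps (\<lambda>n. (deriv ^^ j) (theta_coeff n) a)"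

definition T_ser :: "real \<Rightarrow> real fps" where
  "T_ser \<alpha> = fps_const (cos \<alpha> / (64 * sin \<alpha> ^ 3)) *
     (- (theta_d 0 \<alpha> * theta_d 3 \<alpha> * inverse (theta_d 1 \<alpha> ^ 2))
      + theta_d 2 \<alpha> * inverse (theta_d 1 \<alpha>))"

definition R_of_q :: "real \<Rightarrow> real fps" where
  "R_of_q \<alpha> = fps_const (cos \<alpha> ^ 2 / (96 * sin \<alpha> ^ 4)) *
     (theta_d 0 \<alpha> ^ 2 * inverse (theta_d 1 \<alpha> ^ 2)) *
     (- (theta_d 3 \<alpha> * inverse (theta_d 1 \<alpha>)) + theta_d 3 0 * inverse (theta_d 1 0))"

definition q_of_t :: "real \<Rightarrow> real fps" where
  "q_of_t \<alpha> = fps_inv (T_ser \<alpha>)"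

definition R_ser :: "real \<Rightarrow> real fps" where
  "R_ser \<alpha> = R_of_q \<alpha> oo q_of_t \<alpha>"

definition t_of_R :: "real \<Rightarrow> real fps" where
  "t_of_R \<alpha> = fps_inv (R_ser \<alpha>)"

definition dfinite :: "real fps \<Rightarrow> bool" where
  "dfinite F \<longleftrightarrow> (\<exists>k (p :: nat \<Rightarrow> real poly). (\<exists>i\<le>k. p i \<noteq> 0) \<and>
      (\<Sum>i\<le>k. fps_of_poly (p i) * (fps_deriv ^^ i) F) = 0)"

end

theory Submission
  imports Defs
begin

text \<open>
  Let \<open>A = \<theta>'/\<theta>\<close> at \<open>\<alpha>\<close>. The Lambert series of \<open>A\<close> satisfies a symmetric product identity at
  arguments of sum zero, whose degenerate case is the heat equation; together they give the addition
  theorem \<open>(A(u) + A(v) - A(u + v))\<^sup>2 = \<wp>(u) + \<wp>(v) + \<wp>(u + v)\<close> and the derivatives of all these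
  series with respect to \<open>q\<close>. Up to constants \<open>T\<close> is \<open>q A\<^sub>q / A\<^sup>2\<close>, and \<open>R\<close> is a modular
  function of weight zero, polynomial in \<open>X = \<wp>/A\<^sup>2\<close> and \<open>Y = \<wp>'/A\<^sup>3\<close>. One finds
  \<open>dT/dR = a A\<close> and \<open>\<rho> dA/dR = b T\<close> with constants \<open>a\<close>, \<open>b\<close> and a polynomial \<open>\<rho>\<close> in \<open>X\<close>, \<open>Y\<close>, \<open>L\<close>,
  where \<open>L = (2 A(\<alpha>) - A(2\<alpha>)) / A\<close> is a normalised tangent slope; the ring generated by \<open>X\<close>, \<open>Y\<close>,
  \<open>L\<close> is stable under \<open>\<rho> d/dR\<close>.

  When \<open>\<alpha>\<close> is a torsion point, the chord construction on multiples of \<open>\<alpha>\<close> closes up. This yields an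
  algebraic relation between two generators of the field of \<open>X\<close>, \<open>Y\<close>, \<open>L\<close>; it is non-trivial because
  the cuspidal cubic has no torsion. Polynomials of degree at most \<open>W\<close> in \<open>X\<close>, \<open>Y\<close>, \<open>L\<close> therefore
  span a space of dimension \<open>O(W)\<close>, and counting dimensions produces a linear relation between the
  products \<open>R\<^sup>j d\<^sup>iT/dR\<^sup>i\<close>.\<close>

section \<open>Formal series in q whose coefficients are differentiable in a real argument\<close>

subsection \<open>Differentiating power series coefficientwise in a parameter\<close>

text \<open>Arguments are real and no convergence in q is used: a series in q depending on z is
  differentiated coefficient by coefficient. Comparing derivatives of two sides of an identity in z
  takes the place of arguments with poles and Liouville's theorem. The invariants of the curve never
  occur as such. The tangent slope stands in for them, since wp'' = - 2 slope wp'; this is why a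
  third generator L accompanies X and Y. Two objects obstruct the passage to algebraic functions.
  The series \<open>eis2\<close> is only quasi-modular, so it has to cancel from R, from dT/dR and
  from the derivatives of X, Y, L. The series A is not elliptic, so in general it is not algebraic
  over the coordinates of a point; at a torsion point the chord slopes along the multiples of
  \<alpha> telescope to a multiple of A, and this makes it so. The equation is not constructed. The
  number of products to be related grows quadratically and the dimension linearly, so neither the
  degree nor the irreducibility of the algebraic relation matters, only that it is non-trivial. That
  is checked by carrying along, with each series, the value of the same expression at one point of a
  degenerate curve.\<close>

definition has_coeff_deriv :: "(real \<Rightarrow> real fps) \<Rightarrow> real fps \<Rightarrow> real \<Rightarrow> bool" where
  "has_coeff_deriv F F' z \<longleftrightarrow> (\<forall>n. ((\<lambda>u. F u $ n) has_real_derivative F' $ n) (at z))"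

lemma has_coeff_deriv_const: "has_coeff_deriv (\<lambda>_. c) 0 z"
  by (simp add: has_coeff_deriv_def)

lemma has_coeff_deriv_fps_const:
  "(f has_real_derivative d) (at z) \<Longrightarrow> has_coeff_deriv (\<lambda>u. fps_const (f u)) (fps_const d) z"
  by (auto simp: has_coeff_deriv_def)

lemma has_coeff_deriv_add:
  "has_coeff_deriv F F' z \<Longrightarrow> has_coeff_deriv G G' z \<Longrightarrow>
    has_coeff_deriv (\<lambda>u. F u + G u) (F' + G') z"
  by (auto simp: has_coeff_deriv_def intro!: derivative_intros)

lemma has_coeff_deriv_diff:
  "has_coeff_deriv F F' z \<Longrightarrow> has_coeff_deriv G G' z \<Longrightarrow>
    has_coeff_deriv (\<lambda>u. F u - G u) (F' - G') z"
  by (auto simp: has_coeff_deriv_def intro!: derivative_intros)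

lemma has_coeff_deriv_minus:
  "has_coeff_deriv F F' z \<Longrightarrow> has_coeff_deriv (\<lambda>u. - F u) (- F') z"
  by (auto simp: has_coeff_deriv_def intro!: derivative_intros)

lemma has_coeff_deriv_mult:
  assumes "has_coeff_deriv F F' z" "has_coeff_deriv G G' z"
  shows "has_coeff_deriv (\<lambda>u. F u * G u) (F' * G z + F z * G') z"
  unfolding has_coeff_deriv_def
proof
  fix n
  have "((\<lambda>u. \<Sum>i=0..n. F u $ i * G u $ (n - i)) has_real_derivative
      (\<Sum>i=0..n. F' $ i * G z $ (n - i) + F z $ i * G' $ (n - i))) (at z)"
    using assms unfolding has_coeff_deriv_def
    by (auto intro!: derivative_eq_intros sum.cong simp: mult_ac)
  then show "((\<lambda>u. (F u * G u) $ n) has_real_derivative (F' * G z + F z * G') $ n) (at z)"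
    by (simp add: fps_mult_nth sum.distrib)
qed

lemma has_coeff_deriv_power2:
  assumes "has_coeff_deriv F F' z"
  shows "has_coeff_deriv (\<lambda>u. F u ^ 2) (2 * F z * F') z"
  using has_coeff_deriv_mult[OF assms assms] by (simp add: power2_eq_square algebra_simps)

lemma has_coeff_deriv_chain:
  assumes "has_coeff_deriv F F' (g z)" "(g has_real_derivative d) (at z)"
  shows "has_coeff_deriv (\<lambda>u. F (g u)) (fps_const d * F') z"
  unfolding has_coeff_deriv_def
proof
  fix n
  show "((\<lambda>u. F (g u) $ n) has_real_derivative (fps_const d * F') $ n) (at z)"
    using DERIV_chain2[of "\<lambda>u. F u $ n" "F' $ n" g z d] assms
    by (simp add: has_coeff_deriv_def mult.commute)
qed

lemma has_coeff_deriv_unique: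
  "has_coeff_deriv F F' z \<Longrightarrow> has_coeff_deriv F G' z \<Longrightarrow> F' = G'"
  by (auto simp: has_coeff_deriv_def fps_eq_iff intro: DERIV_unique)

lemma has_coeff_deriv_cong:
  assumes "has_coeff_deriv F F' z" "eventually (\<lambda>u. F u = G u) (nhds z)"
  shows "has_coeff_deriv G F' z"
  unfolding has_coeff_deriv_def
proof
  fix n
  have "eventually (\<lambda>u. F u $ n = G u $ n) (nhds z)"
    using assms(2) by eventually_elim simp
  then have "((\<lambda>u. F u $ n) has_real_derivative F' $ n) (at z) \<longleftrightarrow>
      ((\<lambda>u. G u $ n) has_real_derivative F' $ n) (at z)"
    by (intro DERIV_cong_ev) auto
  with assms(1) show "((\<lambda>u. G u $ n) has_real_derivative F' $ n) (at z)"
    unfolding has_coeff_deriv_def by blast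
qed

text \<open>This is how an identity gets differentiated: it need only hold near z, and conditions
  such as nonvanishing sines are open.\<close>

lemma has_coeff_deriv_unique_ev:
  assumes "eventually (\<lambda>u. F u = G u) (nhds z)" "has_coeff_deriv F F' z" "has_coeff_deriv G G' z"
  shows "F' = G'"
  using has_coeff_deriv_unique[OF has_coeff_deriv_cong[OF assms(2,1)] assms(3)] .

subsection \<open>The Euler operator\<close>

definition euler :: "real fps \<Rightarrow> real fps" where
  "euler F = fps_X * fps_deriv F"

lemma euler_nth: "euler F $ n = of_nat n * F $ n"
  by (cases n) (auto simp: euler_def)

lemma euler_add: "euler (F + G) = euler F + euler G"
  and euler_diff: "euler (F - G) = euler F - euler G"
  and euler_uminus: "euler (- F) = - euler F"
  and euler_const: "euler (fps_const c) = 0"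
  and euler_mult: "euler (F * G) = euler F * G + F * euler G"
  by (simp_all add: euler_def algebra_simps)

lemma euler_one: "euler 1 = 0" and euler_numeral: "euler (numeral k) = 0"
  by (simp_all add: euler_def)

lemma has_coeff_deriv_euler:
  "has_coeff_deriv F F' z \<Longrightarrow> has_coeff_deriv (\<lambda>u. euler (F u)) (euler F') z"
  by (auto simp: has_coeff_deriv_def euler_nth intro!: derivative_eq_intros)

section \<open>Lambert series and the symmetric product identity for three arguments of sum
  zero\<close>

subsection \<open>Lambert series\<close>

text \<open>The expansion of q^m / (1 - q^m) for positive m.\<close>

definition lambert :: "nat \<Rightarrow> real fps" where
  "lambert m = Abs_fps (\<lambda>n. if 0 < n \<and> m dvd n then 1 else 0)"

text \<open>Here and in \<open>cos_series\<close> the constant coefficient is 0: all numbers divide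
  0, and a sum over an infinite set is 0 by convention.\<close>

definition sin_series :: "real \<Rightarrow> real fps" where
  "sin_series z = Abs_fps (\<lambda>n. \<Sum>d | d dvd n. sin (2 * real d * z))"

definition cos_series :: "real \<Rightarrow> real fps" where
  "cos_series z = Abs_fps (\<lambda>n. \<Sum>d | d dvd n. real (n div d) * cos (2 * real d * z))"

definition log_deriv :: "real \<Rightarrow> real fps" where
  "log_deriv z = fps_const (cot z) + 4 * sin_series z"

text \<open>This is 8 q d/dq of log theta, the constant 1 coming from the prefactor q^(1/8); the
  heat equation then reads theta'' = - \<open>heat_pot\<close> * theta.\<close>

definition heat_pot :: "real \<Rightarrow> real fps" where
  "heat_pot z = 1 - 8 * (cos_series 0 + 2 * cos_series z)"

lemma fps_one_minus_X_power_nth: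
  assumes "m > 0"
  shows "((1 - fps_X ^ m) * (F :: real fps)) $ n = F $ n - (if n < m then 0 else F $ (n - m))"
proof -
  have "(1 - fps_X ^ m) * F = F - fps_X ^ m * F"
    by (simp add: algebra_simps)
  then show ?thesis
    by (simp add: fps_X_power_mult_nth)
qed

lemma lambert_eq:
  assumes "m > 0" shows "(1 - fps_X ^ m) * lambert m = fps_X ^ m"
proof (rule fps_ext)
  fix n
  show "((1 - fps_X ^ m) * lambert m) $ n = (fps_X ^ m :: real fps) $ n"
    unfolding fps_one_minus_X_power_nth[OF assms]
    using assms by (auto simp: lambert_def dvd_minus_self fps_X_power_nth dest: dvd_imp_le)
qed

lemma one_minus_X_power_neq_0:
  assumes "m > 0" shows "(1 - fps_X ^ m :: real fps) \<noteq> 0"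
proof
  assume eq: "(1 - fps_X ^ m :: real fps) = 0"
  have "(1 - fps_X ^ m :: real fps) $ 0 = 1"
    using assms by (simp add: fps_X_power_nth)
  then show False unfolding eq by simp
qed

text \<open>With x = q^m and y = q^n, this is 1 + x/(1-x) + y/(1-y) = (1-xy) / ((1-x)(1-y)). It is
  the relation that collapses the double sums below to single ones.\<close>

lemma lambert_mult:
  assumes "m > 0" "n > 0"
  shows "lambert m * lambert n = lambert (m + n) * (1 + lambert m + lambert n)"
proof -
  let ?d = "\<lambda>k. 1 - fps_X ^ k :: real fps"
  have e: "?d k * lambert k = fps_X ^ k" if "k > 0" for k
    using lambert_eq that by blast
  have "?d m * ?d n * ?d (m + n) * (lambert m * lambert n) =
      (?d m * lambert m) * (?d n * lambert n) * ?d (m + n)"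
    by (simp add: algebra_simps)
  also have "\<dots> = fps_X ^ (m + n) * (1 - fps_X ^ (m + n))"
    by (simp only: e[OF assms(1)] e[OF assms(2)]) (simp add: power_add)
  also have "\<dots> = (?d (m+n) * lambert (m+n)) * (?d m * ?d n + (?d m * lambert m) * ?d n + (?d n * lambert n) * ?d m)"
    using assms by (simp only: e) (simp add: power_add algebra_simps)
  also have "\<dots> = ?d m * ?d n * ?d (m + n) * (lambert (m + n) * (1 + lambert m + lambert n))"
    by (simp add: algebra_simps)
  finally show ?thesis
    using one_minus_X_power_neq_0 assms by simp
qed

text \<open>The sum equals q^m / (1 - q^m)^2. Squares left over from diagonal terms thus join linear
  terms to form \<open>cos_series\<close>.\<close>

lemma lambert_square_nth:
  assumes "m > 0"
  shows "(lambert m + lambert m ^ 2) $ n = (if 0 < n \<and> m dvd n then real (n div m) else 0)"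
proof -
  let ?d = "1 - fps_X ^ m :: real fps"
  let ?G = "Abs_fps (\<lambda>n. if 0 < n \<and> m dvd n then real (n div m) else 0)"
  have "?d * ?G = lambert m"
  proof (rule fps_ext)
    fix n
    show "(?d * ?G) $ n = lambert m $ n"
      unfolding fps_one_minus_X_power_nth[OF assms]
      using assms by (auto simp: lambert_def dvd_minus_self le_div_geq of_nat_diff dest: dvd_imp_le)
  qed
  moreover have "?d * (lambert m + lambert m ^ 2) = lambert m"
  proof -
    have "?d * (lambert m + lambert m ^ 2) = ?d * lambert m + (?d * lambert m) * lambert m"
      by (simp add: algebra_simps power2_eq_square)
    also have "\<dots> = fps_X ^ m + fps_X ^ m * lambert m"
      by (simp only: lambert_eq[OF assms])
    also have "\<dots> = ?d * lambert m + fps_X ^ m * lambert m"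
      by (simp only: lambert_eq[OF assms])
    finally show ?thesis by (simp add: algebra_simps)
  qed
  ultimately have "?d * (lambert m + lambert m ^ 2) = ?d * ?G" by simp
  then have "lambert m + lambert m ^ 2 = ?G"
    using one_minus_X_power_neq_0[OF assms] by simp
  then show ?thesis by simp
qed

subsection \<open>Congruence of power series modulo a power of the variable\<close>

text \<open>Working modulo q^(K+1) keeps the double sums over Lambert series finite, so they can be
  rearranged freely.\<close>

definition fps_cong :: "nat \<Rightarrow> real fps \<Rightarrow> real fps \<Rightarrow> bool" where
  "fps_cong K F G \<longleftrightarrow> (\<forall>n\<le>K. F $ n = G $ n)"

lemma fps_cong_refl [simp]: "fps_cong K F F"
  by (simp add: fps_cong_def)

lemma fps_cong_sym: "fps_cong K F G \<Longrightarrow> fps_cong K G F"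
  by (simp add: fps_cong_def)

lemma fps_cong_trans [trans]: "fps_cong K F G \<Longrightarrow> fps_cong K G H \<Longrightarrow> fps_cong K F H"
  by (simp add: fps_cong_def)

lemma fps_cong_add: "fps_cong K F F' \<Longrightarrow> fps_cong K G G' \<Longrightarrow> fps_cong K (F + G) (F' + G')"
  and fps_cong_diff: "fps_cong K F F' \<Longrightarrow> fps_cong K G G' \<Longrightarrow> fps_cong K (F - G) (F' - G')"
  by (simp_all add: fps_cong_def)

lemma fps_cong_mult: "fps_cong K F F' \<Longrightarrow> fps_cong K G G' \<Longrightarrow> fps_cong K (F * G) (F' * G')"
  by (simp add: fps_cong_def fps_mult_nth)

lemma fps_cong_sum: "(\<And>i. i \<in> I \<Longrightarrow> fps_cong K (F i) (G i)) \<Longrightarrow> fps_cong K (sum F I) (sum G I)"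
  by (simp add: fps_cong_def fps_sum_nth)

lemma sum_dvd_atMost:
  fixes f :: "nat \<Rightarrow> real"
  assumes "n \<le> K"
  shows "(\<Sum>d=1..K. f d * (if 0 < n \<and> d dvd n then g d else 0)) =
    (if n = 0 then 0 else (\<Sum>d | d dvd n. f d * g d))"
proof (cases "n = 0")
  case False
  have "(\<Sum>d=1..K. f d * (if 0 < n \<and> d dvd n then g d else 0)) =
      (\<Sum>d=1..K. if d dvd n then f d * g d else 0)"
    using False by (intro sum.cong) auto
  also have "\<dots> = (\<Sum>d \<in> {d \<in> {1..K}. d dvd n}. f d * g d)"
    by (rule sum.inter_filter[symmetric]) simp
  also have "{d \<in> {1..K}. d dvd n} = {d. d dvd n}"
    using False assms by (auto dest: dvd_imp_le intro: Nat.gr0I)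
  finally show ?thesis using False by simp
qed auto

lemma sin_series_cong:
  "fps_cong K (sin_series z) (\<Sum>m=1..K. fps_const (sin (2 * real m * z)) * lambert m)"
  unfolding fps_cong_def
proof (intro allI impI)
  fix n assume "n \<le> K"
  then show "sin_series z $ n = (\<Sum>m=1..K. fps_const (sin (2 * real m * z)) * lambert m) $ n"
    using sum_dvd_atMost[of n K "\<lambda>m. sin (2 * real m * z)" "\<lambda>_. 1"]
    by (auto simp: sin_series_def lambert_def fps_sum_nth)
qed

lemma cos_series_cong:
  "fps_cong K (cos_series z)
     (\<Sum>m=1..K. fps_const (cos (2 * real m * z)) * (lambert m + lambert m ^ 2))"
  unfolding fps_cong_def
proof (intro allI impI)
  fix n assume "n \<le> K"
  have "(\<Sum>m=1..K. fps_const (cos (2 * real m * z)) * (lambert m + lambert m ^ 2)) $ n =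
      (\<Sum>m=1..K. cos (2 * real m * z) * (if 0 < n \<and> m dvd n then real (n div m) else 0))"
    unfolding fps_sum_nth fps_mult_left_const_nth
    by (intro sum.cong refl) (subst lambert_square_nth, auto)
  then show "cos_series z $ n =
      (\<Sum>m=1..K. fps_const (cos (2 * real m * z)) * (lambert m + lambert m ^ 2)) $ n"
    using sum_dvd_atMost[OF \<open>n \<le> K\<close>, of "\<lambda>m. cos (2 * real m * z)" "\<lambda>m. real (n div m)"]
    by (auto simp: cos_series_def mult.commute)
qed

text \<open>The product starts at q^(g+h); this cuts a sum over a square of indices down to a
  triangle.\<close>

lemma lambert_mult_cong_0:
  assumes "g + h > K" shows "fps_cong K (lambert g * lambert h) 0"
  unfolding fps_cong_def
proof (intro allI impI)
  fix n assume "n \<le> K"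
  have "lambert g $ i * lambert h $ (n - i) = 0" if "i \<le> n" for i
  proof (rule ccontr)
    assume "lambert g $ i * lambert h $ (n - i) \<noteq> 0"
    then have "0 < i" "g dvd i" "0 < n - i" "h dvd n - i"
      by (auto simp: lambert_def split: if_splits)
    then have "g \<le> i" "h \<le> n - i" by (auto dest: dvd_imp_le)
    with assms \<open>n \<le> K\<close> \<open>i \<le> n\<close> show False by linarith
  qed
  then show "(lambert g * lambert h) $ n = (0 :: real fps) $ n"
    unfolding fps_mult_nth by (simp only: fps_zero_nth) (rule sum.neutral, simp)
qed

subsection \<open>The addition theorem\<close>

definition tri :: "nat \<Rightarrow> (nat \<times> nat) set" where
  "tri K = {(g, h). 1 \<le> g \<and> 1 \<le> h \<and> g + h \<le> K}"

lemma finite_tri [simp]: "finite (tri K)"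
  by (rule finite_subset[of _ "{..K} \<times> {..K}"]) (auto simp: tri_def)

lemma sum_tri_swap: "(\<Sum>(g, h)\<in>tri K. f g h) = (\<Sum>(g, h)\<in>tri K. f h g)"
  by (rule sum.reindex_bij_witness[of _ prod.swap prod.swap]) (auto simp: tri_def)

text \<open>Off the diagonal, a pair is recorded by its difference g and its smaller entry h. The
  larger entry is g + h, so the range is the same triangle that survives the truncation of products
  of Lambert series.\<close>

lemma sum_square_tri:
  fixes f :: "nat \<Rightarrow> nat \<Rightarrow> 'a :: comm_monoid_add"
  shows "(\<Sum>m=1..K. \<Sum>n=1..K. f m n) =
    (\<Sum>(g, h)\<in>tri K. f (g + h) h) + (\<Sum>(g, h)\<in>tri K. f h (g + h)) + (\<Sum>m=1..K. f m m)"
proof -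
  let ?S = "{1..K} \<times> {1..K}"
  let ?A = "{p \<in> ?S. snd p < fst p}" and ?B = "{p \<in> ?S. fst p < snd p}"
    and ?C = "{p \<in> ?S. fst p = snd p}"
  have "(\<Sum>m=1..K. \<Sum>n=1..K. f m n) = (\<Sum>p\<in>?S. f (fst p) (snd p))"
    by (simp add: sum.cartesian_product case_prod_unfold)
  also have "?S = (?A \<union> ?B) \<union> ?C" by auto
  also have "(\<Sum>p\<in>(?A \<union> ?B) \<union> ?C. f (fst p) (snd p)) =
      (\<Sum>p\<in>?A. f (fst p) (snd p)) + (\<Sum>p\<in>?B. f (fst p) (snd p)) + (\<Sum>p\<in>?C. f (fst p) (snd p))"
    by (subst sum.union_disjoint, auto)+
  also have "(\<Sum>p\<in>?A. f (fst p) (snd p)) = (\<Sum>(g, h)\<in>tri K. f (g + h) h)"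
    by (rule sum.reindex_bij_witness[of _ "\<lambda>(g, h). (g + h, h)" "\<lambda>(m, n). (m - n, n)"])
       (auto simp: tri_def)
  also have "(\<Sum>p\<in>?B. f (fst p) (snd p)) = (\<Sum>(g, h)\<in>tri K. f h (g + h))"
    by (rule sum.reindex_bij_witness[of _ "\<lambda>(g, h). (h, g + h)" "\<lambda>(m, n). (n - m, m)"])
       (auto simp: tri_def)
  also have "(\<Sum>p\<in>?C. f (fst p) (snd p)) = (\<Sum>m=1..K. f m m)"
    by (rule sum.reindex_bij_witness[of _ "\<lambda>m. (m, m)" fst]) auto
  finally show ?thesis .
qed


text \<open>If \<open>u + v + w = 0\<close>, the cosine below is the real part of the monomial with exponent
  vector \<open>(g + h, h, 0)\<close> in \<open>(u, v, w)\<close>; the six orderings of the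
  arguments fall into three classes, given by the middle one.\<close>

definition ord_cos :: "real \<Rightarrow> real \<Rightarrow> nat \<Rightarrow> nat \<Rightarrow> real" where
  "ord_cos u v g h = cos (2 * (real (g + h) * u + real h * v))"

lemma ord_cos_reverse:
  assumes "u + v + w = 0" shows "ord_cos w v g h = ord_cos u v h g"
proof -
  have w: "w = - u - v" using assms by simp
  have "2 * (real (g + h) * w + real h * v) = - (2 * (real (h + g) * u + real g * v))"
    by (simp add: w algebra_simps)
  then show ?thesis unfolding ord_cos_def by (simp only: cos_minus)
qed

definition sin_sum :: "nat \<Rightarrow> real \<Rightarrow> real fps" where
  "sin_sum K z = (\<Sum>m=1..K. fps_const (sin (2 * real m * z)) * lambert m)"

definition tri_sum :: "nat \<Rightarrow> real \<Rightarrow> real \<Rightarrow> (nat \<Rightarrow> nat \<Rightarrow> real fps) \<Rightarrow> real fps" where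
  "tri_sum K u v c = (\<Sum>(g, h)\<in>tri K. fps_const (ord_cos u v g h) * c g h)"

lemma tri_sum_diff:
  "tri_sum K u v (\<lambda>g h. c g h - d g h) = tri_sum K u v c - tri_sum K u v d"
  by (simp add: tri_sum_def case_prod_unfold algebra_simps sum_subtractf)

lemma tri_sum_reverse:
  assumes "u + v + w = 0"
  shows "tri_sum K w v c = tri_sum K u v (\<lambda>g h. c h g)"
  unfolding tri_sum_def ord_cos_reverse[OF assms]
  by (rule sum_tri_swap)

text \<open>The product of sines is split into cosines of differences and of sums. For the sums the
  square is divided by the sign of m - n; for the differences the truncation leaves the
  triangle.\<close>

lemma sin_sum_mult:
  assumes "u + v + w = 0"
  shows "fps_cong K (2 * (sin_sum K u * sin_sum K v))
    (tri_sum K u w (\<lambda>g h. lambert g * lambert h)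
     - tri_sum K u v (\<lambda>g h. lambert (g + h) * lambert h)
     - tri_sum K v u (\<lambda>g h. lambert (g + h) * lambert h)
     - (\<Sum>m=1..K. fps_const (cos (2 * real m * w)) * lambert m ^ 2))"
proof -
  have w: "w = - u - v" using assms by simp
  let ?l = "\<lambda>m n. lambert m * lambert n"
  let ?D = "\<lambda>m n. fps_const (cos (2 * real m * u - 2 * real n * v)) * ?l m n"
  let ?S = "\<lambda>m n. fps_const (cos (2 * real m * u + 2 * real n * v)) * ?l m n"
  have sinsin: "2 * (fps_const (sin a) * fps_const (sin b)) = fps_const (cos (a - b)) - fps_const (cos (a + b))"
    for a b :: real
    by (simp add: cos_add cos_diff fps_const_mult[symmetric] del: fps_const_mult flip: fps_const_add fps_const_sub)
  have "2 * (fps_const (sin (2 * real m * u)) * lambert m * (fps_const (sin (2 * real n * v)) * lambert n))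
    = ?D m n - ?S m n" for m n
  proof -
    have "2 * (fps_const (sin (2 * real m * u)) * lambert m * (fps_const (sin (2 * real n * v)) * lambert n))
       = (2 * (fps_const (sin (2 * real m * u)) * fps_const (sin (2 * real n * v)))) * ?l m n"
      by (simp only: mult_ac)
    also have "\<dots> = ?D m n - ?S m n" unfolding sinsin by (simp only: left_diff_distrib)
    finally show ?thesis .
  qed
  then have "2 * (sin_sum K u * sin_sum K v) = (\<Sum>m=1..K. \<Sum>n=1..K. ?D m n - ?S m n)"
    by (simp only: sin_sum_def sum_product) (simp only: sum_distrib_left)
  then have eq: "2 * (sin_sum K u * sin_sum K v) =
      (\<Sum>m=1..K. \<Sum>n=1..K. ?D m n) - (\<Sum>m=1..K. \<Sum>n=1..K. ?S m n)"
    by (simp only: sum_subtractf)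
  have S: "(\<Sum>m=1..K. \<Sum>n=1..K. ?S m n) =
      tri_sum K u v (\<lambda>g h. lambert (g + h) * lambert h)
     + tri_sum K v u (\<lambda>g h. lambert (g + h) * lambert h)
     + (\<Sum>m=1..K. fps_const (cos (2 * real m * w)) * lambert m ^ 2)"
  proof -
    have "cos (2 * real m * u + 2 * real m * v) = cos (2 * real m * w)" for m
      using cos_minus[of "2 * real m * w"] by (simp add: w algebra_simps)
    then show ?thesis
      unfolding sum_square_tri[of ?S] tri_sum_def ord_cos_def
      by (simp add: algebra_simps power2_eq_square)
  qed
  have "fps_cong K (\<Sum>m=1..K. \<Sum>n=1..K. ?D m n) (tri_sum K u w (\<lambda>g h. lambert g * lambert h))"
  proof -
    \<comment> \<open>Eliminating v by u + v + w = 0 brings the cosine of the difference to the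
      normal form used for the sums.\<close>
    have o: "cos (2 * real m * u - 2 * real n * v) = ord_cos u w m n" for m n
      by (simp add: ord_cos_def w algebra_simps)
    have "(\<Sum>m=1..K. \<Sum>n=1..K. ?D m n) = (\<Sum>p\<in>{1..K} \<times> {1..K}. ?D (fst p) (snd p))"
      by (simp add: sum.cartesian_product case_prod_unfold)
    also have "\<dots> = (\<Sum>p\<in>tri K. ?D (fst p) (snd p))
        + (\<Sum>p\<in>{1..K} \<times> {1..K} - tri K. ?D (fst p) (snd p))"
      by (subst sum.subset_diff[of "tri K"]) (auto simp: tri_def add.commute)
    finally have D: "(\<Sum>m=1..K. \<Sum>n=1..K. ?D m n) = (\<Sum>p\<in>tri K. ?D (fst p) (snd p))
        + (\<Sum>p\<in>{1..K} \<times> {1..K} - tri K. ?D (fst p) (snd p))" .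
    have "fps_cong K (\<Sum>p\<in>{1..K} \<times> {1..K} - tri K. ?D (fst p) (snd p))
        (\<Sum>p\<in>{1..K} \<times> {1..K} - tri K. fps_const (ord_cos u w (fst p) (snd p)) * 0)"
      unfolding o
      by (intro fps_cong_sum fps_cong_mult fps_cong_refl lambert_mult_cong_0) (auto simp: tri_def)
    then have "fps_cong K (\<Sum>m=1..K. \<Sum>n=1..K. ?D m n) ((\<Sum>p\<in>tri K. ?D (fst p) (snd p)) + 0)"
      unfolding D by (intro fps_cong_add fps_cong_refl) simp
    then show ?thesis
      by (simp add: tri_sum_def case_prod_unfold o)
  qed
  then show ?thesis
    unfolding eq S diff_diff_eq[symmetric] by (intro fps_cong_diff fps_cong_refl)
qed

text \<open>Each of the three classes of orderings receives one product of indices g, h and, with a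
  minus sign, the products of indices g + h, h and g + h, g. By \<open>lambert_mult\<close> these
  add up to the single series of index g + h.\<close>

lemma sin_sum_symmetric_product:
  assumes "x + y + z = 0"
  shows "fps_cong K
    (2 * (sin_sum K x * sin_sum K y + sin_sum K x * sin_sum K z + sin_sum K y * sin_sum K z))
    (tri_sum K x y (\<lambda>g h. lambert (g + h)) + tri_sum K x z (\<lambda>g h. lambert (g + h))
     + tri_sum K y x (\<lambda>g h. lambert (g + h))
     - (\<Sum>m=1..K. fps_const (cos (2 * real m * x) + cos (2 * real m * y) + cos (2 * real m * z)) * lambert m ^ 2))"
proof -
  let ?l = "\<lambda>g h. lambert g * lambert h" and ?t = "\<lambda>g h. lambert (g + h) * lambert h"
  let ?q = "\<lambda>u. \<Sum>m=1..K. fps_const (cos (2 * real m * u)) * lambert m ^ 2"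
  have *: "tri_sum K u v ?l - tri_sum K u v ?t - tri_sum K u v (\<lambda>g h. ?t h g)
      = tri_sum K u v (\<lambda>g h. lambert (g + h))" for u v
  proof -
    have "lambert g * lambert h - lambert (g + h) * lambert h - lambert (h + g) * lambert g = lambert (g + h)"
      if "(g, h) \<in> tri K" for g h
      using lambert_mult[of g h] that by (simp add: tri_def algebra_simps)
    then have "tri_sum K u v (\<lambda>g h. ?l g h - ?t g h - ?t h g) = tri_sum K u v (\<lambda>g h. lambert (g + h))"
      unfolding tri_sum_def by (intro sum.cong refl) (auto simp del: fps_mult_left_const_nth)
    then show ?thesis by (simp only: tri_sum_diff)
  qed
  have p: "x + z + y = 0" "y + z + x = 0" "y + x + z = 0" using assms by auto
  have r: "tri_sum K z y c = tri_sum K x y (\<lambda>g h. c h g)" "tri_sum K y z c = tri_sum K x z (\<lambda>g h. c h g)"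
     "tri_sum K z x c = tri_sum K y x (\<lambda>g h. c h g)" for c
    using tri_sum_reverse[of x y z K c] tri_sum_reverse[of x z y K c] tri_sum_reverse[of y x z K c] assms p
    by auto
  let ?P1 = "tri_sum K x z ?l - tri_sum K x y ?t - tri_sum K y x ?t - ?q z"
  let ?P2 = "tri_sum K x y ?l - tri_sum K x z ?t - tri_sum K z x ?t - ?q y"
  let ?P3 = "tri_sum K y x ?l - tri_sum K y z ?t - tri_sum K z y ?t - ?q x"
  have "fps_cong K (2 * (sin_sum K x * sin_sum K y) + 2 * (sin_sum K x * sin_sum K z)
      + 2 * (sin_sum K y * sin_sum K z)) (?P1 + ?P2 + ?P3)"
    by (intro fps_cong_add sin_sum_mult assms p)
  also have "?P1 + ?P2 + ?P3 = 
     (tri_sum K x y ?l - tri_sum K x y ?t - tri_sum K x y (\<lambda>g h. ?t h g))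
     + (tri_sum K x z ?l - tri_sum K x z ?t - tri_sum K x z (\<lambda>g h. ?t h g))
     + (tri_sum K y x ?l - tri_sum K y x ?t - tri_sum K y x (\<lambda>g h. ?t h g))
     - (?q x + ?q y + ?q z)"
    unfolding r by (simp only: algebra_simps)
  also have "?q x + ?q y + ?q z =
     (\<Sum>m=1..K. fps_const (cos (2 * real m * x) + cos (2 * real m * y) + cos (2 * real m * z)) * lambert m ^ 2)"
    by (simp add: sum.distrib algebra_simps flip: fps_const_add)
  finally show ?thesis
    unfolding * by (simp add: algebra_simps)
qed

text \<open>Multiplied by 2 sin y, each term is a difference of sines whose arguments contain
  consecutive odd multiples of y.\<close>

lemma sum_cos_telescope:
  fixes x y :: real
  assumes "d > 0"
  shows "2 * sin y * (\<Sum>h=1..<d. cos (2 * (real d * x + real h * y))) =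
    sin (2 * real d * x + (2 * real d - 1) * y) - sin (2 * real d * x + y)"
  using assms
proof -
  define D where "D = 2 * real d * x"
  have "2 * sin y * (\<Sum>h=1..<Suc k. cos (D + 2 * real h * y)) =
      sin (D + (2 * real (Suc k) - 1) * y) - sin (D + y)" for k
  proof (induction k)
    case (Suc k)
    have "2 * sin y * cos (D + 2 * real (Suc k) * y) =
        sin (D + (2 * real (Suc (Suc k)) - 1) * y) - sin (D + (2 * real (Suc k) - 1) * y)"
    proof -
      define E where "E = D + 2 * real (Suc k) * y"
      have "D + (2 * real (Suc (Suc k)) - 1) * y = E + y" "D + (2 * real (Suc k) - 1) * y = E - y"
        by (simp_all add: E_def algebra_simps)
      then show ?thesis
        by (simp only: E_def[symmetric]) (simp add: sin_add sin_diff)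
    qed
    with Suc show ?case by (simp add: algebra_simps del: of_nat_Suc)
  qed simp
  from this[of "d - 1"] assms show ?thesis
    by (simp add: D_def algebra_simps)
qed

lemma sum_ord_cos:
  assumes "x + y + z = 0" "sin y \<noteq> 0" "d > 0"
  shows "2 * (\<Sum>h=1..<d. cos (2 * (real d * x + real h * y))) =
    - cot y * (sin (2 * real d * z) + sin (2 * real d * x))
    - cos (2 * real d * z) - cos (2 * real d * x)"
proof -
  have z: "2 * real d * x + (2 * real d - 1) * y = - (2 * real d * z + y)"
  proof -
    have "2 * real d * x + 2 * real d * y + 2 * real d * z = 2 * real d * (x + y + z)"
      by (simp only: distrib_left)
    then show ?thesis using assms(1) by (simp add: left_diff_distrib)
  qed
  have "2 * sin y * (\<Sum>h=1..<d. cos (2 * (real d * x + real h * y))) =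
      - (sin (2 * real d * z) * cos y + cos (2 * real d * z) * sin y)
      - (sin (2 * real d * x) * cos y + cos (2 * real d * x) * sin y)"
    unfolding sum_cos_telescope[OF assms(3)] z sin_minus by (simp add: sin_add)
  then have "2 * (\<Sum>h=1..<d. cos (2 * (real d * x + real h * y))) = 
     (- (sin (2 * real d * z) * cos y + cos (2 * real d * z) * sin y)
      - (sin (2 * real d * x) * cos y + cos (2 * real d * x) * sin y)) / sin y"
    using assms(2) by (simp add: field_simps)
  also have "\<dots> = - cot y * (sin (2 * real d * z) + sin (2 * real d * x))
    - cos (2 * real d * z) - cos (2 * real d * x)"
    using assms(2) by (simp add: cot_def field_simps)
  finally show ?thesis .
qed

lemma fps_const_sum: "fps_const (sum f I) = (\<Sum>i\<in>I. fps_const (f i))"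
  by (rule fps_ext) (simp add: fps_sum_nth)

lemma tri_sum_diagonal:
  "tri_sum K x y (\<lambda>g h. lambert (g + h)) =
    (\<Sum>d=1..K. fps_const (\<Sum>h=1..<d. cos (2 * (real d * x + real h * y))) * lambert d)"
proof -
  have "tri_sum K x y (\<lambda>g h. lambert (g + h)) =
      (\<Sum>(d, h)\<in>(SIGMA d:{1..K}. {1..<d}). fps_const (cos (2 * (real d * x + real h * y))) * lambert d)"
    unfolding tri_sum_def ord_cos_def
    by (rule sum.reindex_bij_witness[of _ "\<lambda>(d, h). (d - h, h)" "\<lambda>(g, h). (g + h, h)"])
       (auto simp: tri_def)
  also have "\<dots> = (\<Sum>d=1..K. \<Sum>h=1..<d. fps_const (cos (2 * (real d * x + real h * y))) * lambert d)"
    by (subst sum.Sigma) auto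
  also have "\<dots> = (\<Sum>d=1..K. fps_const (\<Sum>h=1..<d. cos (2 * (real d * x + real h * y))) * lambert d)"
  proof (intro sum.cong refl)
    fix d
    show "(\<Sum>h=1..<d. fps_const (cos (2 * (real d * x + real h * y))) * lambert d) =
      fps_const (\<Sum>h=1..<d. cos (2 * (real d * x + real h * y))) * lambert d"
      by (simp add: sum_distrib_right fps_const_sum)
  qed
  finally show ?thesis .
qed


text \<open>Summed along g + h = d, the linear terms yield cotangents times sines, which cancel the
  cross terms with the constant parts of \<open>log_deriv\<close>. The remaining cosines combine
  with the squares into the shape required by \<open>lambert_square_nth\<close>.\<close>

lemma sin_sum_cot_product:
  assumes "x + y + z = 0" "sin x \<noteq> 0" "sin y \<noteq> 0" "sin z \<noteq> 0"
  shows "fps_cong K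
    (8 * (sin_sum K x * sin_sum K y + sin_sum K x * sin_sum K z + sin_sum K y * sin_sum K z)
      + 2 * (fps_const (cot x) * (sin_sum K y + sin_sum K z) + fps_const (cot y) * (sin_sum K x + sin_sum K z)
        + fps_const (cot z) * (sin_sum K x + sin_sum K y)))
    (- 4 * (\<Sum>m=1..K. fps_const (cos (2 * real m * x) + cos (2 * real m * y) + cos (2 * real m * z))
        * (lambert m + lambert m ^ 2)))"
proof -
  let ?c = "\<lambda>m. cos (2 * real m * x) + cos (2 * real m * y) + cos (2 * real m * z)"
  let ?E = "\<lambda>u v. tri_sum K u v (\<lambda>g h. lambert (g + h))"
  let ?C = "fps_const (cot x) * (sin_sum K y + sin_sum K z) + fps_const (cot y) * (sin_sum K x + sin_sum K z)
        + fps_const (cot z) * (sin_sum K x + sin_sum K y)"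
  have E: "2 * ?E u v = (\<Sum>d=1..K. fps_const (- cot v * (sin (2 * real d * w) + sin (2 * real d * u))
    - cos (2 * real d * w) - cos (2 * real d * u)) * lambert d)" 
    if "u + v + w = 0" "sin v \<noteq> 0" for u v w
    unfolding tri_sum_diagonal sum_distrib_left
  proof (intro sum.cong refl)
    fix d assume "d \<in> {1..K}"
    then have "d > 0" by simp
    show "2 * (fps_const (\<Sum>h=1..<d. cos (2 * (real d * u + real h * v))) * lambert d) =
      fps_const (- cot v * (sin (2 * real d * w) + sin (2 * real d * u))
        - cos (2 * real d * w) - cos (2 * real d * u)) * lambert d"
      unfolding sum_ord_cos[OF that \<open>d > 0\<close>, symmetric]
      by (simp flip: fps_const_mult add: numeral_fps_const mult.assoc)
  qed
  have "x + z + y = 0" "y + x + z = 0" using assms by auto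
  note E3 = E[OF assms(1,3)] E[OF this(1) assms(4)] E[OF this(2) assms(2)]
  have "2 * (?E x y + ?E x z + ?E y x) + ?C = (\<Sum>m=1..K. fps_const (- 2 * ?c m) * lambert m)"
    unfolding distrib_left E3 sin_sum_def sum_distrib_left sum.distrib[symmetric]
  proof (intro sum.cong refl, goal_cases)
    case (1 m)
    show ?case
      by (simp add: algebra_simps numeral_fps_const flip: fps_const_add fps_const_mult fps_const_sub fps_const_neg)
  qed
  then have C: "2 * (2 * (?E x y + ?E x z + ?E y x)) + 2 * ?C = 2 * (\<Sum>m=1..K. fps_const (- 2 * ?c m) * lambert m)"
    by (simp only: distrib_left[symmetric])
  have "fps_cong K (4 * (2 * (sin_sum K x * sin_sum K y + sin_sum K x * sin_sum K z + sin_sum K y * sin_sum K z))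
      + 2 * ?C)
     (4 * (?E x y + ?E x z + ?E y x - (\<Sum>m=1..K. fps_const (?c m) * lambert m ^ 2)) + 2 * ?C)"
    by (intro fps_cong_add fps_cong_mult fps_cong_refl sin_sum_symmetric_product assms)
  also have "4 * (?E x y + ?E x z + ?E y x - (\<Sum>m=1..K. fps_const (?c m) * lambert m ^ 2)) + 2 * ?C
    = (2 * (2 * (?E x y + ?E x z + ?E y x)) + 2 * ?C) - 4 * (\<Sum>m=1..K. fps_const (?c m) * lambert m ^ 2)"
    by (simp only: right_diff_distrib) (simp add: algebra_simps)
  also have "\<dots> = (- 4 * (\<Sum>m=1..K. fps_const (?c m) * (lambert m + lambert m ^ 2)))"
  proof -
    have "fps_const (- 2 * r) = - 2 * fps_const r" for r :: real
      by (simp add: numeral_fps_const)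
    then have "fps_const (- 2 * r) * F = - 2 * (fps_const r * F)" for r and F :: "real fps"
      by (simp only: mult.assoc)
    then have "(\<Sum>m=1..K. fps_const (- 2 * ?c m) * lambert m) = - 2 * (\<Sum>m=1..K. fps_const (?c m) * lambert m)"
      by (simp only: sum_distrib_left)
    moreover have "(\<Sum>m=1..K. fps_const (?c m) * (lambert m + lambert m ^ 2)) =
        (\<Sum>m=1..K. fps_const (?c m) * lambert m) + (\<Sum>m=1..K. fps_const (?c m) * lambert m ^ 2)"
      by (simp only: distrib_left sum.distrib)
    ultimately show ?thesis
      unfolding C by (simp only:) (simp only: algebra_simps, simp)
  qed
  finally show ?thesis by (simp add: mult.assoc[symmetric])
qed

lemma cot_symmetric_product:
  fixes x y z :: real
  assumes "x + y + z = 0" "sin x \<noteq> 0" "sin y \<noteq> 0" "sin z \<noteq> 0"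
  shows "cot x * cot y + cot x * cot z + cot y * cot z = 1"
proof -
  have z: "z = - (x + y)" using assms(1) by simp
  have "sin (x + y) \<noteq> 0" using assms(4) by (simp only: z sin_minus neg_equal_0_iff_equal not_False_eq_True)
  with assms(2,3) show ?thesis
    unfolding z cot_def sin_minus cos_minus
    by (simp add: field_simps) (simp add: sin_add cos_add, simp add: field_simps)
qed

text \<open>The coefficient of q^K sees only the truncations at K, and K is arbitrary. At q = 0 the
  identity is \<open>cot_symmetric_product\<close>.\<close>

lemma log_deriv_symmetric_product:
  assumes "x + y + z = 0" "sin x \<noteq> 0" "sin y \<noteq> 0" "sin z \<noteq> 0"
  shows "log_deriv x * log_deriv y + log_deriv x * log_deriv z + log_deriv y * log_deriv z =
    1 - 8 * (cos_series x + cos_series y + cos_series z)"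
proof (rule fps_ext)
  fix K
  let ?a = "\<lambda>u. fps_const (cot u) + 4 * sin_sum K u"
  let ?c = "\<lambda>m. cos (2 * real m * x) + cos (2 * real m * y) + cos (2 * real m * z)"
  let ?S = "sin_sum K x * sin_sum K y + sin_sum K x * sin_sum K z + sin_sum K y * sin_sum K z"
  let ?C = "fps_const (cot x) * (sin_sum K y + sin_sum K z) + fps_const (cot y) * (sin_sum K x + sin_sum K z)
        + fps_const (cot z) * (sin_sum K x + sin_sum K y)"
  have a: "fps_cong K (log_deriv u) (?a u)" for u
    unfolding log_deriv_def sin_sum_def
    by (intro fps_cong_add fps_cong_mult fps_cong_refl sin_series_cong)
  have "fps_cong K (log_deriv x * log_deriv y + log_deriv x * log_deriv z + log_deriv y * log_deriv z)
     (?a x * ?a y + ?a x * ?a z + ?a y * ?a z)"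
    by (intro fps_cong_add fps_cong_mult a)
  also have "?a x * ?a y + ?a x * ?a z + ?a y * ?a z =
     fps_const (cot x * cot y + cot x * cot z + cot y * cot z) + 2 * (8 * ?S + 2 * ?C)"
    by (simp add: algebra_simps flip: fps_const_add fps_const_mult)
  also have "\<dots> = 1 + 2 * (8 * ?S + 2 * ?C)"
    by (simp add: cot_symmetric_product[OF assms])
  also have "fps_cong K \<dots> (1 + 2 * (- 4 * (\<Sum>m=1..K. fps_const (?c m) * (lambert m + lambert m ^ 2))))"
    by (intro fps_cong_add fps_cong_mult fps_cong_refl sin_sum_cot_product assms)
  also have "\<dots> = 1 - 8 * (\<Sum>m=1..K. fps_const (?c m) * (lambert m + lambert m ^ 2))"
    by simp
  also have "(\<Sum>m=1..K. fps_const (?c m) * (lambert m + lambert m ^ 2)) =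
     (\<Sum>m=1..K. fps_const (cos (2 * real m * x)) * (lambert m + lambert m ^ 2))
     + (\<Sum>m=1..K. fps_const (cos (2 * real m * y)) * (lambert m + lambert m ^ 2))
     + (\<Sum>m=1..K. fps_const (cos (2 * real m * z)) * (lambert m + lambert m ^ 2))"
    by (simp add: sum.distrib[symmetric] distrib_right flip: fps_const_add)
  also have "fps_cong K (1 - 8 * \<dots>) (1 - 8 * (cos_series x + cos_series y + cos_series z))"
    by (intro fps_cong_add fps_cong_diff fps_cong_mult fps_cong_refl fps_cong_sym[OF cos_series_cong])
  finally show "(log_deriv x * log_deriv y + log_deriv x * log_deriv z + log_deriv y * log_deriv z) $ K =
    (1 - 8 * (cos_series x + cos_series y + cos_series z)) $ K"
    by (simp add: fps_cong_def)
qed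

section \<open>The heat equation, and the Lambert series as logarithmic derivative of theta\<close>

subsection \<open>The Riccati equation\<close>

lemma has_coeff_deriv_sin_series:
  "has_coeff_deriv sin_series (Abs_fps (\<lambda>n. \<Sum>d | d dvd n. 2 * real d * cos (2 * real d * z))) z"
  unfolding has_coeff_deriv_def
proof
  fix n
  show "((\<lambda>u. sin_series u $ n) has_real_derivative
      Abs_fps (\<lambda>n. \<Sum>d | d dvd n. 2 * real d * cos (2 * real d * z)) $ n) (at z)"
    unfolding sin_series_def by (auto intro!: derivative_eq_intros sum.cong)
qed

lemma has_coeff_deriv_cos_series:
  "has_coeff_deriv cos_series (- 2 * euler (sin_series z)) z"
  unfolding has_coeff_deriv_def
proof
  fix n
  have "((\<lambda>u. cos_series u $ n) has_real_derivative
      (\<Sum>d | d dvd n. real (n div d) * (- sin (2 * real d * z) * (2 * real d)))) (at z)"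
    unfolding cos_series_def by (auto intro!: derivative_eq_intros sum.cong)
  also have "(\<Sum>d | d dvd n. real (n div d) * (- sin (2 * real d * z) * (2 * real d))) =
      (\<Sum>d | d dvd n. - 2 * real n * sin (2 * real d * z))"
  proof (intro sum.cong refl)
    fix d assume "d \<in> {d. d dvd n}"
    \<comment> \<open>Frequency times cofactor is n for every divisor, which turns the z-derivative
      into a q-derivative.\<close>
    then have "real n = real (n div d) * real d"
      by (metis dvd_div_mult_self mem_Collect_eq of_nat_mult)
    then show "real (n div d) * (- sin (2 * real d * z) * (2 * real d)) = - 2 * real n * sin (2 * real d * z)"
      by simp
  qed
  also have "\<dots> = (- 2 * euler (sin_series z)) $ n"
    by (simp add: euler_nth sin_series_def sum_distrib_left numeral_fps_const mult.assoc sum_negf)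
  finally show "((\<lambda>u. cos_series u $ n) has_real_derivative (- 2 * euler (sin_series z)) $ n) (at z)" .
qed

text \<open>Equality of the mixed second derivatives of log theta. As \<open>euler\<close> removes
  the cotangent, the formula also covers z = 0.\<close>

lemma has_coeff_deriv_heat_pot:
  "has_coeff_deriv heat_pot (8 * euler (log_deriv z)) z"
proof -
  have "has_coeff_deriv heat_pot (0 - (0 * (cos_series 0 + 2 * cos_series z)
      + 8 * (0 + (0 * cos_series z + 2 * (- 2 * euler (sin_series z)))))) z"
    unfolding heat_pot_def[abs_def]
    by (intro has_coeff_deriv_diff has_coeff_deriv_mult has_coeff_deriv_add has_coeff_deriv_const
        has_coeff_deriv_cos_series)
  moreover have "euler (log_deriv z) = 4 * euler (sin_series z)"
    by (simp add: log_deriv_def euler_add euler_const euler_mult euler_numeral)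
  ultimately show ?thesis by (simp add: algebra_simps)
qed

lemma sin_series_minus: "sin_series (- z) = - sin_series z"
  by (rule fps_ext) (simp add: sin_series_def sum_negf)

lemma cos_series_minus: "cos_series (- z) = cos_series z"
  by (rule fps_ext) (simp add: cos_series_def)

lemma cot_minus_real: "cot (- z) = - cot (z :: real)"
  by (simp add: cot_def)

lemma log_deriv_minus: "log_deriv (- z) = - log_deriv z"
  by (simp add: log_deriv_def sin_series_minus cot_minus_real flip: fps_const_neg)

lemma heat_pot_minus: "heat_pot (- z) = heat_pot z"
  by (simp add: heat_pot_def cos_series_minus)

lemma log_deriv_differentiable:
  assumes "sin z \<noteq> 0" shows "\<exists>F'. has_coeff_deriv log_deriv F' z"
proof -
  have "has_coeff_deriv (\<lambda>u. fps_const (cot u)) (fps_const (- inverse ((sin z)\<^sup>2))) z"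
    by (intro has_coeff_deriv_fps_const DERIV_cot assms)
  from has_coeff_deriv_add[OF this
      has_coeff_deriv_mult[OF has_coeff_deriv_const has_coeff_deriv_sin_series]]
  show ?thesis unfolding log_deriv_def[abs_def] by blast
qed

lemma eventually_sin_neq_0:
  assumes "sin z \<noteq> (0::real)" shows "eventually (\<lambda>u. sin u \<noteq> 0) (nhds z)"
proof -
  have "(sin \<longlongrightarrow> sin z) (nhds z)"
    by (intro tendsto_sin filterlim_ident)
  then show ?thesis using assms by (rule tendsto_imp_eventually_ne)
qed

lemma eventually_sin_neq_0_at_0: "eventually (\<lambda>u. sin u = 0 \<longrightarrow> u = 0) (nhds (0::real))"
proof -
  have "eventually (\<lambda>u. u \<in> {- pi<..<pi}) (nhds (0::real))"
    by (intro eventually_nhds_in_open) auto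
  then show ?thesis
    by eventually_elim (use sin_eq_0_pi in auto)
qed

text \<open>The case \<open>y \<rightarrow> - x\<close> of the symmetric product formula: after multiplication by
  \<open>sin (x + y)\<close> it can be differentiated at \<open>x + y = 0\<close>.\<close>

lemma has_coeff_deriv_log_deriv:
  assumes "sin x \<noteq> 0"
  shows "has_coeff_deriv log_deriv (- (log_deriv x ^ 2) - heat_pot x) x"
proof -
  obtain F' where F': "has_coeff_deriv log_deriv F' x"
    using log_deriv_differentiable assms by blast
  \<comment> \<open>\<open>B\<close> is sin u * \<open>log_deriv\<close> u with the pole at u = 0
    removed. \<open>G\<close> and \<open>H\<close> are the two sides of the symmetric product
    identity at x, u - x, - u, multiplied by sin u.\<close>
  define B where "B = (\<lambda>u. fps_const (cos u) + 4 * (fps_const (sin u) * sin_series u))"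
  define G where "G = (\<lambda>u. - (fps_const (sin u) * (log_deriv x * log_deriv (x - u)))
     - (log_deriv x - log_deriv (x - u)) * B u)"
  define H where "H = (\<lambda>u. fps_const (sin u) * (1 - 8 * (cos_series x + cos_series (x - u) + cos_series u)))"
  have B: "B u = fps_const (sin u) * log_deriv u" if "sin u \<noteq> 0" for u
    using that by (simp add: B_def log_deriv_def algebra_simps cot_def)
  have "((\<lambda>u. x - u) \<longlongrightarrow> x - 0) (nhds 0)"
    by (intro tendsto_intros filterlim_ident)
  then have "eventually (\<lambda>u. sin (x - u) \<noteq> 0) (nhds 0)"
    using eventually_sin_neq_0[OF assms] unfolding filterlim_iff diff_zero by blast
  then have "eventually (\<lambda>u. G u = H u) (nhds 0)"
    using eventually_sin_neq_0_at_0
  proof eventually_elim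
    case (elim u)
    show ?case
    proof (cases "sin u = 0")
      case True
      with elim show ?thesis by (simp add: G_def H_def)
    next
      case False
      have s: "x + - (x - u) + - u = 0" "sin (- (x - u)) \<noteq> 0" "sin (- u) \<noteq> 0"
        using elim False by (simp, metis sin_minus neg_equal_0_iff_equal, simp)
      have "log_deriv x * log_deriv (- (x - u)) + log_deriv x * log_deriv (- u)
          + log_deriv (- (x - u)) * log_deriv (- u) =
          1 - 8 * (cos_series x + cos_series (- (x - u)) + cos_series (- u))"
        by (rule log_deriv_symmetric_product[OF s(1) assms s(2,3)])
      then have "1 - 8 * (cos_series x + cos_series (x - u) + cos_series u) =
          - (log_deriv x * log_deriv (x - u)) - (log_deriv x - log_deriv (x - u)) * log_deriv u"
        unfolding cos_series_minus log_deriv_minus by (simp add: algebra_simps)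
      then have "H u = fps_const (sin u) * (- (log_deriv x * log_deriv (x - u))
          - (log_deriv x - log_deriv (x - u)) * log_deriv u)"
        by (simp only: H_def)
      then show ?thesis
        by (simp add: G_def B[OF False] algebra_simps)
    qed
  qed
  moreover have "has_coeff_deriv G (- (log_deriv x ^ 2) - F') 0"
  proof -
    have c: "has_coeff_deriv (\<lambda>u. log_deriv (x - u)) (fps_const (- 1) * F') 0"
      by (rule has_coeff_deriv_chain) (use F' in \<open>auto intro!: derivative_eq_intros\<close>)
    have s: "has_coeff_deriv (\<lambda>u. fps_const (sin u)) (fps_const (cos 0)) 0"
      "has_coeff_deriv (\<lambda>u. fps_const (cos u)) (fps_const (- sin 0)) 0"
      by (intro has_coeff_deriv_fps_const DERIV_sin DERIV_cos)+
    obtain B' where B': "has_coeff_deriv B B' 0"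
      unfolding B_def
      using has_coeff_deriv_add[OF s(2) has_coeff_deriv_mult[OF has_coeff_deriv_const
          has_coeff_deriv_mult[OF s(1) has_coeff_deriv_sin_series]]] by blast
    have "B 0 = 1" by (simp add: B_def)
    show ?thesis
      using has_coeff_deriv_diff[OF has_coeff_deriv_minus[OF has_coeff_deriv_mult[OF s(1)
        has_coeff_deriv_mult[OF has_coeff_deriv_const c]]]
        has_coeff_deriv_mult[OF has_coeff_deriv_diff[OF has_coeff_deriv_const c] B'],
        of "log_deriv x" "log_deriv x"]
      by (simp add: G_def \<open>B 0 = 1\<close> power2_eq_square flip: fps_const_neg)
  qed
  moreover have "has_coeff_deriv H (heat_pot x) 0"
  proof -
    have s: "has_coeff_deriv (\<lambda>u. fps_const (sin u)) (fps_const (cos 0)) 0"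
      by (intro has_coeff_deriv_fps_const DERIV_sin)
    have c: "has_coeff_deriv (\<lambda>u. cos_series (x - u)) (fps_const (- 1) * (- 2 * euler (sin_series (x - 0)))) 0"
      by (rule has_coeff_deriv_chain, rule has_coeff_deriv_cos_series)
         (auto intro!: derivative_eq_intros)
    obtain C where C: "has_coeff_deriv (\<lambda>u. 1 - 8 * (cos_series x + cos_series (x - u) + cos_series u)) C 0"
      using has_coeff_deriv_diff[OF has_coeff_deriv_const has_coeff_deriv_mult[OF has_coeff_deriv_const
        has_coeff_deriv_add[OF has_coeff_deriv_add[OF has_coeff_deriv_const c] has_coeff_deriv_cos_series]]]
      by blast
    show ?thesis
      using has_coeff_deriv_mult[OF s C] by (simp add: H_def heat_pot_def algebra_simps)
  qed
  ultimately have "- (log_deriv x ^ 2) - F' = heat_pot x"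
    by (rule has_coeff_deriv_unique_ev)
  then have "F' = - (log_deriv x ^ 2) - heat_pot x" by (simp add: algebra_simps)
  with F' show ?thesis by simp
qed


subsection \<open>The theta series\<close>

definition theta_factor :: "nat \<Rightarrow> real \<Rightarrow> real fps" where
  "theta_factor k z = (1 - fps_const (2 * cos (2 * z)) * fps_X ^ k + fps_X ^ (2 * k)) * (1 - fps_X ^ k)"

lemma theta_trunc_0: "theta_trunc 0 z = fps_const (2 * sin z)"
  by (simp add: theta_trunc_def)

lemma theta_trunc_Suc: "theta_trunc (Suc m) z = theta_trunc m z * theta_factor (Suc m) z"
  by (simp add: theta_trunc_def theta_factor_def prod.atLeast1_atMost_eq mult.assoc)

lemma theta_trunc_cong:
  assumes "n \<le> K" shows "fps_cong n (theta_trunc K z) (theta_trunc n z)"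
  using assms
proof (induction K rule: dec_induct)
  case (step K)
  have X: "fps_cong n (c * fps_X ^ k) 0" if "n < k" for c :: "real fps" and k
    using that by (simp add: fps_cong_def fps_X_power_mult_right_nth)
  have "fps_cong n (theta_factor (Suc K) z) ((1 - 0 + 0) * (1 - 0))"
    unfolding theta_factor_def
    using step.hyps X[of "2 * Suc K" 1] X[of "Suc K" 1]
    by (intro fps_cong_mult fps_cong_add fps_cong_diff fps_cong_refl X) auto
  with step.IH have "fps_cong n (theta_trunc (Suc K) z) (theta_trunc n z * ((1 - 0 + 0) * (1 - 0)))"
    unfolding theta_trunc_Suc by (rule fps_cong_mult)
  then show ?case by simp
qed simp

lemma theta_trunc_cong_theta: "fps_cong K (theta_trunc K z) (theta_d 0 z)"
  unfolding fps_cong_def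
proof (intro allI impI)
  fix n assume "n \<le> K"
  then have "theta_trunc K z $ n = theta_trunc n z $ n"
    using theta_trunc_cong[of n K z] by (simp add: fps_cong_def)
  then show "theta_trunc K z $ n = theta_d 0 z $ n"
    by (simp add: theta_d_def theta_coeff_def)
qed

definition sin_geom :: "nat \<Rightarrow> real \<Rightarrow> real fps" where
  "sin_geom k z = Abs_fps (\<lambda>n. if k dvd n then sin (2 * real (n div k) * z) else 0)"

text \<open>The generating function of the sequence sin (2 j z), by its three-term recurrence. It
  makes \<open>sin_geom\<close>, up to the factor 4, the logarithmic derivative of one factor of the
  product.\<close>

lemma sin_geom_eq:
  assumes "k > 0"
  shows "(1 - fps_const (2 * cos (2 * z)) * fps_X ^ k + fps_X ^ (2 * k)) * sin_geom k z =
    fps_const (sin (2 * z)) * fps_X ^ k"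
proof (rule fps_ext)
  fix n
  let ?S = "sin_geom k z"
  have "(1 - fps_const (2 * cos (2 * z)) * fps_X ^ k + fps_X ^ (2 * k)) * ?S =
     ?S - fps_const (2 * cos (2 * z)) * (fps_X ^ k * ?S) + fps_X ^ (2 * k) * ?S"
    by (simp add: algebra_simps)
  then have eq: "((1 - fps_const (2 * cos (2 * z)) * fps_X ^ k + fps_X ^ (2 * k)) * ?S) $ n =
     ?S $ n - 2 * cos (2 * z) * (if n < k then 0 else ?S $ (n - k)) + (if n < 2 * k then 0 else ?S $ (n - 2 * k))"
    by (simp add: fps_X_power_mult_nth)
  have r: "(fps_const (sin (2 * z)) * fps_X ^ k) $ n = (if n = k then sin (2 * z) else 0)"
    by (simp add: fps_X_power_nth)
  show "((1 - fps_const (2 * cos (2 * z)) * fps_X ^ k + fps_X ^ (2 * k)) * ?S) $ n =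
     (fps_const (sin (2 * z)) * fps_X ^ k) $ n"
  proof (cases "k dvd n")
    case False
    then have "\<not> k dvd n - k" if "n \<ge> k" using that by (simp add: dvd_minus_self)
    moreover have "\<not> k dvd n - 2 * k" if "n \<ge> 2 * k"
      using that False by (metis dvd_add dvd_triv_right le_add_diff_inverse)
    moreover have "n \<noteq> k" using False by auto
    ultimately show ?thesis unfolding eq r using False by (simp add: sin_geom_def)
  next
    case True
    then obtain j where j: "n = k * j" by blast
    consider "j = 0" | "j = 1" | i where "j = Suc (Suc i)" by (metis One_nat_def not0_implies_Suc)
    then show ?thesis
    proof cases
      case 1
      then show ?thesis unfolding eq r using assms by (simp add: j sin_geom_def)
    next
      case 2
      then show ?thesis unfolding eq r using assms by (simp add: j sin_geom_def)
    next
      case 3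
      have m: "n - k = k * Suc i" "n - 2 * k = k * i" "\<not> n < k" "\<not> n < 2 * k" "n \<noteq> k"
        using assms by (auto simp: j 3)
      define E where "E = 2 * real (Suc i) * z"
      have "sin (2 * real (Suc (Suc i)) * z) = sin (E + 2 * z)" "sin (2 * real i * z) = sin (E - 2 * z)"
        by (simp_all add: E_def algebra_simps)
      then show ?thesis unfolding eq r m
        using m assms by (simp add: sin_geom_def j 3 E_def[symmetric] del: of_nat_Suc)
          (simp add: sin_add sin_diff)
    qed
  qed
qed

lemma has_coeff_deriv_theta_factor:
  assumes "k > 0"
  shows "has_coeff_deriv (theta_factor k) (4 * sin_geom k z * theta_factor k z) z"
proof -
  have "has_coeff_deriv (theta_factor k)
     ((0 - (fps_const (- 4 * sin (2 * z)) * fps_X ^ k + fps_const (2 * cos (2 * z)) * 0) + 0) * (1 - fps_X ^ k) +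
      (1 - fps_const (2 * cos (2 * z)) * fps_X ^ k + fps_X ^ (2 * k)) * 0) z"
    unfolding theta_factor_def[abs_def]
    by (intro has_coeff_deriv_mult has_coeff_deriv_add has_coeff_deriv_diff has_coeff_deriv_const
        has_coeff_deriv_fps_const) (auto intro!: derivative_eq_intros)
  also have "(0 - (fps_const (- 4 * sin (2 * z)) * fps_X ^ k + fps_const (2 * cos (2 * z)) * 0) + 0) * (1 - fps_X ^ k) +
      (1 - fps_const (2 * cos (2 * z)) * fps_X ^ k + fps_X ^ (2 * k)) * 0 =
      4 * (fps_const (sin (2 * z)) * fps_X ^ k) * (1 - fps_X ^ k)"
    by (simp add: numeral_fps_const flip: fps_const_neg)
  also have "\<dots> = 4 * sin_geom k z * theta_factor k z"
    unfolding sin_geom_eq[OF assms, symmetric] theta_factor_def by (simp only: mult_ac)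
  finally show ?thesis .
qed

lemma has_coeff_deriv_theta_trunc:
  assumes "sin z \<noteq> 0"
  shows "has_coeff_deriv (theta_trunc K)
    ((fps_const (cot z) + 4 * (\<Sum>k=1..K. sin_geom k z)) * theta_trunc K z) z"
proof (induction K)
  case 0
  have "has_coeff_deriv (\<lambda>u. fps_const (2 * sin u)) (fps_const (cos z * 2)) z"
    by (auto intro!: has_coeff_deriv_fps_const derivative_eq_intros)
  then show ?case using assms by (simp add: theta_trunc_0[abs_def] theta_trunc_0 cot_def)
next
  case (Suc K)
  have "has_coeff_deriv (\<lambda>u. theta_trunc K u * theta_factor (Suc K) u)
     ((fps_const (cot z) + 4 * (\<Sum>k=1..K. sin_geom k z)) * theta_trunc K z * theta_factor (Suc K) z
      + theta_trunc K z * (4 * sin_geom (Suc K) z * theta_factor (Suc K) z)) z"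
    by (intro has_coeff_deriv_mult Suc has_coeff_deriv_theta_factor) simp
  then show ?case
    by (simp add: theta_trunc_Suc[abs_def] theta_trunc_Suc algebra_simps)
qed

text \<open>Both sides sum sin (2 j z) q^(j k) over j and k; the coefficient of q^n is matched by
  exchanging a divisor of n with its cofactor.\<close>

lemma sum_sin_geom_cong:
  "fps_cong K (\<Sum>k=1..K. sin_geom k z) (sin_series z)"
  unfolding fps_cong_def
proof (intro allI impI)
  fix n assume "n \<le> K"
  show "(\<Sum>k=1..K. sin_geom k z) $ n = sin_series z $ n"
  proof (cases "n = 0")
    case True
    then show ?thesis by (simp add: fps_sum_nth sin_geom_def sin_series_def)
  next
    case False
    have "(\<Sum>k=1..K. sin_geom k z) $ n =
        (\<Sum>k=1..K. sin (2 * real (n div k) * z) * (if 0 < n \<and> k dvd n then 1 else 0))"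
      using False unfolding fps_sum_nth by (intro sum.cong) (auto simp: sin_geom_def)
    also have "\<dots> = (\<Sum>k | k dvd n. sin (2 * real (n div k) * z))"
      using sum_dvd_atMost[OF \<open>n \<le> K\<close>, of "\<lambda>k. sin (2 * real (n div k) * z)" "\<lambda>_. 1"] False
      by simp
    also have "\<dots> = sin_series z $ n"
      unfolding sin_series_def fps_nth_Abs_fps
      by (rule sum.reindex_bij_witness[of _ "\<lambda>d. n div d" "\<lambda>d. n div d"])
         (use False in \<open>auto simp: div_div_eq_right dest: dvd_imp_le\<close>)
    finally show ?thesis .
  qed
qed

lemma has_coeff_deriv_theta:
  assumes "sin z \<noteq> 0"
  shows "has_coeff_deriv (theta_d 0) (log_deriv z * theta_d 0 z) z"
  unfolding has_coeff_deriv_def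
proof
  fix K
  let ?D = "(fps_const (cot z) + 4 * (\<Sum>k=1..K. sin_geom k z)) * theta_trunc K z"
  have "fps_cong K ?D (log_deriv z * theta_d 0 z)"
    unfolding log_deriv_def
    by (intro fps_cong_mult fps_cong_add fps_cong_refl sum_sin_geom_cong theta_trunc_cong_theta)
  then have "?D $ K = (log_deriv z * theta_d 0 z) $ K"
    by (simp add: fps_cong_def)
  moreover have "(\<lambda>u. theta_d 0 u $ K) = (\<lambda>u. theta_trunc K u $ K)"
    by (simp add: theta_d_def theta_coeff_def)
  moreover have "((\<lambda>u. theta_trunc K u $ K) has_real_derivative ?D $ K) (at z)"
    using has_coeff_deriv_theta_trunc[OF assms, of K] unfolding has_coeff_deriv_def by blast
  ultimately show "((\<lambda>u. theta_d 0 u $ K) has_real_derivative (log_deriv z * theta_d 0 z) $ K) (at z)"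
    by (simp only:)
qed

text \<open>\<open>theta_d\<close> iterates the total function \<open>deriv\<close>, which carries
  information only where derivatives exist. Writing the coefficients as sin z times a polynomial in
  cos z gives differentiability to all orders needed, and the oddness that makes theta and theta''
  vanish at 0.\<close>

definition cos_poly :: "(real \<Rightarrow> real fps) \<Rightarrow> bool" where
  "cos_poly F \<longleftrightarrow> (\<forall>n. \<exists>p. \<forall>z. F z $ n = poly p (cos z))"

lemma cos_poly_const: "cos_poly (\<lambda>_. c)"
  unfolding cos_poly_def
proof
  fix n show "\<exists>p. \<forall>z. c $ n = poly p (cos z)"
    by (intro exI[of _ "[:c $ n:]"]) simp
qed

lemma cos_poly_fps_const: "cos_poly (\<lambda>z. fps_const (poly p (cos z)))"
  unfolding cos_poly_def
proof
  fix n show "\<exists>q. \<forall>z. fps_const (poly p (cos z)) $ n = poly q (cos z)"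
    by (intro exI[of _ "if n = 0 then p else 0"]) simp
qed

lemma cos_poly_add: "cos_poly F \<Longrightarrow> cos_poly G \<Longrightarrow> cos_poly (\<lambda>z. F z + G z)"
  unfolding cos_poly_def by (metis fps_add_nth poly_add)

lemma cos_poly_diff: "cos_poly F \<Longrightarrow> cos_poly G \<Longrightarrow> cos_poly (\<lambda>z. F z - G z)"
  unfolding cos_poly_def by (metis fps_sub_nth poly_diff)

lemma cos_poly_mult:
  assumes "cos_poly F" "cos_poly G" shows "cos_poly (\<lambda>z. F z * G z)"
proof -
  obtain p q where "\<And>n z. F z $ n = poly (p n) (cos z)" "\<And>n z. G z $ n = poly (q n) (cos z)"
    using assms unfolding cos_poly_def by metis
  then have "(F z * G z) $ n = poly (\<Sum>i=0..n. p i * q (n - i)) (cos z)" for n z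
    by (simp add: fps_mult_nth poly_sum)
  then show ?thesis
    unfolding cos_poly_def by blast
qed

lemma theta_trunc_cos_poly: "\<exists>F. cos_poly F \<and> (\<forall>z. theta_trunc m z = fps_const (sin z) * F z)"
proof (induction m)
  case 0
  show ?case
    by (intro exI[of _ "\<lambda>_. 2"]) (simp add: theta_trunc_0 cos_poly_const numeral_fps_const mult.commute)
next
  case (Suc m)
  then obtain F where F: "cos_poly F" "\<And>z. theta_trunc m z = fps_const (sin z) * F z" by blast
  have "2 * cos (2 * z) = poly [:- 2, 0, 4:] (cos z)" for z :: real
    by (simp add: cos_double_cos power2_eq_square)
  then have "cos_poly (theta_factor (Suc m))"
    unfolding theta_factor_def[abs_def]
    by (simp only:) (intro cos_poly_mult cos_poly_add cos_poly_diff cos_poly_const cos_poly_fps_const)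
  with F show ?case
    by (intro exI[of _ "\<lambda>z. F z * theta_factor (Suc m) z"])
       (simp add: cos_poly_mult theta_trunc_Suc mult.assoc)
qed

lemma theta_coeff_deriv:
  "\<exists>p0 p1 p2 p3. theta_coeff n = (\<lambda>z. sin z * poly p0 (cos z)) \<and>
    deriv (theta_coeff n) = (\<lambda>z. poly p1 (cos z)) \<and>
    deriv (deriv (theta_coeff n)) = (\<lambda>z. sin z * poly p2 (cos z)) \<and>
    deriv (deriv (deriv (theta_coeff n))) = (\<lambda>z. poly p3 (cos z))"
proof -
  have 1: "\<exists>q. deriv (\<lambda>z. sin z * poly p (cos z)) = (\<lambda>z. poly q (cos z :: real))" for p
  proof (intro exI ext DERIV_imp_deriv)
    fix z :: real
    have eq: "poly ([:0, 1:] * p - [:1, 0, - 1:] * pderiv p) (cos z) =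
        cos z * poly p (cos z) - sin z ^ 2 * poly (pderiv p) (cos z)"
      unfolding sin_squared_eq by (simp add: algebra_simps power2_eq_square)
    show "((\<lambda>z. sin z * poly p (cos z)) has_real_derivative
       poly ([:0, 1:] * p - [:1, 0, - 1:] * pderiv p) (cos z)) (at z)"
      unfolding eq
      by (auto intro!: derivative_eq_intros DERIV_chain2[OF poly_DERIV] simp: power2_eq_square)
  qed
  have 2: "\<exists>q. deriv (\<lambda>z. poly p (cos z :: real)) = (\<lambda>z. sin z * poly q (cos z))" for p
  proof (intro exI ext DERIV_imp_deriv)
    fix z :: real
    show "((\<lambda>z. poly p (cos z)) has_real_derivative sin z * poly (- pderiv p) (cos z)) (at z)"
      by (auto intro!: derivative_eq_intros DERIV_chain2[OF poly_DERIV])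
  qed
  obtain F where F: "cos_poly F" "\<And>z. theta_trunc n z = fps_const (sin z) * F z"
    using theta_trunc_cos_poly by blast
  then obtain p0 where "theta_coeff n = (\<lambda>z. sin z * poly p0 (cos z))"
    unfolding cos_poly_def theta_coeff_def fun_eq_iff by (metis fps_mult_left_const_nth)
  then show ?thesis using 1 2 by metis
qed

lemma has_coeff_deriv_theta_d:
  assumes "j < 3" shows "has_coeff_deriv (theta_d j) (theta_d (Suc j) z) z"
  unfolding has_coeff_deriv_def
proof
  fix n
  obtain p0 p1 p2 p3 where p: "theta_coeff n = (\<lambda>z. sin z * poly p0 (cos z))"
    "deriv (theta_coeff n) = (\<lambda>z. poly p1 (cos z))"
    "deriv (deriv (theta_coeff n)) = (\<lambda>z. sin z * poly p2 (cos z))"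
    using theta_coeff_deriv by metis
  have pc: "((\<lambda>z. poly q (cos z)) has_real_derivative poly (pderiv q) (cos z) * - sin z) (at z)"
    for q :: "real poly" and z
    by (auto intro!: derivative_eq_intros DERIV_chain2[OF poly_DERIV])
  have d: "(\<lambda>z. sin z * poly q (cos z)) differentiable (at z)" "(\<lambda>z. poly q (cos z)) differentiable (at z)"
    for q :: "real poly" and z
    unfolding real_differentiable_def
    using pc DERIV_mult[OF DERIV_sin pc] by blast+
  have "((deriv ^^ j) (theta_coeff n)) differentiable (at z)"
  proof -
    consider "j = 0" | "j = 1" | "j = 2" using assms by linarith
    then show ?thesis
    proof cases
      case 1 then show ?thesis using d(1)[of p0 z] p(1) by simp
    next
      case 2 then show ?thesis using d(2)[of p1 z] p(2) by simp
    next
      case 3 then show ?thesis using d(1)[of p2 z] p(3) by (simp add: numeral_2_eq_2)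
    qed
  qed
  then have "((deriv ^^ j) (theta_coeff n) has_real_derivative deriv ((deriv ^^ j) (theta_coeff n)) z) (at z)"
    by (simp add: DERIV_deriv_iff_real_differentiable)
  then show "((\<lambda>u. theta_d j u $ n) has_real_derivative theta_d (Suc j) z $ n) (at z)"
    by (simp add: theta_d_def eta_contract_eq)
qed

lemma theta_d_1:
  assumes "sin z \<noteq> 0" shows "theta_d 1 z = log_deriv z * theta_d 0 z"
proof -
  have "has_coeff_deriv (theta_d 0) (theta_d (Suc 0) z) z"
    by (rule has_coeff_deriv_theta_d) simp
  from has_coeff_deriv_unique[OF this has_coeff_deriv_theta[OF assms]] show ?thesis by simp
qed

text \<open>The square in the Riccati equation cancels the one produced by the product rule.\<close>

lemma theta_d_2:
  assumes "sin z \<noteq> 0" shows "theta_d 2 z = - (heat_pot z * theta_d 0 z)"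
proof -
  have "eventually (\<lambda>u. log_deriv u * theta_d 0 u = theta_d 1 u) (nhds z)"
    using eventually_sin_neq_0[OF assms] by eventually_elim (rule theta_d_1[symmetric])
  with has_coeff_deriv_mult[OF has_coeff_deriv_log_deriv has_coeff_deriv_theta] assms
  have "has_coeff_deriv (theta_d 1) ((- (log_deriv z ^ 2) - heat_pot z) * theta_d 0 z
      + log_deriv z * (log_deriv z * theta_d 0 z)) z"
    by (blast intro: has_coeff_deriv_cong)
  from has_coeff_deriv_unique[OF has_coeff_deriv_theta_d this]
  show ?thesis by (simp add: numeral_2_eq_2 algebra_simps)
qed

lemma theta_d_2_0: "theta_d 2 0 = 0" "theta_d 0 0 = 0"
proof -
  have "(deriv ^^ 2) (theta_coeff n) 0 = 0 \<and> theta_coeff n 0 = 0" for n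
    using theta_coeff_deriv[of n] by (auto simp: numeral_2_eq_2)
  then show "theta_d 2 0 = 0" "theta_d 0 0 = 0"
    by (auto intro!: fps_ext simp: theta_d_def)
qed

text \<open>The point 0 is included because R involves theta'''(0) / theta'(0). The formula for
  theta'' persists at 0, where both of its sides vanish, and can therefore be differentiated
  there.\<close>

lemma theta_d_3:
  assumes "sin z \<noteq> 0 \<or> z = 0"
  shows "theta_d 3 z = - (8 * euler (log_deriv z) * theta_d 0 z + heat_pot z * theta_d 1 z)"
proof -
  have "eventually (\<lambda>u. sin u \<noteq> 0 \<or> u = 0) (nhds z)"
  proof (cases "sin z = 0")
    case True
    with assms eventually_sin_neq_0_at_0 show ?thesis by (auto elim: eventually_mono)
  next
    case False
    from eventually_sin_neq_0[OF this] show ?thesis by eventually_elim simp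
  qed
  then have "eventually (\<lambda>u. - (heat_pot u * theta_d 0 u) = theta_d 2 u) (nhds z)"
    by eventually_elim (auto simp: theta_d_2 theta_d_2_0)
  with has_coeff_deriv_minus[OF has_coeff_deriv_mult[OF has_coeff_deriv_heat_pot
    has_coeff_deriv_theta_d[of 0 z]]]
  have "has_coeff_deriv (theta_d 2) (- (8 * euler (log_deriv z) * theta_d 0 z + heat_pot z * theta_d (Suc 0) z)) z"
    by (auto intro: has_coeff_deriv_cong)
  from has_coeff_deriv_unique[OF has_coeff_deriv_theta_d this]
  show ?thesis by (simp add: numeral_3_eq_3 numeral_2_eq_2)
qed

lemma theta_d_1_nth_0: "theta_d 1 z $ 0 = 2 * cos z"
proof -
  have "deriv (theta_coeff 0) z = 2 * cos z"
    unfolding theta_coeff_def theta_trunc_0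
    by (rule DERIV_imp_deriv) (auto intro!: derivative_eq_intros)
  then show ?thesis by (simp add: theta_d_def)
qed

lemma fps_eq_mult_inverse:
  fixes F G H :: "real fps"
  assumes "F * G = H" "G $ 0 \<noteq> 0" shows "H * inverse G = F"
  using assms inverse_mult_eq_1'[of G] by (metis mult.assoc mult.right_neutral)

lemma theta_d_3_quotient_0: "theta_d 3 0 * inverse (theta_d 1 0) = - heat_pot 0"
  by (rule fps_eq_mult_inverse) (simp_all add: theta_d_3 theta_d_2_0 theta_d_1_nth_0[simplified])

section \<open>Elliptic functions: chord and tangent formulas and the derivatives in q\<close>

subsection \<open>The Weierstrass function\<close>

text \<open>\<open>eis2\<close> is the Eisenstein series of weight two up to a factor, so that
  \<open>wp = eis2 - log_deriv'\<close> is the Weierstrass function.\<close>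

definition eis2 :: "real fps" where
  "eis2 = - (fps_const (1 / 3) * heat_pot 0)"

definition wp :: "real \<Rightarrow> real fps" where
  "wp z = log_deriv z ^ 2 + heat_pot z + eis2"

text \<open>\<open>wp_d\<close> and \<open>wp_dd\<close> are the first two z-derivatives of
  \<open>wp\<close>, with \<open>heat_pot\<close>' replaced by its value in terms of
  \<open>euler\<close>. Read backwards, the two definitions give the q-derivatives of
  \<open>log_deriv\<close> and of \<open>eis2 - wp\<close>.\<close>

definition wp_d :: "real \<Rightarrow> real fps" where
  "wp_d z = 8 * euler (log_deriv z) + 2 * log_deriv z * (eis2 - wp z)"

definition wp_dd :: "real \<Rightarrow> real fps" where
  "wp_dd z = 8 * euler (eis2 - wp z) + 2 * (eis2 - wp z) ^ 2 - 2 * log_deriv z * wp_d z"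

text \<open>Up to sign, the slope of the chord through the points with parameters u and v on the
  cubic parametrised by (wp, wp' / 2); \<open>slope_mult_wp_diff\<close> makes this precise.\<close>

definition slope :: "real \<Rightarrow> real \<Rightarrow> real fps" where
  "slope u v = log_deriv u + log_deriv v - log_deriv (u + v)"

lemma eis2_eq: "3 * eis2 = - heat_pot 0"
proof -
  have "3 * fps_const (1 / 3) = (1 :: real fps)"
    by (simp add: numeral_fps_const)
  then show ?thesis
    unfolding eis2_def by (simp only: mult_minus_right mult.assoc[symmetric] mult_1)
qed

lemma fps_two_cancel: "2 * F = 2 * G \<Longrightarrow> F = (G :: real fps)"
  by simp

lemma fps_cancel: "C * F = C * G \<Longrightarrow> C \<noteq> 0 \<Longrightarrow> F = (G :: real fps)"
  by simp

lemma has_coeff_deriv_log_deriv_wp: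
  "sin z \<noteq> 0 \<Longrightarrow> has_coeff_deriv log_deriv (eis2 - wp z) z"
  using has_coeff_deriv_log_deriv[of z] by (simp add: wp_def)

lemma has_coeff_deriv_wp:
  assumes "sin z \<noteq> 0" shows "has_coeff_deriv wp (wp_d z) z"
proof -
  have "has_coeff_deriv (\<lambda>z. log_deriv z * log_deriv z + heat_pot z + eis2)
      ((eis2 - wp z) * log_deriv z + log_deriv z * (eis2 - wp z) + 8 * euler (log_deriv z) + 0) z"
    by (intro has_coeff_deriv_add has_coeff_deriv_mult has_coeff_deriv_const
        has_coeff_deriv_log_deriv_wp has_coeff_deriv_heat_pot assms)
  then show ?thesis
    by (simp add: wp_def[abs_def] wp_d_def power2_eq_square algebra_simps)
qed

lemma has_coeff_deriv_wp_d:
  assumes "sin z \<noteq> 0" shows "has_coeff_deriv wp_d (wp_dd z) z"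
proof -
  have "has_coeff_deriv (\<lambda>z. 8 * euler (log_deriv z) + 2 * (log_deriv z * (eis2 - wp z)))
      ((0 * euler (log_deriv z) + 8 * euler (eis2 - wp z)) +
       (0 * (log_deriv z * (eis2 - wp z)) +
        2 * ((eis2 - wp z) * (eis2 - wp z) + log_deriv z * (0 - wp_d z)))) z"
    by (intro has_coeff_deriv_add has_coeff_deriv_mult has_coeff_deriv_diff has_coeff_deriv_const
        has_coeff_deriv_euler has_coeff_deriv_wp has_coeff_deriv_log_deriv_wp assms)
  then show ?thesis
    by (simp add: wp_d_def[abs_def] wp_dd_def power2_eq_square algebra_simps)
qed

text \<open>The cross terms of the square are those of the symmetric product identity at u, v, - (u
  + v). The multiple 3 of \<open>eis2\<close> removes \<open>cos_series 0\<close> from the three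
  heat potentials.\<close>

lemma slope_square:
  assumes "sin u \<noteq> 0" "sin v \<noteq> 0" "sin (u + v) \<noteq> 0"
  shows "slope u v ^ 2 = wp u + wp v + wp (u + v)"
proof -
  have "sin (- (u + v)) \<noteq> 0" using assms(3) unfolding sin_minus by simp
  from log_deriv_symmetric_product[OF _ assms(1,2) this]
  have "log_deriv u * log_deriv v - (log_deriv u + log_deriv v) * log_deriv (u + v) =
      1 - 8 * (cos_series u + cos_series v + cos_series (u + v))"
    unfolding log_deriv_minus cos_series_minus by (simp add: algebra_simps)
  moreover have "heat_pot u + heat_pot v + heat_pot (u + v) + 3 * eis2 =
      2 * (1 - 8 * (cos_series u + cos_series v + cos_series (u + v)))"
    unfolding eis2_eq by (simp add: heat_pot_def algebra_simps)
  moreover have "wp u + wp v + wp (u + v) = log_deriv u ^ 2 + log_deriv v ^ 2 + log_deriv (u + v) ^ 2 +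
     (heat_pot u + heat_pot v + heat_pot (u + v) + 3 * eis2)"
    by (simp add: wp_def)
  ultimately show ?thesis
    unfolding slope_def by algebra
qed

lemma slope_commute: "slope u v = slope v u"
  by (simp add: slope_def add.commute)

lemma eventually_sin_add_neq_0:
  assumes "sin (a + b :: real) \<noteq> 0" shows "eventually (\<lambda>u. sin (u + b) \<noteq> 0) (nhds a)"
proof -
  have "((\<lambda>u. u + b) \<longlongrightarrow> a + b) (nhds a)"
    by (intro tendsto_intros filterlim_ident)
  then show ?thesis
    using eventually_sin_neq_0[OF assms] unfolding filterlim_iff by blast
qed

lemma has_coeff_deriv_shift:
  "has_coeff_deriv F F' (z + b) \<Longrightarrow> has_coeff_deriv (\<lambda>u. F (u + b)) F' z"
  using has_coeff_deriv_chain[of F F' "\<lambda>u. u + b" z 1] DERIV_shift[of "\<lambda>u. u" 1 z b]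
  by simp

lemma has_coeff_deriv_slope:
  assumes "sin u \<noteq> 0" "sin (u + v) \<noteq> 0"
  shows "has_coeff_deriv (\<lambda>u. slope u v) (wp (u + v) - wp u) u"
proof -
  have "has_coeff_deriv (\<lambda>u. slope u v) (eis2 - wp u + 0 - (eis2 - wp (u + v))) u"
    unfolding slope_def
    by (intro has_coeff_deriv_add has_coeff_deriv_diff has_coeff_deriv_const has_coeff_deriv_shift
        has_coeff_deriv_log_deriv_wp assms)
  then show ?thesis by simp
qed

text \<open>The derivative of \<open>slope_square\<close> in u, with v fixed.\<close>

lemma slope_mult_wp_add:
  assumes "sin u \<noteq> 0" "sin v \<noteq> 0" "sin (u + v) \<noteq> 0"
  shows "2 * slope u v * (wp (u + v) - wp u) = wp_d u + wp_d (u + v)"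
proof -
  have "eventually (\<lambda>u. slope u v * slope u v = wp u + wp v + wp (u + v)) (nhds u)"
    using eventually_sin_neq_0[OF assms(1)] eventually_sin_add_neq_0[OF assms(3)]
    by eventually_elim (simp add: slope_square[OF _ assms(2)] flip: power2_eq_square)
  moreover have "has_coeff_deriv (\<lambda>u. slope u v * slope u v)
      ((wp (u + v) - wp u) * slope u v + slope u v * (wp (u + v) - wp u)) u"
    by (intro has_coeff_deriv_mult has_coeff_deriv_slope assms)
  moreover have "has_coeff_deriv (\<lambda>u. wp u + wp v + wp (u + v)) (wp_d u + 0 + wp_d (u + v)) u"
    by (intro has_coeff_deriv_add has_coeff_deriv_const has_coeff_deriv_shift has_coeff_deriv_wp assms)
  ultimately have "(wp (u + v) - wp u) * slope u v + slope u v * (wp (u + v) - wp u) =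
      wp_d u + 0 + wp_d (u + v)"
    by (rule has_coeff_deriv_unique_ev)
  then show ?thesis by (simp add: algebra_simps)
qed

lemma slope_mult_wp_diff:
  assumes "sin u \<noteq> 0" "sin v \<noteq> 0" "sin (u + v) \<noteq> 0"
  shows "2 * slope u v * (wp v - wp u) = wp_d u - wp_d v"
  using slope_mult_wp_add[OF assms] slope_mult_wp_add[of v u] assms
  by (simp add: slope_commute[of v u] add.commute[of v u] algebra_simps)

text \<open>Differentiating the chord formula at coinciding points gives the tangent: the factor
  \<open>wp u - wp v\<close> vanishes there, so only its derivative contributes.\<close>

lemma wp_dd_eq:
  assumes "sin u \<noteq> 0" "sin (u + u) \<noteq> 0"
  shows "wp_dd u = - (2 * slope u u * wp_d u)"
proof -
  have "eventually (\<lambda>v. 2 * slope v u * (wp u - wp v) = wp_d v - wp_d u) (nhds u)"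
    using eventually_sin_neq_0[OF assms(1)] eventually_sin_add_neq_0[OF assms(2)]
    by eventually_elim (rule slope_mult_wp_diff[OF _ assms(1)])
  moreover have "has_coeff_deriv (\<lambda>v. 2 * slope v u * (wp u - wp v))
     ((0 * slope u u + 2 * (wp (u + u) - wp u)) * (wp u - wp u) + 2 * slope u u * (0 - wp_d u)) u"
    by (intro has_coeff_deriv_mult has_coeff_deriv_diff has_coeff_deriv_const has_coeff_deriv_slope
        has_coeff_deriv_wp assms)
  moreover have "has_coeff_deriv (\<lambda>v. wp_d v - wp_d u) (wp_dd u - 0) u"
    by (intro has_coeff_deriv_diff has_coeff_deriv_const has_coeff_deriv_wp_d assms)
  ultimately have "(0 * slope u u + 2 * (wp (u + u) - wp u)) * (wp u - wp u) + 2 * slope u u * (0 - wp_d u)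
      = wp_dd u - 0"
    by (rule has_coeff_deriv_unique_ev)
  then show ?thesis by simp
qed

lemma wp_double:
  assumes "sin u \<noteq> 0" "sin (2 * u) \<noteq> 0"
  shows "wp (2 * u) = slope u u ^ 2 - 2 * wp u"
proof -
  have "slope u u ^ 2 = wp u + wp u + wp (2 * u)"
    using slope_square[of u u] assms by (simp flip: mult_2)
  then show ?thesis by simp
qed

lemma wp_d_double:
  assumes "sin u \<noteq> 0" "sin (2 * u) \<noteq> 0"
  shows "wp_d (2 * u) = 2 * slope u u * (slope u u ^ 2 - 3 * wp u) - wp_d u"
proof -
  have "2 * slope u u * (wp (2 * u) - wp u) = wp_d u + wp_d (2 * u)"
    using slope_mult_wp_add[of u u] assms by (simp flip: mult_2)
  then show ?thesis
    unfolding wp_double[OF assms] by (simp add: algebra_simps)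
qed

lemma has_coeff_deriv_double:
  "has_coeff_deriv F F' (2 * z) \<Longrightarrow> has_coeff_deriv (\<lambda>u. F (2 * u)) (2 * F') z"
  using has_coeff_deriv_chain[of F F' "\<lambda>u. 2 * u" z 2] DERIV_cmult_Id[of 2 z UNIV]
  by (simp add: numeral_fps_const)

lemma has_coeff_deriv_slope_diag:
  assumes "sin u \<noteq> 0" "sin (2 * u) \<noteq> 0"
  shows "has_coeff_deriv (\<lambda>u. slope u u) (2 * slope u u ^ 2 - 6 * wp u) u"
proof -
  have "has_coeff_deriv (\<lambda>u. log_deriv u + log_deriv u - log_deriv (2 * u))
    (eis2 - wp u + (eis2 - wp u) - 2 * (eis2 - wp (2 * u))) u"
    by (intro has_coeff_deriv_add has_coeff_deriv_diff has_coeff_deriv_log_deriv_wp assms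
        has_coeff_deriv_double[OF has_coeff_deriv_log_deriv_wp])
  moreover have "(\<lambda>u. log_deriv u + log_deriv u - log_deriv (2 * u)) = (\<lambda>u. slope u u)"
    unfolding slope_def mult_2 ..
  ultimately show ?thesis
    unfolding wp_double[OF assms] by (simp add: algebra_simps)
qed

lemma wp_dd_eq':
  assumes "sin u \<noteq> 0" "sin (2 * u) \<noteq> 0" shows "wp_dd u = - (2 * slope u u * wp_d u)"
  by (rule wp_dd_eq) (use assms in \<open>simp_all flip: mult_2\<close>)

lemma eventually_sin_double_neq_0:
  assumes "sin (2 * u :: real) \<noteq> 0" shows "eventually (\<lambda>v. sin (2 * v) \<noteq> 0) (nhds u)"
proof -
  have "((\<lambda>u. 2 * u) \<longlongrightarrow> 2 * u) (nhds u)"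
    by (intro tendsto_intros filterlim_ident)
  then show ?thesis
    using eventually_sin_neq_0[OF assms] unfolding filterlim_iff by blast
qed

lemma wp_dd_double:
  assumes "sin u \<noteq> 0" "sin (2 * u) \<noteq> 0"
  shows "wp_dd (2 * u) = (6 * slope u u ^ 2 - 6 * wp u) * (slope u u ^ 2 - 3 * wp u)
    - 2 * slope u u * wp_d u"
proof -
  let ?l = "slope u u" and ?x = "wp u" and ?y = "wp_d u"
  let ?l' = "2 * ?l ^ 2 - 6 * ?x"
  have "eventually (\<lambda>v. wp_d (2 * v) = 2 * slope v v * (slope v v ^ 2 - 3 * wp v) - wp_d v) (nhds u)"
    using eventually_sin_double_neq_0[OF assms(2)] eventually_sin_neq_0[OF assms(1)]
    by eventually_elim (rule wp_d_double)
  moreover have "has_coeff_deriv (\<lambda>v. wp_d (2 * v)) (2 * wp_dd (2 * u)) u"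
    by (rule has_coeff_deriv_double[OF has_coeff_deriv_wp_d[OF assms(2)]])
  moreover have "has_coeff_deriv (\<lambda>v. 2 * slope v v * (slope v v ^ 2 - 3 * wp v) - wp_d v)
     ((0 * ?l + 2 * ?l') * (?l ^ 2 - 3 * ?x)
       + 2 * ?l * (2 * ?l * ?l' - (0 * ?x + 3 * ?y)) - wp_dd u) u"
    using has_coeff_deriv_diff[OF has_coeff_deriv_mult[OF
        has_coeff_deriv_mult[OF has_coeff_deriv_const has_coeff_deriv_slope_diag[OF assms]]
        has_coeff_deriv_diff[OF has_coeff_deriv_power2[OF has_coeff_deriv_slope_diag[OF assms]]
          has_coeff_deriv_mult[OF has_coeff_deriv_const has_coeff_deriv_wp[OF assms(1)]]]]
        has_coeff_deriv_wp_d[OF assms(1)]] .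
  ultimately have eq: "2 * wp_dd (2 * u) = (0 * ?l + 2 * ?l') * (?l ^ 2 - 3 * ?x)
       + 2 * ?l * (2 * ?l * ?l' - (0 * ?x + 3 * ?y)) - wp_dd u"
    by (rule has_coeff_deriv_unique_ev)
  with eq have "2 * wp_dd (2 * u) = 2 * ((6 * ?l ^ 2 - 6 * ?x) * (?l ^ 2 - 3 * ?x) - 2 * ?l * ?y)"
    unfolding wp_dd_eq'[OF assms] by algebra
  then show ?thesis by (rule fps_two_cancel)
qed

subsection \<open>The differential system in \<open>q\<close>\<close>

lemma euler_log_deriv: "8 * euler (log_deriv z) = wp_d z + 2 * log_deriv z * (wp z - eis2)"
  by (simp add: wp_d_def algebra_simps)

lemma euler_wp_eis2:
  "8 * euler (eis2 - wp z) = wp_dd z - 2 * (eis2 - wp z) ^ 2 + 2 * log_deriv z * wp_d z"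
  by (simp add: wp_dd_def)

text \<open>At this stage only the combination \<open>eis2 - wp\<close> has a known q-derivative.
  Since \<open>eis2\<close> does not depend on z, differentiating in z isolates
  \<open>wp_d\<close>.\<close>

lemma euler_wp_d:
  assumes "sin u \<noteq> 0" "sin (2 * u) \<noteq> 0"
  shows "4 * euler (wp_d u) = 2 * log_deriv u * slope u u * wp_d u - 3 * wp u * wp_d u - 3 * eis2 * wp_d u"
proof -
  let ?l = "slope u u" and ?x = "wp u" and ?y = "wp_d u" and ?A = "log_deriv u" and ?e = eis2
  note A' = has_coeff_deriv_log_deriv_wp[OF assms(1)] and x' = has_coeff_deriv_wp[OF assms(1)]
    and y' = has_coeff_deriv_wp_d[OF assms(1)] and l' = has_coeff_deriv_slope_diag[OF assms]
  note e_x' = has_coeff_deriv_diff[OF has_coeff_deriv_const x', of ?e]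
  have "eventually (\<lambda>v. 8 * euler (eis2 - wp v) =
      - (2 * slope v v * wp_d v) - 2 * (eis2 - wp v) ^ 2 + 2 * log_deriv v * wp_d v) (nhds u)"
    using eventually_sin_double_neq_0[OF assms(2)] eventually_sin_neq_0[OF assms(1)]
  proof eventually_elim
    case (elim v)
    show ?case unfolding euler_wp_eis2 wp_dd_eq'[OF elim(2,1)] ..
  qed
  moreover have "has_coeff_deriv (\<lambda>v. 8 * euler (eis2 - wp v))
      (0 * euler (eis2 - wp u) + 8 * euler (0 - wp_d u)) u"
    by (rule has_coeff_deriv_mult[OF has_coeff_deriv_const has_coeff_deriv_euler[OF e_x']])
  moreover have "has_coeff_deriv (\<lambda>v. - (2 * slope v v * wp_d v) - 2 * (eis2 - wp v) ^ 2
      + 2 * log_deriv v * wp_d v)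
     (- ((0 * ?l + 2 * (2 * ?l ^ 2 - 6 * ?x)) * ?y + 2 * ?l * wp_dd u)
      - (0 * (?e - ?x) ^ 2 + 2 * (2 * (?e - ?x) * (0 - ?y)))
      + ((0 * ?A + 2 * (?e - ?x)) * ?y + 2 * ?A * wp_dd u)) u"
    using has_coeff_deriv_add[OF has_coeff_deriv_diff[OF
      has_coeff_deriv_minus[OF has_coeff_deriv_mult[OF has_coeff_deriv_mult[OF has_coeff_deriv_const l'] y']]
      has_coeff_deriv_mult[OF has_coeff_deriv_const has_coeff_deriv_power2[OF e_x']]]
      has_coeff_deriv_mult[OF has_coeff_deriv_mult[OF has_coeff_deriv_const A'] y']] .
  ultimately have "0 * euler (eis2 - wp u) + 8 * euler (0 - wp_d u) =
      (- ((0 * ?l + 2 * (2 * ?l ^ 2 - 6 * ?x)) * ?y + 2 * ?l * wp_dd u)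
      - (0 * (?e - ?x) ^ 2 + 2 * (2 * (?e - ?x) * (0 - ?y)))
      + ((0 * ?A + 2 * (?e - ?x)) * ?y + 2 * ?A * wp_dd u))"
    by (rule has_coeff_deriv_unique_ev)
  then have "2 * (4 * euler ?y) = 2 * (2 * ?A * ?l * ?y - 3 * ?x * ?y - 3 * ?e * ?y)"
    unfolding wp_dd_eq'[OF assms] diff_0 euler_uminus by algebra
  then show ?thesis by (rule fps_two_cancel)
qed

lemma log_deriv_double: "log_deriv (2 * u) = 2 * log_deriv u - slope u u"
  by (simp add: slope_def)

text \<open>The tangent slope is 2 A(u) - A(2u), and the q-derivative of A is known at both
  arguments; the duplication formulas then remove 2u.\<close>

lemma euler_slope:
  assumes "sin u \<noteq> 0" "sin (2 * u) \<noteq> 0"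
  shows "8 * euler (slope u u) = 3 * wp_d u + 2 * wp u * slope u u - 2 * eis2 * slope u u
    - 4 * log_deriv u * slope u u ^ 2 + 12 * log_deriv u * wp u"
proof -
  have "8 * euler (slope u u) = 2 * (8 * euler (log_deriv u)) - 8 * euler (log_deriv (2 * u))"
    unfolding slope_def euler_add euler_diff mult_2[of u] by algebra
  then show ?thesis
    unfolding euler_log_deriv
    unfolding wp_double[OF assms] wp_d_double[OF assms] log_deriv_double
    by algebra
qed

text \<open>Ramanujan's formula for the derivative of the Eisenstein series of weight two, with one
  quarter of the invariant g2 written as slope * wp' + 3 wp^2.\<close>

lemma euler_eis2:
  assumes "sin u \<noteq> 0" "sin (2 * u) \<noteq> 0"
  shows "12 * euler eis2 = slope u u * wp_d u + 3 * wp u ^ 2 - 3 * eis2 ^ 2"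
proof -
  let ?l = "slope u u" and ?x = "wp u" and ?y = "wp_d u" and ?A = "log_deriv u" and ?e = eis2
  \<comment> \<open>The duplication formula is regrouped so that every part except 3
    \<open>eis2\<close> already has a known q-derivative.\<close>
  have "?l * ?l = 3 * ?e - 2 * (?e - ?x) - (?e - wp (2 * u))"
    by (simp add: wp_double[OF assms] power2_eq_square)
  then have "8 * euler (?l * ?l) = 8 * euler (3 * ?e - 2 * (?e - ?x) - (?e - wp (2 * u)))"
    by simp
  then have "2 * ?l * (8 * euler ?l) = 24 * euler ?e - 2 * (8 * euler (?e - ?x)) - 8 * euler (?e - wp (2 * u))"
    unfolding euler_mult euler_numeral euler_diff[of _ "?e - wp (2 * u)"] euler_diff[of _ "2 * (?e - ?x)"]
    by algebra
  then have "2 * (12 * euler ?e) = 2 * (?l * ?y + 3 * ?x ^ 2 - 3 * ?e ^ 2)"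
    unfolding euler_slope[OF assms] euler_wp_eis2
    unfolding wp_dd_eq'[OF assms] wp_dd_double[OF assms] wp_double[OF assms]
      wp_d_double[OF assms] log_deriv_double
    by algebra
  then show ?thesis by (rule fps_two_cancel)
qed

lemma euler_wp:
  assumes "sin u \<noteq> 0" "sin (2 * u) \<noteq> 0"
  shows "12 * euler (wp u) = 4 * slope u u * wp_d u - 6 * eis2 * wp u + 6 * wp u ^ 2 - 3 * log_deriv u * wp_d u"
proof -
  have "2 * (12 * euler (wp u)) = 2 * (12 * euler eis2) - 3 * (8 * euler (eis2 - wp u))"
    unfolding euler_diff by algebra
  also have "\<dots> = 2 * (4 * slope u u * wp_d u - 6 * eis2 * wp u + 6 * wp u ^ 2 - 3 * log_deriv u * wp_d u)"
    unfolding euler_eis2[OF assms] euler_wp_eis2 wp_dd_eq'[OF assms] by algebra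
  finally show ?thesis by (rule fps_two_cancel)
qed


section \<open>T and R as expressions in X, Y, L and A\<close>

subsection \<open>The modular functions of weight zero\<close>

lemma log_deriv_nth_0: "log_deriv z $ 0 = cot z"
  by (simp add: log_deriv_def sin_series_def)

lemma fps_inverse_power2: "inverse (F ^ 2) = inverse F ^ 2" for F :: "real fps"
  by (simp add: fps_inverse_power)

context
  fixes \<alpha> :: real
  assumes s1: "sin \<alpha> \<noteq> 0" and c1: "cos \<alpha> \<noteq> 0"
begin

abbreviation (input) "AA \<equiv> log_deriv \<alpha>"

lemma sin_double_neq_0: "sin (2 * \<alpha>) \<noteq> 0"
  using s1 c1 by (simp add: sin_double)

lemma AA_nth_0: "AA $ 0 \<noteq> 0"
  using s1 c1 by (simp add: log_deriv_nth_0 cot_def)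

lemma AA_neq_0: "AA \<noteq> 0"
  using AA_nth_0 by auto

definition wp_norm where "wp_norm = wp \<alpha> * inverse AA ^ 2"
definition wp_d_norm where "wp_d_norm = wp_d \<alpha> * inverse AA ^ 3"
definition slope_norm where "slope_norm = slope \<alpha> \<alpha> * inverse AA"
definition T_norm where "T_norm = 8 * euler AA * inverse AA ^ 2"
text \<open>Expanding the theta quotients of R with A' = \<open>eis2\<close> - wp makes
  \<open>eis2\<close> cancel and leaves this polynomial; see \<open>R_of_q_eq\<close>.\<close>

definition R_norm where "R_norm = wp_d_norm + 3 * wp_norm - 1"

lemma AA_inverse: "AA * inverse AA = 1"
  using inverse_mult_eq_1'[OF AA_nth_0] .

lemma wp_eq_norm: "wp \<alpha> = wp_norm * AA ^ 2" and wp_d_eq_norm: "wp_d \<alpha> = wp_d_norm * AA ^ 3"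
  and slope_eq_norm: "slope \<alpha> \<alpha> = slope_norm * AA" and euler_AA: "8 * euler AA = T_norm * AA ^ 2"
  unfolding wp_norm_def wp_d_norm_def slope_norm_def T_norm_def using AA_inverse by algebra+

text \<open>The \<open>eis2\<close> term in the derivative of the numerator is cancelled by the one
  in the derivative of A^2. The same happens for the other two normalised functions, as all three
  have weight zero.\<close>

lemma euler_wp_norm: "12 * euler wp_norm = AA ^ 2 * (4 * wp_d_norm * slope_norm - 3 * wp_d_norm - 3 * wp_norm * wp_d_norm)"
proof -
  have "12 * euler (wp \<alpha>) = 12 * euler (wp_norm * (AA * AA))"
    by (simp add: wp_eq_norm power2_eq_square)
  then have "2 * (AA ^ 2 * (12 * euler wp_norm)) = 2 * (12 * euler (wp \<alpha>)) - 6 * wp_norm * AA * (8 * euler AA)"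
    unfolding euler_mult by algebra
  also have "\<dots> = 2 * (AA ^ 2 * (AA ^ 2 * (4 * wp_d_norm * slope_norm - 3 * wp_d_norm - 3 * wp_norm * wp_d_norm)))"
    unfolding euler_wp[OF s1 sin_double_neq_0] euler_log_deriv
    unfolding wp_eq_norm wp_d_eq_norm slope_eq_norm by algebra
  finally have "AA ^ 2 * (12 * euler wp_norm) = AA ^ 2 * (AA ^ 2 * (4 * wp_d_norm * slope_norm - 3 * wp_d_norm - 3 * wp_norm * wp_d_norm))"
    by (rule fps_two_cancel)
  then show ?thesis by (rule fps_cancel) (simp add: AA_neq_0)
qed

lemma euler_wp_d_norm: "8 * euler wp_d_norm = AA ^ 2 * (4 * wp_d_norm * slope_norm - 12 * wp_norm * wp_d_norm - 3 * wp_d_norm ^ 2)"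
proof -
  have "4 * euler (wp_d \<alpha>) = 4 * euler (wp_d_norm * (AA * (AA * AA)))"
    by (simp add: wp_d_eq_norm power3_eq_cube mult.assoc)
  then have "AA ^ 3 * (8 * euler wp_d_norm) = 2 * (4 * euler (wp_d \<alpha>)) - 3 * wp_d_norm * AA ^ 2 * (8 * euler AA)"
    unfolding euler_mult by algebra
  also have "\<dots> = AA ^ 3 * (AA ^ 2 * (4 * wp_d_norm * slope_norm - 12 * wp_norm * wp_d_norm - 3 * wp_d_norm ^ 2))"
    unfolding euler_wp_d[OF s1 sin_double_neq_0] euler_log_deriv
    unfolding wp_eq_norm wp_d_eq_norm slope_eq_norm by algebra
  finally show ?thesis by (rule fps_cancel) (simp add: AA_neq_0)
qed

lemma euler_slope_norm: "8 * euler slope_norm = AA ^ 2 * (3 * wp_d_norm - wp_d_norm * slope_norm - 4 * slope_norm ^ 2 + 12 * wp_norm)"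
proof -
  have "8 * euler (slope \<alpha> \<alpha>) = 8 * euler (slope_norm * AA)"
    by (simp add: slope_eq_norm)
  then have "AA * (8 * euler slope_norm) = 8 * euler (slope \<alpha> \<alpha>) - slope_norm * (8 * euler AA)"
    unfolding euler_mult by algebra
  also have "\<dots> = AA * (AA ^ 2 * (3 * wp_d_norm - wp_d_norm * slope_norm - 4 * slope_norm ^ 2 + 12 * wp_norm))"
    unfolding euler_slope[OF s1 sin_double_neq_0] euler_log_deriv
    unfolding wp_eq_norm wp_d_eq_norm slope_eq_norm by algebra
  finally show ?thesis by (rule fps_cancel) (simp add: AA_neq_0)
qed

definition R_rate where "R_rate = 12 * wp_d_norm * slope_norm - 18 * wp_norm * wp_d_norm - 3 * wp_d_norm ^ 2 - 6 * wp_d_norm"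

lemma euler_R_norm: "8 * euler R_norm = AA ^ 2 * R_rate"
proof -
  have "8 * euler R_norm = 8 * euler wp_d_norm + 2 * (12 * euler wp_norm)"
    unfolding R_norm_def euler_diff euler_add euler_mult euler_numeral euler_one by algebra
  then show ?thesis
    unfolding euler_wp_norm euler_wp_d_norm R_rate_def by algebra
qed

text \<open>\<open>T_norm\<close> * A^2 is wp' + 2 A (wp - \<open>eis2\<close>), so T still contains
  \<open>eis2\<close>. In its q-derivative all such terms cancel, including the square of
  \<open>eis2\<close> contributed by \<open>euler_eis2\<close>.\<close>

lemma euler_T_norm: "3 * euler T_norm = 2 * AA * euler R_norm"
proof -
  let ?t = "wp_d \<alpha> + 2 * AA * (wp \<alpha> - eis2)"
  have "?t = T_norm * (AA * AA)"
    using euler_AA unfolding euler_log_deriv by (simp add: power2_eq_square)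
  then have "euler ?t = euler (T_norm * (AA * AA))" by simp
  then have "euler (wp_d \<alpha>) + 2 * euler AA * (wp \<alpha> - eis2) + 2 * AA * (euler (wp \<alpha>) - euler eis2)
      = euler T_norm * AA ^ 2 + 2 * T_norm * AA * euler AA"
    unfolding euler_mult euler_add euler_diff euler_numeral by algebra
  moreover have "T_norm * AA * AA = ?t" using \<open>?t = T_norm * (AA * AA)\<close> by (simp add: mult.assoc)
  ultimately have "8 * AA * (3 * euler T_norm) * AA ^ 2 = 6 * AA * (4 * euler (wp_d \<alpha>))
     + 6 * AA * (8 * euler AA) * (wp \<alpha> - eis2)
     + 4 * AA ^ 2 * (12 * euler (wp \<alpha>) - 12 * euler eis2) - 6 * ?t * (8 * euler AA)"
    by algebra
  also have "\<dots> = 8 * AA * (2 * AA * euler R_norm) * AA ^ 2"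
  proof -
    have "8 * AA * (2 * AA * euler R_norm) * AA ^ 2 = 2 * AA ^ 6 * R_rate"
      using euler_R_norm by algebra
    then show ?thesis
      unfolding euler_wp[OF s1 sin_double_neq_0] euler_wp_d[OF s1 sin_double_neq_0]
        euler_eis2[OF s1 sin_double_neq_0] euler_log_deriv R_rate_def
      unfolding wp_eq_norm wp_d_eq_norm slope_eq_norm by algebra
  qed
  finally have "(8 * AA ^ 3) * (3 * euler T_norm) = (8 * AA ^ 3) * (2 * AA * euler R_norm)"
    by algebra
  then show ?thesis by (rule fps_cancel) (simp add: AA_neq_0)
qed

lemma deriv_T_norm: "3 * fps_deriv T_norm = 2 * AA * fps_deriv R_norm"
proof -
  have "fps_X * (3 * fps_deriv T_norm) = fps_X * (2 * AA * fps_deriv R_norm)"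
    using euler_T_norm by (simp add: euler_def algebra_simps)
  then show ?thesis by simp
qed

lemma theta_d_nonzero: "theta_d 1 \<alpha> $ 0 \<noteq> 0"
  using c1 by (simp only: theta_d_1_nth_0 mult_eq_0_iff) simp

lemma theta_quotients:
  "theta_d 0 \<alpha> * inverse (theta_d 1 \<alpha>) = inverse AA"
  "theta_d 2 \<alpha> * inverse (theta_d 1 \<alpha>) = - (heat_pot \<alpha> * inverse AA)"
  "theta_d 3 \<alpha> * inverse (theta_d 1 \<alpha>) = - (8 * euler AA * inverse AA + heat_pot \<alpha>)"
proof -
  have i: "inverse AA * theta_d 1 \<alpha> = theta_d 0 \<alpha>"
    using AA_inverse theta_d_1[OF s1] by algebra
  show "theta_d 0 \<alpha> * inverse (theta_d 1 \<alpha>) = inverse AA"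
    by (rule fps_eq_mult_inverse[OF i theta_d_nonzero])
  show "theta_d 2 \<alpha> * inverse (theta_d 1 \<alpha>) = - (heat_pot \<alpha> * inverse AA)"
  proof (rule fps_eq_mult_inverse[OF _ theta_d_nonzero])
    show "- (heat_pot \<alpha> * inverse AA) * theta_d 1 \<alpha> = theta_d 2 \<alpha>"
      unfolding theta_d_2[OF s1] i[symmetric] by (simp only: mult.assoc mult_minus_left)
  qed
  have "- (8 * euler AA * inverse AA + heat_pot \<alpha>) * theta_d 1 \<alpha> = theta_d 3 \<alpha>"
  proof -
    have "theta_d 3 \<alpha> = - (8 * euler AA * theta_d 0 \<alpha> + heat_pot \<alpha> * theta_d 1 \<alpha>)"
      using theta_d_3 s1 by blast
    moreover have "i * t1 = t0 \<Longrightarrow> t3 = - (8 * e * t0 + h * t1) \<Longrightarrow> - (8 * e * i + h) * t1 = t3"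
      for i t0 t1 t3 e h :: "real fps"
      by (drule sym, simp only:) (simp add: algebra_simps)
    ultimately show ?thesis using i by blast
  qed
  then show "theta_d 3 \<alpha> * inverse (theta_d 1 \<alpha>) = - (8 * euler AA * inverse AA + heat_pot \<alpha>)"
    by (rule fps_eq_mult_inverse[OF _ theta_d_nonzero])
qed

lemma T_ser_eq: "T_ser \<alpha> = fps_const (cos \<alpha> / (64 * sin \<alpha> ^ 3)) * T_norm"
proof -
  have "- (theta_d 0 \<alpha> * theta_d 3 \<alpha> * inverse (theta_d 1 \<alpha> ^ 2)) + theta_d 2 \<alpha> * inverse (theta_d 1 \<alpha>)
     = - ((theta_d 0 \<alpha> * inverse (theta_d 1 \<alpha>)) * (theta_d 3 \<alpha> * inverse (theta_d 1 \<alpha>)))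
       + theta_d 2 \<alpha> * inverse (theta_d 1 \<alpha>)"
    unfolding fps_inverse_power2 by algebra
  also have "\<dots> = T_norm"
    unfolding theta_quotients T_norm_def by algebra
  finally show ?thesis unfolding T_ser_def by simp
qed

lemma R_of_q_eq: "R_of_q \<alpha> = fps_const (cos \<alpha> ^ 2 / (96 * sin \<alpha> ^ 4)) * R_norm"
proof -
  have "(theta_d 0 \<alpha> ^ 2 * inverse (theta_d 1 \<alpha> ^ 2)) *
     (- (theta_d 3 \<alpha> * inverse (theta_d 1 \<alpha>)) + theta_d 3 0 * inverse (theta_d 1 0)) =
     (theta_d 0 \<alpha> * inverse (theta_d 1 \<alpha>)) ^ 2 *
     (- (theta_d 3 \<alpha> * inverse (theta_d 1 \<alpha>)) + theta_d 3 0 * inverse (theta_d 1 0))"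
    unfolding fps_inverse_power2 by algebra
  also have "\<dots> = inverse AA ^ 2 * (8 * euler AA * inverse AA + heat_pot \<alpha> + 3 * eis2)"
    unfolding theta_quotients theta_d_3_quotient_0 eis2_eq by algebra
  also have "\<dots> = R_norm"
    unfolding R_norm_def wp_d_norm_def wp_norm_def wp_d_def wp_def using AA_inverse by algebra
  finally show ?thesis unfolding R_of_q_def mult.assoc by simp
qed

end

section \<open>Degree filtrations, linear growth, and the existence of a linear relation\<close>

subsection \<open>Filtrations on algebras of power series\<close>

interpretation fps_vs: vector_space "\<lambda>(c :: real) (F :: real fps). fps_const c * F"
proof
  fix a b :: real and x y :: "real fps"
  show "fps_const a * (x + y) = fps_const a * x + fps_const a * y"
    by (rule distrib_left)
  show "fps_const (a + b) * x = fps_const a * x + fps_const b * x"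
    by (simp only: fps_const_add[symmetric] distrib_right)
  show "fps_const a * (fps_const b * x) = fps_const (a * b) * x"
    by (simp only: fps_const_mult[symmetric] mult.assoc)
  show "fps_const 1 * x = x"
    by simp
qed

fun monoms :: "real fps set \<Rightarrow> nat \<Rightarrow> real fps set" where
  "monoms G 0 = {1}"
| "monoms G (Suc W) = monoms G W \<union> {g * m | g m. g \<in> G \<and> m \<in> monoms G W}"

definition fil :: "real fps set \<Rightarrow> nat \<Rightarrow> real fps set" where
  "fil G W = fps_vs.span (monoms G W)"

lemma monoms_mono: "W \<le> W' \<Longrightarrow> monoms G W \<subseteq> monoms G W'"
  by (induction rule: dec_induct) auto

lemma fil_mono: "W \<le> W' \<Longrightarrow> f \<in> fil G W \<Longrightarrow> f \<in> fil G W'"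
  unfolding fil_def using fps_vs.span_mono[OF monoms_mono] by blast

lemma fil_add: "f \<in> fil G W \<Longrightarrow> g \<in> fil G W \<Longrightarrow> f + g \<in> fil G W"
  and fil_diff: "f \<in> fil G W \<Longrightarrow> g \<in> fil G W \<Longrightarrow> f - g \<in> fil G W"
  and fil_scale: "f \<in> fil G W \<Longrightarrow> fps_const c * f \<in> fil G W"
  and fil_zero: "0 \<in> fil G W"
  unfolding fil_def by (auto intro: fps_vs.span_add fps_vs.span_diff fps_vs.span_scale fps_vs.span_zero)

lemma monoms_one: "1 \<in> monoms G W"
  by (induction W) auto

lemma fil_const: "fps_const c \<in> fil G W"
  using fil_scale[of 1 G W c] monoms_one[of G W] by (simp add: fil_def fps_vs.span_base)

lemma fil_gen: "g \<in> G \<Longrightarrow> g \<in> fil G 1"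
  by (auto simp: fil_def intro!: fps_vs.span_base)

lemma span_induct_fps [consumes 1, case_names zero step]:
  assumes "f \<in> fps_vs.span S" "P 0"
    "\<And>c x y. x \<in> S \<Longrightarrow> P y \<Longrightarrow> P (fps_const c * x + y)"
  shows "P f"
  using assms(1) by (rule fps_vs.span_induct_alt) (rule assms(2), rule assms(3))

lemma monoms_mult: "m \<in> monoms G a \<Longrightarrow> n \<in> monoms G b \<Longrightarrow> m * n \<in> monoms G (a + b)"
proof (induction a arbitrary: m)
  case (Suc a)
  then consider "m \<in> monoms G a" | g m' where "m = g * m'" "g \<in> G" "m' \<in> monoms G a" by auto
  then show ?case
    using Suc monoms_mono[of "a + b" "Suc a + b" G] by cases (auto simp: mult.assoc)
qed simp

lemma fil_mult:
  assumes "f \<in> fil G a" "g \<in> fil G b" shows "f * g \<in> fil G (a + b)"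
  using assms(1) unfolding fil_def
proof (induction rule: span_induct_fps)
  case (step c x y)
  from assms(2) have "x * g \<in> fil G (a + b)"
    unfolding fil_def
  proof (induction rule: span_induct_fps)
    case (step d m z)
    have "x * (fps_const d * m + z) = fps_const d * (x * m) + x * z"
      by (simp add: algebra_simps)
    with step monoms_mult[OF \<open>x \<in> monoms G a\<close> \<open>m \<in> monoms G b\<close>] show ?case
      by (simp add: fps_vs.span_add fps_vs.span_scale fps_vs.span_base)
  qed (simp add: fps_vs.span_zero)
  moreover have "(fps_const c * x + y) * g = fps_const c * (x * g) + y * g"
    by (simp add: algebra_simps)
  ultimately show ?case
    using step by (simp add: fil_def fps_vs.span_add fps_vs.span_scale)
qed (simp add: fps_vs.span_zero)

lemma fil_power: "f \<in> fil G a \<Longrightarrow> f ^ n \<in> fil G (a * n)"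
proof (induction n)
  case 0
  show ?case using fil_const[of 1 G 0] by simp
next
  case (Suc n)
  then show ?case using fil_mult[of f G a "f ^ n" "a * n"] by simp
qed

definition pol :: "real fps set \<Rightarrow> real fps set" where
  "pol G = (\<Union>W. fil G W)"

lemma pol_mult: "f \<in> pol G \<Longrightarrow> g \<in> pol G \<Longrightarrow> f * g \<in> pol G"
  unfolding pol_def using fil_mult by blast

lemma pol_common:
  assumes "f \<in> pol G" "g \<in> pol G"
  obtains W where "f \<in> fil G W" "g \<in> fil G W"
proof -
  obtain a b where ab: "f \<in> fil G a" "g \<in> fil G b"
    using assms unfolding pol_def by blast
  show thesis
    by (rule that[of "max a b"]) (rule fil_mono[OF _ ab(1)], simp, rule fil_mono[OF _ ab(2)], simp)
qed

lemma pol_add: "f \<in> pol G \<Longrightarrow> g \<in> pol G \<Longrightarrow> f + g \<in> pol G"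
  by (erule (1) pol_common) (auto simp: pol_def dest: fil_add)

lemma pol_diff: "f \<in> pol G \<Longrightarrow> g \<in> pol G \<Longrightarrow> f - g \<in> pol G"
  by (erule (1) pol_common) (auto simp: pol_def dest: fil_diff)

lemma pol_const: "fps_const c \<in> pol G" and pol_gen: "g \<in> G \<Longrightarrow> g \<in> pol G"
  unfolding pol_def using fil_const[of c G 0] fil_gen[of g G] by blast+

lemma pol_one: "1 \<in> pol G"
  using pol_const[of 1 G] by simp

lemma pol_numeral: "numeral k \<in> pol G"
  unfolding numeral_fps_const by (rule pol_const)

lemma pol_power: "f \<in> pol G \<Longrightarrow> f ^ n \<in> pol G"
  by (induction n) (simp_all add: pol_one pol_mult)

lemma pol_uniform:
  assumes "finite S" "S \<subseteq> pol G" shows "\<exists>c. S \<subseteq> fil G c"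
  using assms
proof (induction rule: finite_induct)
  case (insert f S)
  then obtain c d where "S \<subseteq> fil G c" "f \<in> fil G d" unfolding pol_def by blast
  then have "insert f S \<subseteq> fil G (max c d)"
    using fil_mono[of c "max c d"] fil_mono[of d "max c d"] by auto
  then show ?case by blast
qed auto

text \<open>Leibniz's rule replaces one generator at a time, and the finitely many images have a
  common degree bound. The essential point is that c does not depend on W.\<close>

lemma fil_derivation:
  fixes \<delta> :: "real fps \<Rightarrow> real fps"
  assumes "finite G"
    and add: "\<And>f g. \<delta> (f + g) = \<delta> f + \<delta> g"
    and mult: "\<And>f g. \<delta> (f * g) = \<delta> f * g + f * \<delta> g"
    and const: "\<And>c. \<delta> (fps_const c) = 0"
    and gen: "\<And>g. g \<in> G \<Longrightarrow> \<delta> g \<in> pol G"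
  obtains c where "\<And>f W. f \<in> fil G W \<Longrightarrow> \<delta> f \<in> fil G (W + c)"
proof -
  have "\<delta> ` G \<subseteq> pol G" using gen by blast
  then obtain c where c: "\<delta> ` G \<subseteq> fil G c"
    using pol_uniform[of "\<delta> ` G" G] \<open>finite G\<close> by blast
  have m: "\<delta> m \<in> fil G (W + c)" if "m \<in> monoms G W" for m W
    using that
  proof (induction W arbitrary: m)
    case 0
    then show ?case using const[of 1] by (simp add: fil_zero)
  next
    case (Suc W)
    then consider "m \<in> monoms G W" | g n where "m = g * n" "g \<in> G" "n \<in> monoms G W" by auto
    then show ?case
    proof cases
      case 1
      with Suc.IH fil_mono[of "W + c" "Suc W + c"] show ?thesis by simp
    next
      case 2
      have n: "n \<in> fil G W" using 2 by (simp add: fil_def fps_vs.span_base)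
      have "\<delta> g * n \<in> fil G (c + W)" by (rule fil_mult) (use 2 c n in auto)
      then have "\<delta> g * n \<in> fil G (Suc W + c)" by (rule fil_mono[rotated]) simp
      moreover have "g * \<delta> n \<in> fil G (1 + (W + c))" by (intro fil_mult fil_gen Suc.IH 2)
      ultimately show ?thesis using 2 by (simp add: mult fil_add)
    qed
  qed
  have "\<delta> f \<in> fil G (W + c)" if "f \<in> fil G W" for f W
    using that unfolding fil_def
  proof (induction rule: span_induct_fps)
    case zero
    then show ?case using const[of 0] by (simp add: fps_vs.span_zero)
  next
    case (step d x y)
    then show ?case using m[of x W]
      by (simp add: add mult const fil_def fps_vs.span_add fps_vs.span_scale)
  qed
  then show thesis by (rule that)
qed

text \<open>One factor n is spent on each generator in a monomial, so the degree after clearing is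
  still linear in W.\<close>

lemma fil_clear_denominator:
  assumes "n \<in> fil H c" "\<And>g. g \<in> G \<Longrightarrow> n * g \<in> fil H c" "f \<in> fil G W"
  shows "n ^ W * f \<in> fil H (c * W)"
proof -
  have m: "n ^ W * m \<in> fil H (c * W)" if "m \<in> monoms G W" for m
    using that
  proof (induction W arbitrary: m)
    case 0
    then show ?case using fil_const[of 1 H 0] by simp
  next
    case (Suc W)
    then consider "m \<in> monoms G W" | g k where "m = g * k" "g \<in> G" "k \<in> monoms G W" by auto
    then show ?case
    proof cases
      case 1
      have "n * (n ^ W * m) \<in> fil H (c + c * W)" by (intro fil_mult assms Suc.IH 1)
      then show ?thesis by (simp add: mult.assoc)
    next
      case 2
      have "(n * g) * (n ^ W * k) \<in> fil H (c + c * W)" by (intro fil_mult assms Suc.IH 2)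
      then show ?thesis by (simp add: 2 mult_ac)
    qed
  qed
  show ?thesis
    using assms(3) unfolding fil_def[of G]
  proof (induction rule: span_induct_fps)
    case (step d x y)
    have "n ^ W * (fps_const d * x + y) = fps_const d * (n ^ W * x) + n ^ W * y"
      by (simp add: algebra_simps)
    with step m[of x] show ?case by (simp add: fil_add fil_scale)
  qed (simp add: fil_zero)
qed

subsection \<open>Two algebraically dependent generators\<close>

text \<open>The Hilbert function is at most linear, as for the coordinate ring of a curve.\<close>

definition growth_linear :: "real fps set \<Rightarrow> bool" where
  "growth_linear G \<longleftrightarrow> (\<exists>d. \<forall>W. \<exists>B. finite B \<and> card B \<le> d * (W + 1) \<and> fil G W \<subseteq> fps_vs.span B)"

text \<open>A pair consists of the values of one polynomial at the series (X, Y) and at the real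
  point (x, y). A pair (0, a) with a nonzero second entry thus certifies a non-trivial relation
  between X and Y, without a separate type of polynomials.\<close>

inductive_set two_gen :: "real fps \<Rightarrow> real fps \<Rightarrow> real \<Rightarrow> real \<Rightarrow> (real fps \<times> real) set"
  for X Y x y where
  const: "(fps_const c, c) \<in> two_gen X Y x y"
| gen1: "(X, x) \<in> two_gen X Y x y"
| gen2: "(Y, y) \<in> two_gen X Y x y"
| add: "(f, a) \<in> two_gen X Y x y \<Longrightarrow> (g, b) \<in> two_gen X Y x y \<Longrightarrow> (f + g, a + b) \<in> two_gen X Y x y"
| mult: "(f, a) \<in> two_gen X Y x y \<Longrightarrow> (g, b) \<in> two_gen X Y x y \<Longrightarrow> (f * g, a * b) \<in> two_gen X Y x y"

lemma two_gen_diff: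
  assumes "(f, a) \<in> two_gen X Y x y" "(g, b) \<in> two_gen X Y x y"
  shows "(f - g, a - b) \<in> two_gen X Y x y"
  using two_gen.add[OF assms(1) two_gen.mult[OF two_gen.const[of "- 1"] assms(2)]]
  by (simp flip: fps_const_neg)

lemma two_gen_pol:
  assumes "(f, a) \<in> two_gen X Y x y" shows "f \<in> pol {X, Y}"
  using assms by induction (auto intro: pol_const pol_gen pol_add pol_mult)

definition expansion :: "real fps \<Rightarrow> real fps \<Rightarrow> real \<Rightarrow> real \<Rightarrow> (nat \<times> nat) set \<Rightarrow> (nat \<times> nat \<Rightarrow> real) \<Rightarrow> real fps \<times> real" where
  "expansion X Y x y S c = ((\<Sum>s\<in>S. fps_const (c s) * (X ^ fst s * Y ^ snd s)), (\<Sum>s\<in>S. c s * (x ^ fst s * y ^ snd s)))"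

lemma expansion_enlarge:
  assumes "finite S'" "S \<subseteq> S'"
  shows "expansion X Y x y S c = expansion X Y x y S' (\<lambda>s. if s \<in> S then c s else 0)"
  unfolding expansion_def prod.inject
  by (intro conjI sum.mono_neutral_cong_left assms) auto

lemma two_gen_expansion:
  assumes "(f, a) \<in> two_gen X Y x y"
  shows "\<exists>S c. finite S \<and> (f, a) = expansion X Y x y S c"
  using assms
proof induction
  case (const c)
  show ?case by (intro exI[of _ "{(0, 0)}"] exI[of _ "\<lambda>_. c"]) (simp add: expansion_def)
next
  case gen1
  show ?case by (intro exI[of _ "{(1, 0)}"] exI[of _ "\<lambda>_. 1"]) (simp add: expansion_def)
next
  case gen2
  show ?case by (intro exI[of _ "{(0, 1)}"] exI[of _ "\<lambda>_. 1"]) (simp add: expansion_def)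
next
  case (add f a g b)
  then obtain S c S' c' where S: "finite S" "(f, a) = expansion X Y x y S c"
    "finite S'" "(g, b) = expansion X Y x y S' c'" by blast
  let ?U = "S \<union> S'"
  have U: "finite ?U" "S \<subseteq> ?U" "S' \<subseteq> ?U" using S by auto
  obtain d d' where "(f, a) = expansion X Y x y ?U d" "(g, b) = expansion X Y x y ?U d'"
    unfolding S(2,4) expansion_enlarge[OF U(1,2)] expansion_enlarge[OF U(1,3)] by blast
  then have "(f + g, a + b) = expansion X Y x y ?U (\<lambda>s. d s + d' s)"
    unfolding expansion_def
    by (simp only: prod.inject fps_const_add[symmetric] distrib_right sum.distrib simp_thms)
  with U(1) show ?case by blast
next
  case (mult f a g b)
  then obtain S c S' c' where S: "finite S" "(f, a) = expansion X Y x y S c"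
    "finite S'" "(g, b) = expansion X Y x y S' c'" by blast
  \<comment> \<open>\<open>?h\<close> adds exponents and \<open>?d\<close> collects the products of
    coefficients that land on the same monomial.\<close>
  let ?h = "\<lambda>p :: (nat \<times> nat) \<times> (nat \<times> nat). (fst (fst p) + fst (snd p), snd (fst p) + snd (snd p))"
  let ?P = "S \<times> S'"
  let ?d = "\<lambda>s. \<Sum>p\<in>{p \<in> ?P. ?h p = s}. c (fst p) * c' (snd p)"
  have f: "f = (\<Sum>s\<in>S. fps_const (c s) * (X ^ fst s * Y ^ snd s))"
    and g: "g = (\<Sum>s\<in>S'. fps_const (c' s) * (X ^ fst s * Y ^ snd s))"
    and a: "a = (\<Sum>s\<in>S. c s * (x ^ fst s * y ^ snd s))"
    and b: "b = (\<Sum>s\<in>S'. c' s * (x ^ fst s * y ^ snd s))"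
    using S unfolding expansion_def by simp_all
  have "(fps_const (c (fst p)) * (X ^ fst (fst p) * Y ^ snd (fst p))) *
      (fps_const (c' (snd p)) * (X ^ fst (snd p) * Y ^ snd (snd p))) =
      fps_const (c (fst p) * c' (snd p)) * (X ^ fst (?h p) * Y ^ snd (?h p))" for p
    by (simp only: fst_conv snd_conv power_add fps_const_mult[symmetric] mult_ac)
  then have "f * g = (\<Sum>p\<in>?P. fps_const (c (fst p) * c' (snd p)) * (X ^ fst (?h p) * Y ^ snd (?h p)))"
    unfolding f g sum_product sum.cartesian_product case_prod_unfold by (simp only:)
  also have "\<dots> = (\<Sum>s\<in>?h ` ?P. \<Sum>p\<in>{p \<in> ?P. ?h p = s}. fps_const (c (fst p) * c' (snd p)) * (X ^ fst (?h p) * Y ^ snd (?h p)))"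
    by (rule sum.image_gen) (use S in simp)
  also have "\<dots> = (\<Sum>s\<in>?h ` ?P. fps_const (?d s) * (X ^ fst s * Y ^ snd s))"
    unfolding fps_const_sum sum_distrib_right by (intro sum.cong refl) auto
  finally have 1: "f * g = (\<Sum>s\<in>?h ` ?P. fps_const (?d s) * (X ^ fst s * Y ^ snd s))" .
  have "(c (fst p) * (x ^ fst (fst p) * y ^ snd (fst p))) * (c' (snd p) * (x ^ fst (snd p) * y ^ snd (snd p))) =
      (c (fst p) * c' (snd p)) * (x ^ fst (?h p) * y ^ snd (?h p))" for p
    by (simp only: fst_conv snd_conv power_add mult_ac)
  then have "a * b = (\<Sum>p\<in>?P. (c (fst p) * c' (snd p)) * (x ^ fst (?h p) * y ^ snd (?h p)))"
    unfolding a b sum_product sum.cartesian_product case_prod_unfold by (simp only:)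
  also have "\<dots> = (\<Sum>s\<in>?h ` ?P. \<Sum>p\<in>{p \<in> ?P. ?h p = s}. (c (fst p) * c' (snd p)) * (x ^ fst (?h p) * y ^ snd (?h p)))"
    by (rule sum.image_gen) (use S in simp)
  also have "\<dots> = (\<Sum>s\<in>?h ` ?P. ?d s * (x ^ fst s * y ^ snd s))"
    unfolding sum_distrib_right by (intro sum.cong refl) auto
  finally have 2: "a * b = (\<Sum>s\<in>?h ` ?P. ?d s * (x ^ fst s * y ^ snd s))" .
  have "finite (?h ` ?P)" using S by simp
  moreover have "(f * g, a * b) = expansion X Y x y (?h ` ?P) ?d"
    unfolding expansion_def 1 2 ..
  ultimately show ?case by blast
qed

lemma monoms_two: "monoms {X, Y} W \<subseteq> {X ^ i * Y ^ j | i j. i + j \<le> W}"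
proof (induction W)
  case (Suc W)
  show ?case
  proof
    fix m assume "m \<in> monoms {X, Y} (Suc W)"
    then consider "m \<in> monoms {X, Y} W" | n where "m = X * n" "n \<in> monoms {X, Y} W"
      | n where "m = Y * n" "n \<in> monoms {X, Y} W" by auto
    then show "m \<in> {X ^ i * Y ^ j | i j. i + j \<le> Suc W}"
    proof cases
      case 1
      with Suc show ?thesis by fastforce
    next
      case 2
      with Suc obtain i j where "n = X ^ i * Y ^ j" "i + j \<le> W" by blast
      with 2 have "m = X ^ Suc i * Y ^ j" "Suc i + j \<le> Suc W" by (simp_all add: mult_ac)
      then show ?thesis by blast
    next
      case 3
      with Suc obtain i j where "n = X ^ i * Y ^ j" "i + j \<le> W" by blast
      with 3 have "m = X ^ i * Y ^ Suc j" "i + Suc j \<le> Suc W" by (simp_all add: mult_ac)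
      then show ?thesis by blast
    qed
  qed
qed auto

text \<open>A relation rewrites its leading monomial (in the graded lexicographic order) into smaller
  monomials, so the monomials not divisible by it suffice.\<close>

lemma growth_linear_two:
  assumes "(0, a) \<in> two_gen X Y x y" "a \<noteq> 0"
  shows "growth_linear {X, Y}"
proof -
  obtain S c where S: "finite S" "(0, a) = expansion X Y x y S c"
    using two_gen_expansion[OF assms(1)] by blast
  define S' where "S' = {s \<in> S. c s \<noteq> 0}"
  have "finite S'" using S by (simp add: S'_def)
  \<comment> \<open>The nonzero value at (x, y) is what excludes the zero polynomial.\<close>
  have "S' \<noteq> {}"
  proof
    assume "S' = {}"
    then have "(\<Sum>s\<in>S. c s * (x ^ fst s * y ^ snd s)) = 0"
      by (intro sum.neutral) (auto simp: S'_def)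
    with S assms(2) show False by (simp add: expansion_def)
  qed
  define D where "D = Max ((\<lambda>s. fst s + snd s) ` S')"
  define p where "p = Max (fst ` {s \<in> S'. fst s + snd s = D})"
  have D: "fst s + snd s \<le> D" if "s \<in> S'" for s
    using that \<open>finite S'\<close> unfolding D_def by (intro Max_ge) auto
  have "D \<in> (\<lambda>s. fst s + snd s) ` S'"
    using \<open>finite S'\<close> \<open>S' \<noteq> {}\<close> unfolding D_def by (intro Max_in) auto
  then obtain s0 where "s0 \<in> {s \<in> S'. fst s + snd s = D}" by blast
  then have "fst ` {s \<in> S'. fst s + snd s = D} \<noteq> {}" by blast
  then have "p \<in> fst ` {s \<in> S'. fst s + snd s = D}"
    using \<open>finite S'\<close> unfolding p_def by (intro Max_in) simp_all
  then obtain q where pq: "(p, q) \<in> S'" "p + q = D" by auto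
  have p: "fst s \<le> p" if "s \<in> S'" "fst s + snd s = D" for s
    using that \<open>finite S'\<close> unfolding p_def by (intro Max_ge) auto
  let ?m = "\<lambda>i j. X ^ i * Y ^ j"
  have "0 = (\<Sum>s\<in>S. fps_const (c s) * ?m (fst s) (snd s))"
    using S by (simp add: expansion_def)
  also have "\<dots> = (\<Sum>s\<in>S'. fps_const (c s) * ?m (fst s) (snd s))"
    using S by (intro sum.mono_neutral_right) (auto simp: S'_def)
  also have "\<dots> = fps_const (c (p, q)) * ?m p q + (\<Sum>s\<in>S' - {(p, q)}. fps_const (c s) * ?m (fst s) (snd s))"
    using pq \<open>finite S'\<close> by (subst sum.remove[of _ "(p, q)"]) auto
  finally have "fps_const (c (p, q)) * ?m p q = - (\<Sum>s\<in>S' - {(p, q)}. fps_const (c s) * ?m (fst s) (snd s))"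
    by (simp add: eq_neg_iff_add_eq_0)
  then have "fps_const (- 1 / c (p, q)) * (fps_const (c (p, q)) * ?m p q) =
      fps_const (- 1 / c (p, q)) * (- (\<Sum>s\<in>S' - {(p, q)}. fps_const (c s) * ?m (fst s) (snd s)))"
    by simp
  then have lead: "?m p q = (\<Sum>s\<in>S' - {(p, q)}. fps_const (- c s / c (p, q)) * ?m (fst s) (snd s))"
    using pq(1) by (simp add: S'_def sum_distrib_left mult.assoc[symmetric] flip: fps_const_neg)
  define B where "B W = {?m i j | i j. i + j \<le> W \<and> (i < p \<or> j < q)}" for W
  have red: "?m i j \<in> fps_vs.span (B W)" if "i + j \<le> W" for i j W
    using that
  \<comment> \<open>The measure encodes the graded lexicographic order in one number: i is at most
    W, so a drop in total degree outweighs any change of i.\<close>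
  proof (induction "(i + j) * (W + 1) + i" arbitrary: i j rule: less_induct)
    case less
    show ?case
    proof (cases "i < p \<or> j < q")
      case True
      with less.prems show ?thesis by (auto simp: B_def intro!: fps_vs.span_base)
    next
      case False
      define i' j' where "i' = i - p" and "j' = j - q"
      have ij: "i = i' + p" "j = j' + q" using False by (simp_all add: i'_def j'_def)
      have "?m i j = ?m i' j' * ?m p q"
        by (simp add: ij power_add mult_ac)
      also have "\<dots> = (\<Sum>s\<in>S' - {(p, q)}. fps_const (- c s / c (p, q)) * ?m (i' + fst s) (j' + snd s))"
        unfolding lead sum_distrib_left by (simp add: power_add mult_ac)
      also have "\<dots> \<in> fps_vs.span (B W)"
      proof (intro fps_vs.span_sum fps_vs.span_scale less.hyps)
        fix s assume s: "s \<in> S' - {(p, q)}"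
        show W: "i' + fst s + (j' + snd s) \<le> W"
          using D[of s] s less.prems pq(2) by (simp add: ij)
        show "(i' + fst s + (j' + snd s)) * (W + 1) + (i' + fst s) < (i + j) * (W + 1) + i"
        proof (cases "fst s + snd s = D")
          case True
          with s p[of s] have "fst s \<le> p" by simp
          moreover have "fst s \<noteq> p" using s True pq(2) by (cases s) auto
          ultimately have "fst s < p" by simp
          have e: "i' + fst s + (j' + snd s) = i + j" using True pq(2) by (simp add: ij)
          show ?thesis unfolding e using \<open>fst s < p\<close> by (simp add: ij(1))
        next
          case False
          with D[of s] s have "fst s + snd s < D" by simp
          then have "i' + fst s + (j' + snd s) + 1 \<le> i + j" using pq(2) by (simp add: ij)
          then have "(i' + fst s + (j' + snd s) + 1) * (W + 1) \<le> (i + j) * (W + 1)"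
            by (rule mult_le_mono1)
          moreover have "i' + fst s < W + 1" using W by simp
          ultimately show ?thesis by simp
        qed
      qed
      finally show ?thesis .
    qed
  qed
  have "fil {X, Y} W \<subseteq> fps_vs.span (B W)" for W
    unfolding fil_def
  proof (rule fps_vs.span_minimal)
    show "monoms {X, Y} W \<subseteq> fps_vs.span (B W)"
      using monoms_two[of X Y W] red by blast
  qed (rule fps_vs.subspace_span)
  moreover have "finite (B W) \<and> card (B W) \<le> (p + q) * (W + 1)" for W
  proof -
    let ?U = "{..<p} \<times> {..W} \<union> {..W} \<times> {..<q}"
    have sub: "B W \<subseteq> (\<lambda>(i, j). ?m i j) ` ?U"
      by (fastforce simp: B_def)
    have "card (B W) \<le> card ((\<lambda>(i, j). ?m i j) ` ?U)"
      by (rule card_mono[OF _ sub]) simp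
    also have "\<dots> \<le> card ?U" by (rule card_image_le) simp
    also have "\<dots> \<le> card ({..<p} \<times> {..W}) + card ({..W} \<times> {..<q})" by (rule card_Un_le)
    also have "\<dots> = (p + q) * (W + 1)" by (simp add: algebra_simps)
    finally show ?thesis using finite_subset[OF sub] by simp
  qed
  ultimately show ?thesis unfolding growth_linear_def by blast
qed

text \<open>The vectors form an indexed family, so coincidences must be handled apart: two equal
  members already give a relation.\<close>

lemma linear_relation:
  fixes v :: "'i \<Rightarrow> real fps"
  assumes "finite I" "finite B" "card B < card I" "\<And>i. i \<in> I \<Longrightarrow> v i \<in> fps_vs.span B"
  shows "\<exists>c. (\<exists>i\<in>I. c i \<noteq> 0) \<and> (\<Sum>i\<in>I. fps_const (c i) * v i) = 0"
proof (cases "inj_on v I")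
  case True
  have "fps_vs.dependent (v ` I)"
  proof (rule ccontr)
    assume "fps_vs.independent (v ` I)"
    moreover have "v ` I \<subseteq> fps_vs.span B" using assms(4) by blast
    ultimately have "card (v ` I) \<le> card B"
      using fps_vs.independent_span_bound[OF assms(2)] by blast
    with assms(3) True show False by (simp add: card_image)
  qed
  then obtain u where u: "\<exists>x\<in>v ` I. u x \<noteq> 0" "(\<Sum>x\<in>v ` I. fps_const (u x) * x) = 0"
    using fps_vs.dependent_finite[of "v ` I"] assms(1) by auto
  show ?thesis
  proof (intro exI[of _ "\<lambda>i. u (v i)"] conjI)
    show "(\<Sum>i\<in>I. fps_const (u (v i)) * v i) = 0"
      using u(2) by (simp add: sum.reindex[OF True])
  qed (use u(1) in blast)
next
  case False
  then obtain i j where ij: "i \<in> I" "j \<in> I" "i \<noteq> j" "v i = v j" by (auto simp: inj_on_def)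
  let ?c = "\<lambda>k. if k = i then 1 else if k = j then - 1 else (0 :: real)"
  have "(\<Sum>k\<in>I. fps_const (?c k) * v k) = (\<Sum>k\<in>{i, j}. fps_const (?c k) * v k)"
    by (rule sum.mono_neutral_right) (use ij assms(1) in auto)
  also have "\<dots> = 0" using ij by (simp flip: fps_const_neg)
  finally show ?thesis using ij(1) by (intro exI[of _ ?c]) auto
qed

subsection \<open>D-finiteness by counting dimensions\<close>

text \<open>With \<open>D F = F' / R'\<close>, the products \<open>R\<^sup>j D\<^sup>i T\<close> (\<open>i, j \<le> k\<close>) lie, up to
  a common denominator, in a space of dimension \<open>O(k)\<close>, while there are \<open>(k + 1)\<^sup>2\<close> of them.\<close>

lemma counting:
  fixes A T R \<rho> n :: "real fps" and D :: "real fps \<Rightarrow> real fps"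
  assumes "finite G"
    and D_add: "\<And>f g. D (f + g) = D f + D g"
    and D_mult: "\<And>f g. D (f * g) = D f * g + f * D g"
    and D_const: "\<And>c. D (fps_const c) = 0"
    and D_gen: "\<And>g. g \<in> G \<Longrightarrow> \<rho> * D g \<in> pol G"
    and D_T: "D T = fps_const a * A" and D_A: "\<rho> * D A = fps_const b * T"
    and \<rho>: "\<rho> \<in> pol G" "\<rho> \<noteq> 0" and R: "R \<in> pol G"
    and H: "growth_linear H" and n: "n \<noteq> 0" "n \<in> pol H" "\<And>g. g \<in> G \<Longrightarrow> n * g \<in> pol H"
  shows "\<exists>k (c :: nat \<Rightarrow> nat \<Rightarrow> real). (\<exists>i\<le>k. \<exists>j\<le>k. c i j \<noteq> 0) \<and>
    (\<Sum>i\<le>k. \<Sum>j\<le>k. fps_const (c i j) * (R ^ j * (D ^^ i) T)) = 0"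
proof -
  define \<delta> where "\<delta> f = \<rho> * D f" for f
  have \<delta>: "\<delta> (f + g) = \<delta> f + \<delta> g" "\<delta> (f * g) = \<delta> f * g + f * \<delta> g" "\<delta> (fps_const c) = 0" for f g c
    by (simp_all add: \<delta>_def D_add D_mult D_const algebra_simps)
  obtain c1 where c1: "\<And>f W. f \<in> fil G W \<Longrightarrow> \<delta> f \<in> fil G (W + c1)"
    using fil_derivation[of G \<delta>] assms(1) \<delta> D_gen by (metis \<delta>_def)
  obtain c2 where c2: "\<rho> \<in> fil G c2" "R \<in> fil G c2"
    using pol_uniform[of "{\<rho>, R}" G] \<rho> R by auto
  obtain c3 where c3: "n \<in> fil H c3" "\<And>g. g \<in> G \<Longrightarrow> n * g \<in> fil H c3"
  proof -
    have "insert n ((*) n ` G) \<subseteq> pol H" using n by blast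
    then obtain c where "insert n ((*) n ` G) \<subseteq> fil H c"
      using pol_uniform[of "insert n ((*) n ` G)" H] assms(1) by blast
    then show thesis by (intro that[of c]) auto
  qed
  define K where "K = c1 + 2 * c2"
  \<comment> \<open>The derivatives of T stay in the module generated by T and A, because \<rho> D
    maps both into it. Neither T nor A has to lie in the ring generated by \<open>G\<close>.\<close>
  define M where "M W = {f * T + g * A | f g. f \<in> fil G W \<and> g \<in> fil G W}" for W
  have M_mono: "u \<in> M W'" if "u \<in> M W" "W \<le> W'" for u W W'
    using that fil_mono unfolding M_def by blast
  have M_mult: "h * u \<in> M (V + W)" if h: "h \<in> fil G V" and u: "u \<in> M W" for h u V W
  proof -
    obtain f g where "u = f * T + g * A" "f \<in> fil G W" "g \<in> fil G W" using u unfolding M_def by blast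
    moreover from this have "h * u = (h * f) * T + (h * g) * A" by (simp add: algebra_simps)
    ultimately show ?thesis using fil_mult[OF h] unfolding M_def by blast
  qed
  have M_diff: "u - w \<in> M W" if uw: "u \<in> M W" "w \<in> M W" for u w W
  proof -
    obtain f g f' g' where "u = f * T + g * A" "w = f' * T + g' * A"
      "f \<in> fil G W" "g \<in> fil G W" "f' \<in> fil G W" "g' \<in> fil G W" using uw unfolding M_def by blast
    moreover from this have "u - w = (f - f') * T + (g - g') * A" by (simp add: algebra_simps)
    ultimately show ?thesis using fil_diff unfolding M_def by blast
  qed
  have M_\<delta>: "\<delta> u \<in> M (W + c1 + c2)" if u: "u \<in> M W" for u W
  proof -
    obtain f g where fg: "u = f * T + g * A" "f \<in> fil G W" "g \<in> fil G W" using u unfolding M_def by blast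
    have "\<delta> u = (\<delta> f + fps_const b * g) * T + (\<delta> g + fps_const a * (\<rho> * f)) * A"
    proof -
      have "\<delta> T = \<rho> * (fps_const a * A)" "\<delta> A = fps_const b * T" by (simp_all add: \<delta>_def D_T D_A)
      then show ?thesis by (simp add: fg(1) \<delta> algebra_simps)
    qed
    moreover have "\<delta> f + fps_const b * g \<in> fil G (W + c1 + c2)"
      by (intro fil_add fil_scale fil_mono[OF _ c1[OF fg(2)]] fil_mono[OF _ fg(3)]) auto
    moreover have "\<delta> g + fps_const a * (\<rho> * f) \<in> fil G (W + c1 + c2)"
      by (intro fil_add fil_scale fil_mono[OF _ c1[OF fg(3)]] fil_mono[OF _ fil_mult[OF c2(1) fg(2)]]) auto
    ultimately show ?thesis unfolding M_def by blast
  qed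
  \<comment> \<open>Each differentiation costs two factors \<rho>: one turns D into
    \<open>\<delta>\<close>, the other clears the denominator created by differentiating the power
    of \<rho>.\<close>
  have iter: "\<rho> ^ (2 * i) * (D ^^ i) T \<in> M (K * i)" for i
  proof (induction i)
    case 0
    have "T = 1 * T + 0 * A" by simp
    moreover have "1 \<in> fil G 0" using fil_const[of 1 G 0] by simp
    ultimately have "T \<in> M 0" using fil_zero[of G 0] unfolding M_def by blast
    then show ?case by simp
  next
    case (Suc i)
    let ?f = "(D ^^ i) T" and ?u = "\<rho> ^ (2 * i) * (D ^^ i) T"
    have pw: "\<rho> * \<delta> (\<rho> ^ m) = of_nat m * (\<rho> ^ m * \<delta> \<rho>)" for m
    proof (induction m)
      case 0
      show ?case using \<delta>(3)[of 1] by simp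
    next
      case (Suc m)
      have "\<rho> * \<delta> (\<rho> ^ Suc m) = \<rho> * \<delta> \<rho> * \<rho> ^ m + \<rho> * (\<rho> * \<delta> (\<rho> ^ m))"
        by (simp add: \<delta> algebra_simps)
      then show ?case unfolding Suc by (simp add: algebra_simps)
    qed
    have "\<rho> * \<delta> ?u = \<rho> * \<delta> (\<rho> ^ (2 * i)) * ?f + \<rho> * \<rho> ^ (2 * i) * \<delta> ?f"
      by (simp add: \<delta> algebra_simps)
    then have "\<rho> ^ (2 * Suc i) * (D ^^ Suc i) T = \<rho> * \<delta> ?u - fps_const (of_nat (2 * i)) * (\<delta> \<rho> * ?u)"
      unfolding pw fps_of_nat by (simp add: \<delta>_def algebra_simps)
    moreover have "\<rho> * \<delta> ?u \<in> M (K * Suc i)"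
      by (rule M_mono[OF M_mult[OF c2(1) M_\<delta>[OF Suc]]]) (simp add: K_def)
    moreover have "fps_const (of_nat (2 * i)) * (\<delta> \<rho> * ?u) \<in> M (K * Suc i)"
      by (rule M_mono[OF M_mult[OF fil_const M_mult[OF c1[OF c2(1)] Suc], of _ 0]]) (simp add: K_def)
    ultimately show ?case using M_diff by simp
  qed
  obtain d where d: "\<And>W. \<exists>B. finite B \<and> card B \<le> d * (W + 1) \<and> fil H W \<subseteq> fps_vs.span B"
    using H unfolding growth_linear_def by blast
  define L where "L = K + 3 * c2"
  \<comment> \<open>With W = L k the spanning set has at most 2 d (c3 L k + 1) elements. The choice
    of k makes this at most k (k + 1), hence less than (k + 1)^2.\<close>
  define k where "k = 2 * d * (c3 * L + 1)"
  define W where "W = L * k"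
  have elem: "\<rho> ^ (2 * k) * (R ^ j * (D ^^ i) T) \<in> M W" if "i \<le> k" "j \<le> k" for i j
  proof -
    have "\<rho> ^ (2 * k) = \<rho> ^ (2 * (k - i)) * \<rho> ^ (2 * i)"
      using that by (simp flip: power_add add: algebra_simps)
    then have eq: "\<rho> ^ (2 * k) * (R ^ j * (D ^^ i) T) = \<rho> ^ (2 * (k - i)) * (R ^ j * (\<rho> ^ (2 * i) * (D ^^ i) T))"
      by (simp add: mult_ac)
    have "c2 * (2 * (k - i)) + (c2 * j + K * i) \<le> c2 * (2 * k) + (c2 * k + K * k)"
      by (intro add_mono mult_le_mono2) (use that in auto)
    also have "\<dots> = W" by (simp add: W_def L_def algebra_simps)
    finally show ?thesis unfolding eq
      by (rule M_mono[OF M_mult[OF fil_power[OF c2(1)] M_mult[OF fil_power[OF c2(2)] iter]]])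
  qed
  obtain B where B: "finite B" "card B \<le> d * (c3 * W + 1)" "fil H (c3 * W) \<subseteq> fps_vs.span B"
    using d by blast
  let ?B = "(\<lambda>f. f * T) ` B \<union> (\<lambda>f. f * A) ` B"
  have span_mult: "f * z \<in> fps_vs.span ((\<lambda>f. f * z) ` B)" if "f \<in> fps_vs.span B" for f z
    using that
  proof (induction rule: span_induct_fps)
    case (step r x y)
    have "(fps_const r * x + y) * z = fps_const r * (x * z) + y * z" by (simp add: algebra_simps)
    moreover have "x * z \<in> fps_vs.span ((\<lambda>f. f * z) ` B)"
      using step(1) by (intro fps_vs.span_base) blast
    ultimately show ?case using step(2) fps_vs.span_add fps_vs.span_scale by metis
  qed (simp add: fps_vs.span_zero)
  have inB: "n ^ W * u \<in> fps_vs.span ?B" if u: "u \<in> M W" for u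
  proof -
    obtain f g where fg: "u = f * T + g * A" "f \<in> fil G W" "g \<in> fil G W" using u unfolding M_def by blast
    have "n ^ W * f \<in> fps_vs.span B" "n ^ W * g \<in> fps_vs.span B"
      using fil_clear_denominator[OF c3 fg(2)] fil_clear_denominator[OF c3 fg(3)] B(3) by auto
    then have "(n ^ W * f) * T \<in> fps_vs.span ?B" "(n ^ W * g) * A \<in> fps_vs.span ?B"
      using fps_vs.span_mono[of "(\<lambda>f. f * T) ` B" ?B] fps_vs.span_mono[of "(\<lambda>f. f * A) ` B" ?B]
        span_mult[of "n ^ W * f" T] span_mult[of "n ^ W * g" A] by auto
    then have "(n ^ W * f) * T + (n ^ W * g) * A \<in> fps_vs.span ?B"
      by (rule fps_vs.span_add)
    then show ?thesis
      by (simp add: fg(1) distrib_left mult.assoc)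
  qed
  let ?I = "{..k} \<times> {..k}"
  let ?v = "\<lambda>p. n ^ W * (\<rho> ^ (2 * k) * (R ^ snd p * (D ^^ fst p) T))"
  have "card ?B \<le> 2 * card B"
    using card_Un_le[of "(\<lambda>f. f * T) ` B" "(\<lambda>f. f * A) ` B"] card_image_le[OF B(1), of "\<lambda>f. f * T"]
      card_image_le[OF B(1), of "\<lambda>f. f * A"] by linarith
  also have "\<dots> \<le> 2 * (d * (c3 * W + 1))" using B(2) by simp
  also have "\<dots> \<le> k * (k + 1)"
  proof -
    have "c3 * W + 1 \<le> (c3 * L + 1) * (k + 1)" by (simp add: W_def algebra_simps)
    then have "2 * d * (c3 * W + 1) \<le> 2 * d * ((c3 * L + 1) * (k + 1))" by (rule mult_le_mono2)
    then show ?thesis by (simp add: k_def algebra_simps)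
  qed
  also have "\<dots> < card ?I" by simp
  finally have "card ?B < card ?I" .
  moreover have "?v p \<in> fps_vs.span ?B" if "p \<in> ?I" for p
    using inB elem that by auto
  moreover have "finite ?I" "finite ?B" using B(1) by simp_all
  ultimately obtain c where c: "\<exists>p\<in>?I. c p \<noteq> 0" "(\<Sum>p\<in>?I. fps_const (c p) * ?v p) = 0"
    using linear_relation[of ?I ?B ?v] by blast
  have "(\<Sum>p\<in>?I. fps_const (c p) * ?v p) =
      (n ^ W * \<rho> ^ (2 * k)) * (\<Sum>p\<in>?I. fps_const (c p) * (R ^ snd p * (D ^^ fst p) T))"
    by (simp add: sum_distrib_left mult_ac)
  with c(2) n(1) \<rho>(2) have "(\<Sum>p\<in>?I. fps_const (c p) * (R ^ snd p * (D ^^ fst p) T)) = 0"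
    by simp
  then have "(\<Sum>i\<le>k. \<Sum>j\<le>k. fps_const (c (i, j)) * (R ^ j * (D ^^ i) T)) = 0"
    by (simp add: sum.cartesian_product case_prod_unfold)
  moreover have "\<exists>i\<le>k. \<exists>j\<le>k. c (i, j) \<noteq> 0" using c(1) by auto
  ultimately show ?thesis by (intro exI[of _ k] exI[of _ "\<lambda>i j. c (i, j)"]) simp
qed


subsection \<open>Rational functions of two generators\<close>

text \<open>Fractions of such pairs. The denominator must be nonzero both as a series and at the
  point, so that a vanishing fraction with nonzero value still has a numerator certifying a
  relation.\<close>

definition ratio_gen :: "real fps \<Rightarrow> real fps \<Rightarrow> real \<Rightarrow> real \<Rightarrow> (real fps \<times> real) set" where
  "ratio_gen X Y x y = {(f, a). \<exists>g b h c. (g, b) \<in> two_gen X Y x y \<and> (h, c) \<in> two_gen X Y x y \<and>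
    h \<noteq> 0 \<and> c \<noteq> 0 \<and> f * h = g \<and> a * c = b}"

lemma ratio_genI:
  "(g, b) \<in> two_gen X Y x y \<Longrightarrow> (h, c) \<in> two_gen X Y x y \<Longrightarrow> h \<noteq> 0 \<Longrightarrow> c \<noteq> 0 \<Longrightarrow>
    f * h = g \<Longrightarrow> a * c = b \<Longrightarrow> (f, a) \<in> ratio_gen X Y x y"
  unfolding ratio_gen_def by blast

lemma ratio_genE:
  assumes "(f, a) \<in> ratio_gen X Y x y"
  obtains g b h c where "(g, b) \<in> two_gen X Y x y" "(h, c) \<in> two_gen X Y x y"
    "h \<noteq> 0" "c \<noteq> 0" "f * h = g" "a * c = b"
  using assms unfolding ratio_gen_def by blast

lemma two_gen_one: "(1, 1) \<in> two_gen X Y x y"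
  using two_gen.const[of 1 X Y x y] by simp

lemma ratio_gen_base: "(f, a) \<in> two_gen X Y x y \<Longrightarrow> (f, a) \<in> ratio_gen X Y x y"
  by (rule ratio_genI[OF _ two_gen_one]) auto

lemma ratio_gen_diff:
  assumes "(f, a) \<in> ratio_gen X Y x y" "(f', a') \<in> ratio_gen X Y x y"
  shows "(f - f', a - a') \<in> ratio_gen X Y x y"
proof -
  obtain g b h c where 1: "(g, b) \<in> two_gen X Y x y" "(h, c) \<in> two_gen X Y x y"
    "h \<noteq> 0" "c \<noteq> 0" "f * h = g" "a * c = b" using assms(1) by (rule ratio_genE)
  obtain g' b' h' c' where 2: "(g', b') \<in> two_gen X Y x y" "(h', c') \<in> two_gen X Y x y"
    "h' \<noteq> 0" "c' \<noteq> 0" "f' * h' = g'" "a' * c' = b'" using assms(2) by (rule ratio_genE)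
  have "(g * h' - g' * h, b * c' - b' * c) \<in> two_gen X Y x y" "(h * h', c * c') \<in> two_gen X Y x y"
    using 1 2 by (auto intro: two_gen.mult two_gen_diff)
  moreover have "(f - f') * (h * h') = g * h' - g' * h" "(a - a') * (c * c') = b * c' - b' * c"
    using 1(5,6) 2(5,6) by (auto simp: algebra_simps)
  ultimately show ?thesis using 1(3,4) 2(3,4) by (auto intro: ratio_genI)
qed

lemma ratio_gen_mult:
  assumes "(f, a) \<in> ratio_gen X Y x y" "(f', a') \<in> ratio_gen X Y x y"
  shows "(f * f', a * a') \<in> ratio_gen X Y x y"
proof -
  obtain g b h c where 1: "(g, b) \<in> two_gen X Y x y" "(h, c) \<in> two_gen X Y x y"
    "h \<noteq> 0" "c \<noteq> 0" "f * h = g" "a * c = b" using assms(1) by (rule ratio_genE)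
  obtain g' b' h' c' where 2: "(g', b') \<in> two_gen X Y x y" "(h', c') \<in> two_gen X Y x y"
    "h' \<noteq> 0" "c' \<noteq> 0" "f' * h' = g'" "a' * c' = b'" using assms(2) by (rule ratio_genE)
  have "(g * g', b * b') \<in> two_gen X Y x y" "(h * h', c * c') \<in> two_gen X Y x y"
    using 1 2 by (auto intro: two_gen.mult)
  moreover have "(f * f') * (h * h') = g * g'" "(a * a') * (c * c') = b * b'"
    using 1(5,6) 2(5,6) by (auto simp: algebra_simps)
  ultimately show ?thesis using 1(3,4) 2(3,4) by (auto intro: ratio_genI)
qed

lemma ratio_gen_const: "(fps_const c, c) \<in> ratio_gen X Y x y"
  by (intro ratio_gen_base two_gen.const)

lemma ratio_gen_add:
  assumes "(f, a) \<in> ratio_gen X Y x y" "(f', a') \<in> ratio_gen X Y x y"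
  shows "(f + f', a + a') \<in> ratio_gen X Y x y"
proof -
  have "(fps_const 0 - f', 0 - a') \<in> ratio_gen X Y x y"
    by (intro ratio_gen_diff ratio_gen_const assms)
  from ratio_gen_diff[OF assms(1) this] show ?thesis by simp
qed

lemma ratio_gen_inverse:
  assumes "(f, a) \<in> ratio_gen X Y x y" "f' * f = 1" "a \<noteq> 0"
  shows "(f', 1 / a) \<in> ratio_gen X Y x y"
proof -
  obtain g b h c where 1: "(g, b) \<in> two_gen X Y x y" "(h, c) \<in> two_gen X Y x y"
    "h \<noteq> 0" "c \<noteq> 0" "f * h = g" "a * c = b" using assms(1) by (rule ratio_genE)
  have "f' * g = h" using assms(2) by (simp add: 1(5)[symmetric] mult.assoc[symmetric])
  moreover have "1 / a * b = c" using assms(3) by (simp add: 1(6)[symmetric])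
  moreover have "b \<noteq> 0" using assms(3) 1(4,6) by auto
  moreover have "g \<noteq> 0" using \<open>f' * g = h\<close> 1(3) by auto
  ultimately show ?thesis using 1(1,2) by (auto intro: ratio_genI)
qed

section \<open>The multiples of a torsion point on the cubic and on its cuspidal
  degeneration\<close>

subsection \<open>Torsion points\<close>

lemma sin_cos_period:
  fixes w :: real assumes "sin w = 0"
  shows "sin (2 * real d * w) = 0 \<and> cos (2 * real d * w) = 1"
proof (induction d)
  case (Suc d)
  have "2 * real (Suc d) * w = 2 * real d * w + 2 * w" by (simp add: algebra_simps)
  moreover have "sin (2 * w) = 0" "cos (2 * w) = 1"
    using assms by (simp_all add: sin_double cos_double_sin)
  ultimately show ?case using Suc by (simp only: sin_add cos_add) simp
qed simp

context
  fixes w :: real assumes w: "sin w = 0"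
begin

lemma sin_period: "sin (2 * real d * (w + z)) = sin (2 * real d * z)"
  and cos_period: "cos (2 * real d * (w + z)) = cos (2 * real d * z)"
  using sin_cos_period[OF w, of d] by (simp_all add: distrib_left sin_add cos_add)

lemma log_deriv_period: "log_deriv (w + z) = log_deriv z"
proof -
  have "cos w \<noteq> 0" using w by (metis cos_zero sin_cos_squared_add sin_zero power2_eq_square mult_zero_left add_0 zero_neq_one)
  then have "cot (w + z) = cot z"
    by (simp add: cot_def sin_add cos_add w)
  then show ?thesis by (simp add: log_deriv_def sin_series_def sin_period)
qed

lemma wp_period: "wp (w + z) = wp z"
  by (simp add: wp_def log_deriv_period heat_pot_def cos_series_def cos_period)

end

lemma wp_minus: "wp (- z) = wp z"
  by (simp add: wp_def log_deriv_minus heat_pot_minus)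

lemma cos_series_nth_0: "cos_series z $ 0 = 0"
  by (simp add: cos_series_def)

lemma heat_pot_nth_0: "heat_pot z $ 0 = 1"
  by (simp add: heat_pot_def cos_series_nth_0)

lemma wp_nth_0: assumes "sin z \<noteq> 0" shows "wp z $ 0 = 1 / sin z ^ 2 - 1 / 3"
proof -
  have "wp z $ 0 = cot z ^ 2 + 1 - 1 / 3"
    by (simp add: wp_def eis2_def heat_pot_nth_0 power2_eq_square log_deriv_nth_0)
  also have "cot z ^ 2 + 1 = 1 / sin z ^ 2"
    using assms sin_cos_squared_add[of z] by (simp add: cot_def field_simps)
  finally show ?thesis .
qed

text \<open>n is the order of \<alpha> modulo \<pi>. For 1 \<le> k and k + 1 < n the points
  \<alpha>, k \<alpha> and (k + 1) \<alpha> avoid the poles, so their chord is available.\<close>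

locale torsion =
  fixes \<alpha> :: real and n :: nat
  assumes n3: "n \<ge> 3" and sin_n: "sin (real n * \<alpha>) = 0"
    and sin_k: "\<And>k. 1 \<le> k \<Longrightarrow> k < n \<Longrightarrow> sin (real k * \<alpha>) \<noteq> 0"
begin

definition lam :: "nat \<Rightarrow> real fps" where "lam k = slope \<alpha> (real k * \<alpha>)"
definition dif :: "nat \<Rightarrow> real fps" where "dif k = wp (real k * \<alpha>) - wp \<alpha>"

lemma sin_1: "sin \<alpha> \<noteq> 0"
  using sin_k[of 1] n3 by simp

lemma cos_1: "cos \<alpha> \<noteq> 0"
  using sin_k[of 2] n3 by (auto simp: sin_double)

lemma add_Suc: "\<alpha> + real k * \<alpha> = real (Suc k) * \<alpha>"
  by (simp add: algebra_simps)

lemma sin_k_add: "k + 1 < n \<Longrightarrow> sin (\<alpha> + real k * \<alpha>) \<noteq> 0"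
  unfolding add_Suc by (rule sin_k) simp_all

lemma dif_Suc:
  assumes "1 \<le> k" "k + 1 < n" shows "dif (Suc k) = lam k ^ 2 - 3 * wp \<alpha> - dif k"
proof -
  have "lam k ^ 2 = wp \<alpha> + wp (real k * \<alpha>) + wp (real (Suc k) * \<alpha>)"
    unfolding lam_def add_Suc[symmetric]
    by (rule slope_square) (use assms sin_1 sin_k[of k] sin_k_add[of k] in auto)
  then show ?thesis by (simp add: dif_def)
qed

text \<open>The point (k + 1) \<alpha> is involved in two consecutive chords. Adding the two chord
  formulas eliminates its wp', so \<open>dif\<close> and \<open>lam\<close> obey a recursion over wp
  and wp' at \<alpha> alone.\<close>

lemma lam_Suc:
  assumes "1 \<le> k" "k + 2 < n" shows "(lam k + lam (Suc k)) * dif (Suc k) = wp_d \<alpha>"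
proof -
  have "2 * lam k * dif (Suc k) = wp_d \<alpha> + wp_d (real (Suc k) * \<alpha>)"
    unfolding lam_def dif_def add_Suc[symmetric]
    by (rule slope_mult_wp_add) (use assms sin_1 sin_k[of k] sin_k_add[of k] in auto)
  moreover have "2 * lam (Suc k) * dif (Suc k) = wp_d \<alpha> - wp_d (real (Suc k) * \<alpha>)"
    unfolding lam_def dif_def
    by (rule slope_mult_wp_diff) (use assms sin_1 sin_k[of "Suc k"] sin_k_add[of "Suc k"] in auto)
  ultimately have "2 * ((lam k + lam (Suc k)) * dif (Suc k)) = 2 * wp_d \<alpha>"
    by algebra
  then show ?thesis by (rule fps_two_cancel)
qed

text \<open>At q = 0 the values of wp agree only if (k + 1) \<alpha> and \<alpha> are equal or
  opposite modulo \<pi>, that is, if k \<alpha> or (k + 2) \<alpha> is a multiple of \<pi>.\<close>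

lemma dif_nth_0:
  assumes "1 \<le> k" "k + 2 < n" shows "dif (Suc k) $ 0 \<noteq> 0"
proof
  have s: "sin (real (Suc k) * \<alpha>) \<noteq> 0" by (rule sin_k) (use assms in auto)
  assume "dif (Suc k) $ 0 = 0"
  then have eq: "sin (real (Suc k) * \<alpha>) ^ 2 = sin \<alpha> ^ 2"
    using s sin_1 by (simp add: dif_def wp_nth_0 field_simps del: of_nat_Suc)
  have "sin (real (Suc k) * \<alpha> + \<alpha>) * sin (real (Suc k) * \<alpha> - \<alpha>) =
      sin (real (Suc k) * \<alpha>) ^ 2 * cos \<alpha> ^ 2 - cos (real (Suc k) * \<alpha>) ^ 2 * sin \<alpha> ^ 2"
    unfolding sin_add sin_diff by algebra
  also have "\<dots> = 0" unfolding cos_squared_eq eq by simp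
  finally have "sin (real (Suc k) * \<alpha> + \<alpha>) = 0 \<or> sin (real (Suc k) * \<alpha> - \<alpha>) = 0"
    by simp
  moreover have "real (Suc k) * \<alpha> + \<alpha> = real (k + 2) * \<alpha>" "real (Suc k) * \<alpha> - \<alpha> = real k * \<alpha>"
    by (simp_all add: algebra_simps)
  ultimately show False
    using sin_k[of k] sin_k[of "k + 2"] assms by (simp del: of_nat_add of_nat_Suc)
qed

lemma last_point: "real (n - 1) * \<alpha> = real n * \<alpha> + - \<alpha>"
  using n3 by (simp add: of_nat_diff algebra_simps)

lemma dif_last: "dif (n - 1) = 0"
  unfolding dif_def last_point wp_period[OF sin_n] wp_minus by simp

text \<open>The slopes telescope, and A at (n - 1) \<alpha> is - A at \<alpha>. This expresses A
  through chord slopes.\<close>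

lemma sum_lam: "(\<Sum>k=1..n-2. lam k) = of_nat n * log_deriv \<alpha>"
proof -
  have "(\<Sum>k=1..m. lam k) = of_nat (m + 1) * log_deriv \<alpha> - log_deriv (real (Suc m) * \<alpha>)" for m
  proof (induction m)
    case (Suc m)
    have "lam (Suc m) = log_deriv \<alpha> + log_deriv (real (Suc m) * \<alpha>) - log_deriv (real (Suc (Suc m)) * \<alpha>)"
      by (simp only: lam_def slope_def add_Suc)
    moreover have "of_nat (Suc m + 1) = of_nat (m + 1) + (1 :: real fps)" by simp
    moreover have "(\<Sum>k=1..Suc m. lam k) = (\<Sum>k=1..m. lam k) + lam (Suc m)" by simp
    ultimately show ?case unfolding Suc by (simp only: distrib_right mult_1) (simp only: algebra_simps)
  qed simp
  from this[of "n - 2"]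
  have "(\<Sum>k=1..n-2. lam k) = of_nat (n - 2 + 1) * log_deriv \<alpha> - log_deriv (real (Suc (n - 2)) * \<alpha>)" .
  moreover have "Suc (n - 2) = n - 1" "n - 2 + 1 = n - 1" using n3 by auto
  moreover have "of_nat n = of_nat (n - 1) + (1 :: real fps)"
    using n3 by (simp add: of_nat_diff)
  ultimately show ?thesis
    by (simp only: last_point log_deriv_period[OF sin_n] log_deriv_minus distrib_right)
       (simp only: mult_1 diff_minus_eq_add)
qed

lemma lam_1: "lam 1 = slope \<alpha> \<alpha>"
  by (simp add: lam_def)

lemma lam_1_nth_0: "lam 1 $ 0 \<noteq> 0"
proof -
  have "lam 1 $ 0 = 2 * cot \<alpha> - cot (2 * \<alpha>)"
    by (simp add: lam_def slope_def log_deriv_nth_0)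
  also have "cot (2 * \<alpha>) = (cos \<alpha> ^ 2 - sin \<alpha> ^ 2) / (2 * sin \<alpha> * cos \<alpha>)"
    by (simp only: cot_def sin_double cos_double)
  also have "2 * cot \<alpha> - \<dots> = (3 * cos \<alpha> ^ 2 + sin \<alpha> ^ 2) / (2 * sin \<alpha> * cos \<alpha>)"
    using sin_1 cos_1 by (simp add: cot_def field_simps power2_eq_square)
  also have "\<dots> \<noteq> 0"
  proof -
    have "3 * cos \<alpha> ^ 2 + sin \<alpha> ^ 2 > 0"
      using sin_1 by (intro add_nonneg_pos) auto
    then show ?thesis using sin_1 cos_1 by simp
  qed
  finally show ?thesis .
qed

definition li where "li = inverse (lam 1)"

lemma lam_li: "lam 1 * li = 1"
  unfolding li_def by (rule inverse_mult_eq_1'[OF lam_1_nth_0])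

text \<open>The recursion for \<open>lam\<close> and \<open>dif\<close> does not involve A. Scaling
  by the first slope instead of A therefore leaves only two generators.\<close>

definition X0 where "X0 = wp \<alpha> * li ^ 2"
definition Y0 where "Y0 = wp_d \<alpha> * li ^ 3"

text \<open>The values of \<open>lam\<close> and \<open>dif\<close> on the cuspidal cubic, where \<open>wp z = 1 / z\<^sup>2\<close> and
  \<open>log_deriv z = 1 / z\<close>, at the point \<open>z = 3 / 2\<close>, which makes the first slope 1. A point of the
  additive group is not torsion, so \<open>dif_c\<close> does not vanish.\<close>

definition lam_c :: "nat \<Rightarrow> real" where "lam_c k = 2 / 3 * (1 + 1 / real k - 1 / real (Suc k))"
definition dif_c :: "nat \<Rightarrow> real" where "dif_c k = 4 / 9 * (1 / real k ^ 2 - 1)"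

text \<open>The point is (1 / z^2, - 2 / z^3) at z = 3 / 2, the values of wp and wp' on the
  cusp.\<close>

abbreviation "RG \<equiv> ratio_gen X0 Y0 (4 / 9) (- (16 / 27))"

lemma dif_c_Suc:
  assumes "k \<ge> 1" shows "dif_c (Suc k) = lam_c k * lam_c k - 3 * (4 / 9) - dif_c k"
proof -
  define a b where "a = 1 / real k" and "b = 1 / real (Suc k)"
  have "a * b = a - b" using assms by (simp add: a_def b_def field_simps)
  then have "4 / 9 * (b ^ 2 - 1) = 2 / 3 * (1 + a - b) * (2 / 3 * (1 + a - b)) - 3 * (4 / 9) - 4 / 9 * (a ^ 2 - 1)"
    by algebra
  then show ?thesis
    by (simp only: dif_c_def lam_c_def a_def b_def power_one_over)
qed

lemma dif_c_neq_0:
  assumes "k \<ge> 2" shows "dif_c k \<noteq> 0"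
proof -
  have "real k ^ 2 > 1 ^ 2" using assms by (intro power_strict_mono) auto
  moreover have "0 < real k ^ 2" using assms by simp
  ultimately have "1 / real k ^ 2 < 1" by (simp add: divide_less_eq_1_pos)
  then show ?thesis unfolding dif_c_def by simp
qed

lemma lam_c_Suc:
  assumes "k \<ge> 1" shows "lam_c (Suc k) = - (16 / 27) * (1 / dif_c (Suc k)) - lam_c k"
proof -
  define x a b c where "x = real k" and "a = 1 / x" and "b = 1 / (x + 1)" and "c = 1 / (x + 2)"
  have "x > 0" using assms by (simp add: x_def)
  then have "x * a = 1" "(x + 1) * b = 1" "(x + 2) * c = 1" by (simp_all add: a_def b_def c_def)
  then have "(2 / 3 * (1 + a - b) + 2 / 3 * (1 + b - c)) * (4 / 9 * (b ^ 2 - 1)) = - (16 / 27)"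
    by algebra
  moreover have "real (Suc k) = x + 1" "real (Suc (Suc k)) = x + 2" by (simp_all add: x_def)
  ultimately have "(lam_c k + lam_c (Suc k)) * dif_c (Suc k) = - (16 / 27)"
    by (simp only: lam_c_def dif_c_def a_def b_def c_def x_def power_one_over)
  then have "lam_c k + lam_c (Suc k) = - (16 / 27) / dif_c (Suc k)"
    using dif_c_neq_0[of "Suc k"] assms by (subst nonzero_eq_divide_eq) auto
  then show ?thesis by simp
qed

lemma X0_RG: "(X0, 4 / 9) \<in> RG" and Y0_RG: "(Y0, - (16 / 27)) \<in> RG"
  by (intro ratio_gen_base two_gen.gen1 two_gen.gen2)+

lemma dif_RG_step:
  assumes "1 \<le> k" "k + 1 < n" "(lam k * li, lam_c k) \<in> RG" "(dif k * li ^ 2, dif_c k) \<in> RG"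
  shows "(dif (Suc k) * li ^ 2, dif_c (Suc k)) \<in> RG"
proof -
  have "(lam k * li * (lam k * li) - fps_const 3 * X0 - dif k * li ^ 2,
      lam_c k * lam_c k - 3 * (4 / 9) - dif_c k) \<in> RG"
    by (intro ratio_gen_diff ratio_gen_mult ratio_gen_const assms X0_RG)
  moreover have "dif (Suc k) * li ^ 2 = lam k * li * (lam k * li) - fps_const 3 * X0 - dif k * li ^ 2"
    unfolding dif_Suc[OF assms(1,2)] X0_def numeral_fps_const[symmetric] by algebra
  ultimately show ?thesis by (simp only: dif_c_Suc[OF assms(1)])
qed

text \<open>The series and the cuspidal values satisfy the same recursion. The division in it is
  legitimate on both sides, by \<open>dif_nth_0\<close> and \<open>dif_c_neq_0\<close>.\<close>

lemma lam_dif_RG: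
  "1 \<le> k \<Longrightarrow> k + 1 < n \<Longrightarrow> (lam k * li, lam_c k) \<in> RG \<and> (dif k * li ^ 2, dif_c k) \<in> RG"
proof (induction k rule: dec_induct)
  case base
  have "lam_c 1 = 1" "dif_c 1 = 0" "dif 1 = 0"
    by (simp_all add: lam_c_def dif_c_def dif_def)
  then show ?case using ratio_gen_const[of 1 X0 Y0] ratio_gen_const[of 0 X0 Y0] by (simp add: lam_li[simplified])
next
  case (step k)
  then have IH: "(lam k * li, lam_c k) \<in> RG" "(dif k * li ^ 2, dif_c k) \<in> RG" by auto
  have k: "1 \<le> k" "k + 1 < n" "k + 2 < n" using step by auto
  have D: "(dif (Suc k) * li ^ 2, dif_c (Suc k)) \<in> RG"
    by (rule dif_RG_step[OF k(1,2) IH])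
  define g where "g = inverse (dif (Suc k) * li ^ 2)"
  have li0: "li $ 0 \<noteq> 0" using lam_1_nth_0 by (simp add: li_def)
  have g: "g * (dif (Suc k) * li ^ 2) = 1"
    unfolding g_def by (rule inverse_mult_eq_1) (use dif_nth_0[OF k(1,3)] li0 in \<open>simp add: power2_eq_square\<close>)
  have "(g, 1 / dif_c (Suc k)) \<in> RG"
    by (rule ratio_gen_inverse[OF D g dif_c_neq_0]) (use k in simp)
  then have "(Y0 * g - lam k * li, - (16 / 27) * (1 / dif_c (Suc k)) - lam_c k) \<in> RG"
    by (intro ratio_gen_diff ratio_gen_mult Y0_RG IH)
  moreover have "Y0 * g - lam k * li = lam (Suc k) * li"
  proof -
    have "Y0 * g = (lam k + lam (Suc k)) * li * (g * (dif (Suc k) * li ^ 2))"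
      unfolding Y0_def lam_Suc[OF k(1,3), symmetric] by algebra
    then show ?thesis unfolding g by (simp add: algebra_simps)
  qed
  ultimately show ?case
    using D by (simp only: lam_c_Suc[OF k(1)] simp_thms)
qed

text \<open>One more step reaches (n - 1) \<alpha>, where the series \<open>dif\<close> vanishes but
  its cuspidal value does not: this is the non-trivial relation.\<close>

lemma growth_X0_Y0: "growth_linear {X0, Y0}"
proof -
  have "(dif (Suc (n - 2)) * li ^ 2, dif_c (Suc (n - 2))) \<in> RG"
    using n3 lam_dif_RG[of "n - 2"] by (intro dif_RG_step) auto
  moreover have "Suc (n - 2) = n - 1" using n3 by simp
  ultimately have "(0, dif_c (n - 1)) \<in> RG" using dif_last by simp
  then obtain g b h c where "(g, b) \<in> two_gen X0 Y0 (4 / 9) (- (16 / 27))"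
    "c \<noteq> 0" "0 * h = g" "dif_c (n - 1) * c = b" by (rule ratio_genE)
  moreover have "dif_c (n - 1) \<noteq> 0" by (rule dif_c_neq_0) (use n3 in simp)
  ultimately show ?thesis using growth_linear_two[of b X0 Y0] by auto
qed

text \<open>A is the sum of the slopes divided by n; here the existence of some cuspidal value is
  enough.\<close>

lemma log_deriv_ratio:
  obtains g h where "g \<in> pol {X0, Y0}" "h \<in> pol {X0, Y0}" "h \<noteq> 0" "log_deriv \<alpha> * li * h = g"
proof -
  have "\<exists>a. ((\<Sum>k=1..m. lam k * li), a) \<in> RG" if "m + 1 < n" for m
    using that
  proof (induction m)
    case 0
    show ?case using ratio_gen_const[of 0 X0 Y0] by auto
  next
    case (Suc m)
    then obtain a where "((\<Sum>k=1..m. lam k * li), a) \<in> RG" by auto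
    from ratio_gen_add[OF this conjunct1[OF lam_dif_RG[of "Suc m"]]] Suc.prems
    show ?case by auto
  qed
  moreover have "n - 2 + 1 < n" using n3 by simp
  ultimately obtain a where "((\<Sum>k=1..n-2. lam k * li), a) \<in> RG" by blast
  then have "(fps_const (1 / real n) * (of_nat n * log_deriv \<alpha> * li), 1 / real n * a) \<in> RG"
    unfolding sum_distrib_right[symmetric] sum_lam by (intro ratio_gen_mult ratio_gen_const)
  moreover have "fps_const (1 / real n) * (of_nat n * log_deriv \<alpha> * li) = log_deriv \<alpha> * li"
    using n3 by (simp add: fps_of_nat[symmetric] mult.assoc[symmetric])
  ultimately show thesis
    using that two_gen_pol by (metis ratio_genE)
qed

end

section \<open>Passing from q to the variable R\<close>

subsection \<open>Compositional inverses\<close>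

lemma fps_inv_compose:
  fixes R S :: "real fps"
  assumes R: "R $ 0 = 0" "R $ 1 \<noteq> 0" and S: "S $ 0 = 0" "S $ 1 \<noteq> 0"
  shows "fps_inv (R oo fps_inv S) = S oo fps_inv R"
proof -
  have i0: "fps_inv F $ 0 = 0" for F :: "real fps" by (simp add: fps_inv_def)
  let ?W = "R oo fps_inv S"
  have W0: "?W $ 0 = 0" using R(1) by simp
  have "(S oo fps_inv R) oo ?W = S oo (fps_inv R oo ?W)"
    by (rule fps_compose_assoc[symmetric]) (use W0 i0 in auto)
  also have "fps_inv R oo ?W = (fps_inv R oo R) oo fps_inv S"
    by (rule fps_compose_assoc) (use R i0 in auto)
  also have "\<dots> = fps_inv S"
    using fps_inv[OF R] i0[of S] by (simp add: fps_X_fps_compose_startby0)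
  also have "S oo fps_inv S = fps_X" by (rule fps_inv_right[OF S])
  finally have VW: "(S oo fps_inv R) oo ?W = fps_X" .
  \<comment> \<open>The left inverse just found forces a nonzero linear coefficient of
    \<open>?W\<close>, which gives the right inverse needed for cancellation.\<close>
  have "((S oo fps_inv R) oo ?W) $ 1 = (S oo fps_inv R) $ 1 * ?W $ 1"
    using W0 by (simp add: fps_compose_nth S(1))
  then have W1: "?W $ 1 \<noteq> 0" unfolding VW by auto
  have "S oo fps_inv R = (S oo fps_inv R) oo (?W oo fps_inv ?W)"
    by (simp add: fps_inv_right[OF W0 W1])
  also have "\<dots> = ((S oo fps_inv R) oo ?W) oo fps_inv ?W"
    by (rule fps_compose_assoc) (use W0 i0 in auto)
  also have "\<dots> = fps_inv ?W"
    unfolding VW using i0[of ?W] by (simp add: fps_X_fps_compose_startby0)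
  finally show ?thesis by simp
qed

definition dR :: "real fps \<Rightarrow> real fps \<Rightarrow> real fps" where
  "dR R F = fps_deriv F * inverse (fps_deriv R)"

text \<open>By the chain rule, substituting the inverse of R turns \<open>dR\<close> into the
  ordinary derivative; relations can thus be found among series in q.\<close>

lemma fps_deriv_compose_fps_inv:
  fixes R F :: "real fps"
  assumes R: "R $ 0 = 0" "R $ 1 \<noteq> 0"
  shows "(fps_deriv ^^ i) (F oo fps_inv R) = ((dR R ^^ i) F) oo fps_inv R"
proof (induction i)
  case (Suc i)
  let ?Q = "fps_inv R" and ?G = "(dR R ^^ i) F"
  have Q0: "?Q $ 0 = 0" by (simp add: fps_inv_def)
  have R': "fps_deriv R $ 0 \<noteq> 0" using R(2) by simp
  have "fps_deriv (R oo ?Q) = 1" using fps_inv_right[OF R] by simp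
  then have "(fps_deriv R oo ?Q) * fps_deriv ?Q = 1"
    by (simp add: fps_compose_deriv[OF Q0])
  moreover have "(inverse (fps_deriv R) oo ?Q) * (fps_deriv R oo ?Q) = 1"
    unfolding fps_compose_mult_distrib[OF Q0, symmetric] by (simp add: inverse_mult_eq_1[OF R'])
  ultimately have "fps_deriv ?Q = inverse (fps_deriv R) oo ?Q"
    by (metis mult.assoc mult_1 mult_1_right)
  then show ?case
    by (simp add: Suc fps_compose_deriv[OF Q0] dR_def fps_compose_mult_distrib[OF Q0])
qed simp

lemma dfinite_compose_fps_inv:
  fixes R T :: "real fps"
  assumes R: "R $ 0 = 0" "R $ 1 \<noteq> 0"
    and c: "\<exists>i\<le>k. \<exists>j\<le>k. c i j \<noteq> 0"
    and rel: "(\<Sum>i\<le>k. \<Sum>j\<le>k. fps_const (c i j) * (R ^ j * (dR R ^^ i) T)) = 0"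
  shows "dfinite (T oo fps_inv R)"
proof -
  let ?Q = "fps_inv R"
  have Q0: "?Q $ 0 = 0" by (simp add: fps_inv_def)
  define p where "p i = (\<Sum>j\<le>k. monom (c i j) j)" for i
  have coeff: "coeff (p i) j = c i j" if "j \<le> k" for i j
    using that by (simp add: p_def coeff_sum)
  have "(\<Sum>i\<le>k. fps_of_poly (p i) * (fps_deriv ^^ i) (T oo ?Q)) =
      (\<Sum>i\<le>k. \<Sum>j\<le>k. fps_const (c i j) * (fps_X ^ j * (((dR R ^^ i) T) oo ?Q)))"
    by (simp add: p_def fps_of_poly_sum fps_of_poly_monom sum_distrib_right mult.assoc
        fps_deriv_compose_fps_inv[OF R])
  also have "\<dots> = (\<Sum>i\<le>k. \<Sum>j\<le>k. fps_const (c i j) * (R ^ j * (dR R ^^ i) T)) oo ?Q"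
    by (simp add: fps_compose_sum_distrib fps_compose_mult_distrib[OF Q0] fps_compose_power[OF Q0, symmetric]
        fps_inv_right[OF R])
  also have "\<dots> = 0" unfolding rel by simp
  finally have "(\<Sum>i\<le>k. fps_of_poly (p i) * (fps_deriv ^^ i) (T oo ?Q)) = 0" .
  moreover have "\<exists>i\<le>k. p i \<noteq> 0" using c coeff by (metis coeff_0)
  ultimately show ?thesis unfolding dfinite_def by blast
qed


subsection \<open>The theorem\<close>

context torsion
begin

text \<open>Chosen so that q dR/dq = A^2 \<rho>. Then \<rho> d/dR is A^(-2) q d/dq, which preserves
  weight zero and sends X, Y, L to polynomials in X, Y, L.\<close>

definition \<rho> where "\<rho> = fps_const (cos \<alpha> ^ 2 / (96 * sin \<alpha> ^ 4) / 8) * R_rate \<alpha>"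

abbreviation "cT \<equiv> cos \<alpha> / (64 * sin \<alpha> ^ 3)"
abbreviation "cR \<equiv> cos \<alpha> ^ 2 / (96 * sin \<alpha> ^ 4)"

lemmas sc = sin_1 cos_1

lemma cT_cR_neq_0: "cT \<noteq> 0" "cR \<noteq> 0"
  using sc by simp_all

lemma euler_R: "euler (R_of_q \<alpha>) = log_deriv \<alpha> ^ 2 * \<rho>"
proof -
  have "8 * euler (R_of_q \<alpha>) = fps_const cR * (8 * euler (R_norm \<alpha>))"
    by (simp add: R_of_q_eq[OF sc] euler_mult euler_const)
  also have "\<dots> = 8 * (log_deriv \<alpha> ^ 2 * \<rho>)"
  proof -
    have "8 * \<rho> = fps_const cR * R_rate \<alpha>"
      by (simp add: \<rho>_def numeral_fps_const mult.assoc[symmetric])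
    then show ?thesis unfolding euler_R_norm[OF sc] by algebra
  qed
  finally show ?thesis by simp
qed

lemma deriv_T: "fps_deriv (T_ser \<alpha>) = fps_const (2 * cT / (3 * cR)) * log_deriv \<alpha> * fps_deriv (R_of_q \<alpha>)"
proof -
  have c: "fps_const (2 * cT / (3 * cR)) * fps_const cR * 3 = fps_const cT * (2 :: real fps)"
  proof -
    have "2 * x / (3 * y) * y * 3 = x * 2" if "y \<noteq> 0" for x y :: real
      using that by simp
    from this[OF cT_cR_neq_0(2)] have "2 * cT / (3 * cR) * cR * 3 = cT * 2" .
    then have "fps_const (2 * cT / (3 * cR) * cR * 3) = fps_const (cT * 2)" by (simp only:)
    then show ?thesis by (simp only: fps_const_mult[symmetric] numeral_fps_const)
  qed
  have "3 * fps_deriv (T_ser \<alpha>) = fps_const cT * (3 * fps_deriv (T_norm \<alpha>))"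
    by (simp add: T_ser_eq[OF sc])
  also have "\<dots> = (fps_const cT * 2) * log_deriv \<alpha> * fps_deriv (R_norm \<alpha>)"
    unfolding deriv_T_norm[OF sc] by (simp only: mult_ac)
  also have "\<dots> = 3 * (fps_const (2 * cT / (3 * cR)) * log_deriv \<alpha> * fps_deriv (R_of_q \<alpha>))"
    unfolding c[symmetric] R_of_q_eq[OF sc] by (simp add: mult_ac)
  finally show ?thesis by (rule fps_cancel) simp
qed

lemma eis2_nth_0: "eis2 $ 0 = - 1 / 3"
  by (simp add: eis2_def heat_pot_nth_0)

lemma R_nth_0: "R_of_q \<alpha> $ 0 = 0"
proof -
  define t where "t = inverse (cot \<alpha>)"
  have ct: "cot \<alpha> * t = 1" using sc by (simp add: t_def cot_def)
  have w: "wp \<alpha> $ 0 = cot \<alpha> ^ 2 + 1 - 1 / 3"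
    by (simp add: wp_def eis2_def heat_pot_nth_0 power2_eq_square log_deriv_nth_0)
  have "wp_d \<alpha> $ 0 = 2 * cot \<alpha> * (- 1 / 3 - (cot \<alpha> ^ 2 + 1 - 1 / 3))"
    by (simp add: wp_d_def euler_nth log_deriv_nth_0 w eis2_nth_0)
  then have "R_norm \<alpha> $ 0 = 2 * cot \<alpha> * (- 1 / 3 - (cot \<alpha> ^ 2 + 1 - 1 / 3)) * t ^ 3
      + 3 * ((cot \<alpha> ^ 2 + 1 - 1 / 3) * t ^ 2) - 1"
    by (simp add: R_norm_def[OF sc] wp_norm_def[OF sc] wp_d_norm_def[OF sc] w log_deriv_nth_0 t_def fps_power_zeroth)
  also have "\<dots> = 0" using ct by algebra
  finally show ?thesis by (simp add: R_of_q_eq[OF sc])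
qed

lemma T_nth_0: "T_ser \<alpha> $ 0 = 0"
  by (simp add: T_ser_eq[OF sc] T_norm_def[OF sc] euler_nth)

text \<open>The prefactor cos \<alpha> / (64 sin^3 \<alpha>) normalises this coefficient to
  1.\<close>

lemma T_nth_1: "T_ser \<alpha> $ 1 \<noteq> 0"
proof -
  have "log_deriv \<alpha> $ 1 = 4 * sin (2 * \<alpha>)"
    by (simp add: log_deriv_def sin_series_def numeral_fps_const)
  then have "T_ser \<alpha> $ 1 = cT * (8 * (4 * sin (2 * \<alpha>)) * inverse (cot \<alpha>) ^ 2)"
    by (simp add: T_ser_eq[OF sc] T_norm_def[OF sc] fps_mult_nth_1 euler_nth numeral_fps_const log_deriv_nth_0 fps_power_zeroth)
  also have "\<dots> \<noteq> 0" using sc by (simp add: cot_def sin_double)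
  finally show ?thesis .
qed

text \<open>T' is a multiple of A R', so a vanishing linear coefficient of R would force that of T
  to vanish.\<close>

lemma R_nth_1: "R_of_q \<alpha> $ 1 \<noteq> 0"
proof
  assume "R_of_q \<alpha> $ 1 = 0"
  then have "fps_deriv (T_ser \<alpha>) $ 0 = 0"
    unfolding deriv_T by simp
  with T_nth_1 show False by simp
qed

abbreviation "G \<equiv> {wp_norm \<alpha>, wp_d_norm \<alpha>, slope_norm \<alpha>}"

lemma deriv_R_inverse: "fps_deriv (R_of_q \<alpha>) * inverse (fps_deriv (R_of_q \<alpha>)) = 1"
  by (rule inverse_mult_eq_1') (use R_nth_1 in simp)

lemma \<rho>_dR: "log_deriv \<alpha> ^ 2 * (\<rho> * dR (R_of_q \<alpha>) F) = euler F"
proof -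
  have "log_deriv \<alpha> ^ 2 * (\<rho> * dR (R_of_q \<alpha>) F) = euler (R_of_q \<alpha>) * dR (R_of_q \<alpha>) F"
    by (simp only: euler_R mult.assoc)
  also have "\<dots> = euler F"
    using deriv_R_inverse unfolding euler_def dR_def by algebra
  finally show ?thesis .
qed

lemma \<rho>_dR_eq:
  assumes "fps_const c * euler F = log_deriv \<alpha> ^ 2 * P" "c \<noteq> 0"
  shows "\<rho> * dR (R_of_q \<alpha>) F = fps_const (1 / c) * P"
proof -
  have "log_deriv \<alpha> ^ 2 * (fps_const c * (\<rho> * dR (R_of_q \<alpha>) F)) = log_deriv \<alpha> ^ 2 * P"
    using assms(1) \<rho>_dR[of F] by algebra
  then have "fps_const c * (\<rho> * dR (R_of_q \<alpha>) F) = P"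
    by (rule fps_cancel) (simp add: AA_neq_0[OF sc])
  then have "fps_const (1 / c) * fps_const c * (\<rho> * dR (R_of_q \<alpha>) F) = fps_const (1 / c) * P"
    by (simp only: mult.assoc)
  then show ?thesis using assms(2) by simp
qed

lemmas pol_intros = pol_add pol_diff pol_mult pol_power pol_const pol_numeral pol_one

lemma gens_pol: "wp_norm \<alpha> \<in> pol G" "wp_d_norm \<alpha> \<in> pol G" "slope_norm \<alpha> \<in> pol G"
  by (auto intro: pol_gen)

lemma \<rho>_pol: "\<rho> \<in> pol G"
  unfolding \<rho>_def R_rate_def[OF sc] by (intro pol_intros gens_pol)

lemma R_pol: "R_of_q \<alpha> \<in> pol G"
  unfolding R_of_q_eq[OF sc] R_norm_def[OF sc] by (intro pol_intros gens_pol)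

lemma dR_G: "g \<in> G \<Longrightarrow> \<rho> * dR (R_of_q \<alpha>) g \<in> pol G"
proof -
  have 1: "\<rho> * dR (R_of_q \<alpha>) (wp_norm \<alpha>) \<in> pol G"
  proof -
    have "fps_const 12 * euler (wp_norm \<alpha>) = log_deriv \<alpha> ^ 2 * (4 * wp_d_norm \<alpha> * slope_norm \<alpha> - 3 * wp_d_norm \<alpha> - 3 * wp_norm \<alpha> * wp_d_norm \<alpha>)"
      using euler_wp_norm[OF sc] by (simp only: numeral_fps_const)
    then show ?thesis by (subst \<rho>_dR_eq) (auto intro!: pol_intros gens_pol)
  qed
  have 2: "\<rho> * dR (R_of_q \<alpha>) (wp_d_norm \<alpha>) \<in> pol G"
  proof -
    have "fps_const 8 * euler (wp_d_norm \<alpha>) = log_deriv \<alpha> ^ 2 * (4 * wp_d_norm \<alpha> * slope_norm \<alpha> - 12 * wp_norm \<alpha> * wp_d_norm \<alpha> - 3 * wp_d_norm \<alpha> ^ 2)"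
      using euler_wp_d_norm[OF sc] by (simp only: numeral_fps_const)
    then show ?thesis by (subst \<rho>_dR_eq) (auto intro!: pol_intros gens_pol)
  qed
  have 3: "\<rho> * dR (R_of_q \<alpha>) (slope_norm \<alpha>) \<in> pol G"
  proof -
    have "fps_const 8 * euler (slope_norm \<alpha>) = log_deriv \<alpha> ^ 2 * (3 * wp_d_norm \<alpha> - wp_d_norm \<alpha> * slope_norm \<alpha> - 4 * slope_norm \<alpha> ^ 2 + 12 * wp_norm \<alpha>)"
      using euler_slope_norm[OF sc] by (simp only: numeral_fps_const)
    then show ?thesis by (subst \<rho>_dR_eq) (auto intro!: pol_intros gens_pol)
  qed
  assume "g \<in> G"
  with 1 2 3 show ?thesis by auto
qed

lemma \<rho>_neq_0: "\<rho> \<noteq> 0"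
proof
  assume "\<rho> = 0"
  then have "euler (R_of_q \<alpha>) $ 1 = 0" unfolding euler_R by simp
  with R_nth_1 show False by (simp add: euler_nth)
qed

lemma dR_T: "dR (R_of_q \<alpha>) (T_ser \<alpha>) = fps_const (2 * cT / (3 * cR)) * log_deriv \<alpha>"
  unfolding dR_def deriv_T mult.assoc deriv_R_inverse by simp

lemma dR_log_deriv: "\<rho> * dR (R_of_q \<alpha>) (log_deriv \<alpha>) = fps_const (1 / (8 * cT)) * T_ser \<alpha>"
proof -
  have "fps_const 8 * euler (log_deriv \<alpha>) = log_deriv \<alpha> ^ 2 * T_norm \<alpha>"
    using euler_AA[OF sc] by (simp only: numeral_fps_const mult.commute)
  then have "\<rho> * dR (R_of_q \<alpha>) (log_deriv \<alpha>) = fps_const (1 / 8) * T_norm \<alpha>"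
    by (rule \<rho>_dR_eq) simp
  also have "\<dots> = fps_const (1 / (8 * cT)) * T_ser \<alpha>"
  proof -
    have "1 / 8 = 1 / (8 * x) * x" if "x \<noteq> 0" for x :: real
      using that by simp
    from this[OF cT_cR_neq_0(1)] have "1 / 8 = 1 / (8 * cT) * cT" .
    then have "fps_const (1 / 8) = fps_const (1 / (8 * cT)) * fps_const cT" by (simp only: fps_const_mult)
    then show ?thesis by (simp only: T_ser_eq[OF sc] mult.assoc)
  qed
  finally show ?thesis .
qed

text \<open>The quotient of A by the first slope is g / h, so L = h / g, X = X0 L^2 and Y = Y0 L^3;
  the cube of g clears all three.\<close>

lemma clear_denominator:
  obtains d where "d \<noteq> 0" "d \<in> pol {X0, Y0}" "\<And>g. g \<in> G \<Longrightarrow> d * g \<in> pol {X0, Y0}"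
proof -
  obtain g h where gh: "g \<in> pol {X0, Y0}" "h \<in> pol {X0, Y0}" "h \<noteq> 0" "log_deriv \<alpha> * li * h = g"
    by (rule log_deriv_ratio)
  have l: "lam 1 = slope_norm \<alpha> * log_deriv \<alpha>" unfolding lam_1 by (rule slope_eq_norm[OF sc])
  have L: "slope_norm \<alpha> * g = h"
    using lam_li gh(4) unfolding l by algebra
  have XY: "X0 * slope_norm \<alpha> ^ 2 = wp_norm \<alpha>" "Y0 * slope_norm \<alpha> ^ 3 = wp_d_norm \<alpha>"
    using lam_li unfolding l X0_def Y0_def wp_eq_norm[OF sc] wp_d_eq_norm[OF sc] by algebra+
  have "g \<noteq> 0" using L gh(3) by auto
  have P: "X0 \<in> pol {X0, Y0}" "Y0 \<in> pol {X0, Y0}" by (auto intro: pol_gen)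
  have "g ^ 3 * wp_norm \<alpha> = X0 * (g * h ^ 2)" "g ^ 3 * wp_d_norm \<alpha> = Y0 * h ^ 3" "g ^ 3 * slope_norm \<alpha> = g ^ 2 * h"
    unfolding XY[symmetric] L[symmetric]
    by (simp_all only: power_mult_distrib power2_eq_square power3_eq_cube mult_ac)
  moreover have "X0 * (g * h ^ 2) \<in> pol {X0, Y0}" "Y0 * h ^ 3 \<in> pol {X0, Y0}" "g ^ 2 * h \<in> pol {X0, Y0}"
    by (intro pol_mult pol_power gh P)+
  ultimately have "g ^ 3 * u \<in> pol {X0, Y0}" if "u \<in> G" for u
    using that by auto
  moreover have "g ^ 3 \<noteq> 0" using \<open>g \<noteq> 0\<close> by simp
  ultimately show thesis using that pol_power[OF gh(1)] by blast
qed

lemma t_of_R_eq: "t_of_R \<alpha> = T_ser \<alpha> oo fps_inv (R_of_q \<alpha>)"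
  unfolding t_of_R_def R_ser_def q_of_t_def
  by (rule fps_inv_compose[OF R_nth_0 R_nth_1 T_nth_0 T_nth_1])

lemma dfinite_t_of_R: "dfinite (t_of_R \<alpha>)"
proof -
  let ?D = "dR (R_of_q \<alpha>)"
  have D: "?D (f + g) = ?D f + ?D g" "?D (f * g) = ?D f * g + f * ?D g" "?D (fps_const c) = 0" for f g c
    by (simp_all add: dR_def algebra_simps)
  obtain d where d: "d \<noteq> 0" "d \<in> pol {X0, Y0}" "\<And>g. g \<in> G \<Longrightarrow> d * g \<in> pol {X0, Y0}"
    using clear_denominator by blast
  have "finite G" by simp
  from counting[of G ?D \<rho>, OF this D dR_G dR_T dR_log_deriv \<rho>_pol \<rho>_neq_0 R_pol growth_X0_Y0 d]
  obtain k c where "\<exists>i\<le>k. \<exists>j\<le>k. c i j \<noteq> 0"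
    "(\<Sum>i\<le>k. \<Sum>j\<le>k. fps_const (c i j) * (R_of_q \<alpha> ^ j * (?D ^^ i) (T_ser \<alpha>))) = 0"
    by blast
  then show ?thesis
    unfolding t_of_R_eq by (rule dfinite_compose_fps_inv[OF R_nth_0 R_nth_1])
qed

end

theorem mainTheorem8:
  fixes M N :: int and \<alpha> \<gamma> :: real
  assumes "N \<noteq> 0"
    and "2 * real_of_int M / real_of_int N \<notin> \<int>"
    and "\<alpha> = real_of_int M / real_of_int N * pi"
    and "\<gamma> = - 2 * cos (2 * \<alpha>)"
  shows "dfinite (t_of_R \<alpha>)"
proof -
  have "sin (2 * \<alpha>) \<noteq> 0"
  proof
    assume "sin (2 * \<alpha>) = 0"
    then obtain i where "2 * \<alpha> = of_int i * pi" by (auto simp: sin_zero_iff_int2)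
    then have "2 * real_of_int M / real_of_int N * pi = of_int i * pi"
      by (simp add: assms(3))
    then have "2 * real_of_int M / real_of_int N = of_int i"
      by (simp only: mult_right_cancel[OF pi_neq_zero])
    with assms(2) show False by simp
  qed
  \<comment> \<open>The order of \<alpha> modulo \<pi> is the least such m. It exists because the
    absolute value of N qualifies, and it is neither 1 nor 2 because sin (2 \<alpha>) is
    nonzero.\<close>
  let ?P = "\<lambda>m. 0 < m \<and> sin (real m * \<alpha>) = 0"
  have "real (nat \<bar>N\<bar>) * \<alpha> = of_int (sgn N * M) * pi"
    using assms(1) by (simp add: assms(3) sgn_if abs_if field_simps)
  then have "sin (real (nat \<bar>N\<bar>) * \<alpha>) = 0"
    using sin_zero_iff_int2 by blast
  then have "?P (nat \<bar>N\<bar>)"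
    using assms(1) by simp
  then have P: "?P (LEAST m. ?P m)" by (rule LeastI)
  define n where "n = (LEAST m. ?P m)"
  have "n \<noteq> 1" "n \<noteq> 2"
    using P \<open>sin (2 * \<alpha>) \<noteq> 0\<close> unfolding n_def[symmetric] by (auto simp: sin_double)
  then have "n \<ge> 3" using P unfolding n_def[symmetric] by linarith
  moreover have "sin (real k * \<alpha>) \<noteq> 0" if "1 \<le> k" "k < n" for k
    using not_less_Least[of k ?P] that unfolding n_def by auto
  ultimately interpret torsion \<alpha> n
    by unfold_locales (use P in \<open>auto simp: n_def\<close>)
  show ?thesis by (rule dfinite_t_of_R)
qed

end
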